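(* Let $A=A(\Sigma)$ be a factorial cluster algebra over $K$ with principal coefficients (that is, $\Sigma=(\mathbf x,\mathbf y,B)$ is a seed with principal coefficients and $A(\Sigma)$ is a unique factorization domain). Let $z$ be a non-initial cluster variable of $A$ and let $F_z$ be the associated $F$-polynomial. Then $F_z$ is a prime element of $K[\mathbf y]$.
   Context: The base ring $K$ is either $\mathbb Z$ or a field of characteristic $0$; $[a,b]$ denotes the set of integers between $a$ and $b$. An exchange matrix is an $(n+m)\times n$ integer matrix $B=(b_{ij})$ ($n,m\ge 0$) whose principal part (the top $n\times n$ submatrix) is skew-symmetrizable, i.e. there are positive integers $d_1,\ldots,d_n$ with $d_ib_{ij}=-d_jb_{ji}$ for all $i,j\in[1,n]$. A seed is a triple $\Sigma=(\mathbf x,\mathbf y,B)$ with $\mathbf x=(x_1,\ldots,x_n)$ (exchangeable variables) and $\mathbf y=(x_{n+1},\ldots,x_{n+m})$ (frozen variables) together algebraically independent over $K$, and $B$ an $(n+m)\times n$ exchange matrix; its ambient field is $\mathcal F=\mathbf q(K)(x_1,\ldots,x_{n+m})$, where $\mathbf q$ denotes the quotient field. For $i\in[1,n]$ the exchange polynomial is $f_i=\prod_{j:\,b_{ji}>0}x_j^{b_{ji}}+\prod_{j:\,b_{ji}<0}x_j^{-b_{ji}}$, with $j$ ranging over $[1,n+m]$. The mutation $\mu_i(\Sigma)$ is the seed obtained by replacing $x_i$ by $x_i'=f_i/x_i\in\mathcal F$, keeping $\mathbf y$ and the other $x_j$, and replacing $B$ by $B'=(b'_{kl})$, where $b'_{kl}=-b_{kl}$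 if $k=i$ or $l=i$, and $b'_{kl}=b_{kl}+\tfrac12(|b_{ki}|b_{il}+b_{ki}|b_{il}|)$ otherwise. Let $\mathcal X$ be the set of all exchangeable variables of seeds obtained from $\Sigma$ by finite sequences of mutations; its elements are the cluster variables, and those not among $x_1,\ldots,x_n$ are non-initial. The cluster algebra (with all frozen variables invertible) is $A(\Sigma)=K[x,\,y,\,y^{-1}\mid x\in\mathcal X,\ y\in\mathbf y]\subseteq\mathcal F$. The seed has principal coefficients if $m=n$ and the $n\times n$ submatrix of $B$ formed by the last $n$ rows is the identity matrix. In this case every cluster variable $z$ lies in $K[x_1^{\pm1},\ldots,x_n^{\pm1},x_{n+1},\ldots,x_{2n}]$ (a known form of the Laurent phenomenon), and the $F$-polynomial $F_z\in K[\mathbf y]$ of a non-initial cluster variable $z$ is obtained from $z$ by substituting $x_1=\cdots=x_n=1$. *)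

theory Defs
  imports "HOL-Algebra.Algebra" "HOL-Algebra.Algebraic_Closure_Type" "HOL-Library.Poly_Mapping"
begin

text \<open>Everything takes place inside a field \<open>'f\<close> of characteristic \<open>0\<close> that contains the base ring
  \<open>K\<close> and the variables of the seed. The ambient field \<open>q(K)(x_1, \<dots>, x_{n+m})\<close> is a subfield of
  \<open>'f\<close>, possibly a proper one; none of the constructions below leaves it.\<close>

abbreviation subring_of :: "'f::field set \<Rightarrow> 'f ring" where
  "subring_of H \<equiv> ring_of_type_algebra\<lparr>carrier := H\<rparr>"

definition base_ring :: "'f::field_char_0 set \<Rightarrow> bool" where
  "base_ring K \<longleftrightarrow> K = \<int> \<or> subfield K ring_of_type_algebra"

definition adjoin :: "'f::field set \<Rightarrow> 'f set \<Rightarrow> 'f set" where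
  "adjoin K S = generate_ring ring_of_type_algebra (K \<union> S)"


subsection \<open>Polynomials, Laurent polynomials, algebraic independence\<close>

definition poly_eval :: "(nat \<Rightarrow> 'f) \<Rightarrow> ((nat \<Rightarrow>\<^sub>0 nat) \<Rightarrow>\<^sub>0 'f) \<Rightarrow> 'f::field" where
  "poly_eval x p =
     (\<Sum>e\<in>Poly_Mapping.keys p. Poly_Mapping.lookup p e *
        (\<Prod>i\<in>Poly_Mapping.keys e. x i ^ Poly_Mapping.lookup e i))"

definition laurent_eval :: "(nat \<Rightarrow> 'f) \<Rightarrow> ((nat \<Rightarrow>\<^sub>0 int) \<Rightarrow>\<^sub>0 'f) \<Rightarrow> 'f::field" where
  "laurent_eval x p =
     (\<Sum>e\<in>Poly_Mapping.keys p. Poly_Mapping.lookup p e *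
        (\<Prod>i\<in>Poly_Mapping.keys e. x i powi Poly_Mapping.lookup e i))"

definition algebraically_independent :: "'f::field set \<Rightarrow> nat set \<Rightarrow> (nat \<Rightarrow> 'f) \<Rightarrow> bool" where
  "algebraically_independent K I x \<longleftrightarrow>
     (\<forall>p. (\<forall>e. Poly_Mapping.lookup p e \<in> K) \<longrightarrow>
          (\<forall>e\<in>Poly_Mapping.keys p. Poly_Mapping.keys e \<subseteq> I) \<longrightarrow>
          poly_eval x p = 0 \<longrightarrow> p = 0)"


subsection \<open>Seeds and mutation\<close>

text \<open>\<open>n\<close> is the number of exchangeable and \<open>m\<close> the number of frozen variables. The family
  \<open>seed_x\<close> lists both: \<open>x_1, \<dots>, x_n\<close> are exchangeable and \<open>x_{n+1}, \<dots>, x_{n+m}\<close> are frozen.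
  The entry \<open>b_{ij}\<close> is \<open>seed_B S i j\<close>. Only the values of \<open>seed_x\<close> at indices in \<open>[1,n+m]\<close>
  and of \<open>seed_B\<close> at indices in \<open>[1,n+m] \<times> [1,n]\<close> are meaningful.\<close>

record 'f seed =
  seed_n :: nat
  seed_m :: nat
  seed_x :: "nat \<Rightarrow> 'f"
  seed_B :: "nat \<Rightarrow> nat \<Rightarrow> int"

definition exchange_matrix :: "nat \<Rightarrow> (nat \<Rightarrow> nat \<Rightarrow> int) \<Rightarrow> bool" where
  "exchange_matrix n b \<longleftrightarrow>
     (\<exists>d::nat \<Rightarrow> int. (\<forall>i\<in>{1..n}. d i > 0) \<and>
        (\<forall>i\<in>{1..n}. \<forall>j\<in>{1..n}. d i * b i j = - (d j * b j i)))"

definition is_seed :: "'f::field set \<Rightarrow> 'f seed \<Rightarrow> bool" where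
  "is_seed K S \<longleftrightarrow>
     algebraically_independent K {1..seed_n S + seed_m S} (seed_x S) \<and>
     exchange_matrix (seed_n S) (seed_B S)"

definition exchangeable_vars :: "'f seed \<Rightarrow> 'f set" where
  "exchangeable_vars S = seed_x S ` {1..seed_n S}"

definition frozen_vars :: "'f seed \<Rightarrow> 'f set" where
  "frozen_vars S = seed_x S ` {seed_n S + 1..seed_n S + seed_m S}"

definition exchange_poly :: "'f::field seed \<Rightarrow> nat \<Rightarrow> 'f" where
  "exchange_poly S i =
     (\<Prod>j | j \<in> {1..seed_n S + seed_m S} \<and> seed_B S j i > 0. seed_x S j ^ nat (seed_B S j i)) +
     (\<Prod>j | j \<in> {1..seed_n S + seed_m S} \<and> seed_B S j i < 0. seed_x S j ^ nat (- seed_B S j i))"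

text \<open>The number halved below is always even: it is \<open>0\<close> or \<open>\<plusminus> 2 b_{ki} b_{il}\<close>. So \<open>div\<close> is exact.\<close>

definition mutate_matrix :: "nat \<Rightarrow> (nat \<Rightarrow> nat \<Rightarrow> int) \<Rightarrow> nat \<Rightarrow> nat \<Rightarrow> int" where
  "mutate_matrix i b k l =
     (if k = i \<or> l = i then - b k l
      else b k l + (\<bar>b k i\<bar> * b i l + b k i * \<bar>b i l\<bar>) div 2)"

definition mutate :: "nat \<Rightarrow> 'f::field seed \<Rightarrow> 'f seed" where
  "mutate i S =
     S\<lparr>seed_x := (seed_x S)(i := exchange_poly S i / seed_x S i),
       seed_B := mutate_matrix i (seed_B S)\<rparr>"

inductive_set mutation_class :: "'f::field seed \<Rightarrow> 'f seed set" for S where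
  initial: "S \<in> mutation_class S"
| mutation: "T \<in> mutation_class S \<Longrightarrow> i \<in> {1..seed_n T} \<Longrightarrow> mutate i T \<in> mutation_class S"


subsection \<open>Cluster algebras and \<open>F\<close>-polynomials\<close>

definition cluster_variables :: "'f::field seed \<Rightarrow> 'f set" where
  "cluster_variables S = (\<Union>T\<in>mutation_class S. exchangeable_vars T)"

definition cluster_algebra :: "'f::field set \<Rightarrow> 'f seed \<Rightarrow> 'f set" where
  "cluster_algebra K S =
     adjoin K (cluster_variables S \<union> frozen_vars S \<union> inverse ` frozen_vars S)"

definition principal_coefficients :: "'f seed \<Rightarrow> bool" where
  "principal_coefficients S \<longleftrightarrow>
     seed_m S = seed_n S \<and>
     (\<forall>i\<in>{1..seed_n S}. \<forall>j\<in>{1..seed_n S}. seed_B S (seed_n S + i) j = (if i = j then 1 else 0))"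

text \<open>The substitution \<open>x_1 = \<dots> = x_n = 1\<close> is carried out in a Laurent expression of \<open>z\<close>, that is,
  in a formal Laurent polynomial over \<open>K\<close>, with nonnegative exponents at the frozen indices, whose
  value at the variables of \<open>S\<close> is \<open>z\<close>. For a seed this expression is unique if it exists. If none
  exists, the description is unspecified; the Laurent phenomenon is not built in.\<close>

definition F_polynomial :: "'f::field set \<Rightarrow> 'f seed \<Rightarrow> 'f \<Rightarrow> 'f" where
  "F_polynomial K S z =
     (THE w. \<exists>p. (\<forall>e. Poly_Mapping.lookup p e \<in> K) \<and>
        (\<forall>e\<in>Poly_Mapping.keys p.
            Poly_Mapping.keys e \<subseteq> {1..seed_n S + seed_m S} \<and>
            (\<forall>j\<in>{seed_n S + 1..seed_n S + seed_m S}. Poly_Mapping.lookup e j \<ge> 0)) \<and>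
        laurent_eval (seed_x S) p = z \<and>
        w = laurent_eval (\<lambda>i. if i \<in> {1..seed_n S} then 1 else seed_x S i) p)"

end

theory Submission
  imports Defs
begin

text \<open>By the Laurent phenomenon the cluster algebra \<open>A\<close> lies in the Laurent ring of every seed, and
  the Laurent ring of the initial seed is the localization of \<open>A\<close> at the initial variables. A factor
  of a cluster variable is a unit in the Laurent rings of its seed, hence a monomial, and comparing
  with the adjacent seeds shows that its exponents are nonnegative; so cluster variables are
  irreducible in \<open>A\<close>, and prime if \<open>A\<close> is factorial. A non-initial cluster variable \<open>z\<close> is not
  associated to an initial one, because \<open>F_z\<close> is divisible by no \<open>y_j\<close> and has a positive value at
  suitable points; so \<open>z\<close> stays prime in the Laurent ring. Finally \<open>z\<close> is homogeneous for the
  principal grading, which says that \<open>z\<close> is a monomial times \<open>F_z\<close> evaluated at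
  \<open>y_j \<Prod>\<^sub>i x_i\<^sup>b\<^sup>i\<^sup>j\<close>. A divisibility by \<open>F_z\<close> in \<open>K[y]\<close> can therefore be transported
  to the Laurent ring and back by setting \<open>x_1 = \<dots> = x_n = 1\<close>.

  The Laurent phenomenon itself is proved by induction on the length of a mutation sequence: for seeds
  \<open>t_0 - t_1 - t_2 - t_3\<close> mutated at \<open>j, k, j\<close>, an element of the Laurent rings of \<open>t_1\<close> and \<open>t_3\<close>
  becomes Laurent at \<open>t_0\<close> after multiplication with powers of two elements that are coprime there.
  Coprimality comes from the full rank of the exchange matrix.\<close>


subsection \<open>Subrings of the ambient field\<close>

text \<open>Coprimality is not drawn from unique factorization of Laurent rings; only
  \<open>A\<close> is assumed factorial. It is stated as \<open>nonzerodivisor_mod\<close>, and its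
  nontrivial instances all come from one criterion: if \<open>F\<close> is homogeneous for some
  grading and \<open>g\<close> is a monomial with coefficient 1 plus a homogeneous part of lower
  degree, then \<open>F\<close> can be cancelled against \<open>g\<close> degree by degree, over any
  coefficient ring. For \<open>b_kj = 0\<close> the grading comes from a nonzero 2x2 minor of
  columns \<open>j\<close> and \<open>k\<close>, which is where full rank enters; otherwise it is
  the degree in one variable.

  The other obstacle is the units of \<open>K\<close>. Over a field, \<open>z = c * x_i\<close> with
  a positive integer \<open>c\<close> would make \<open>z\<close> an associate of an initial
  variable without being one. Integrality excludes this: cluster variables of any two seeds expand
  into each other with integer coefficients, so \<open>c\<close> and \<open>1/c\<close> are both
  integers. Hence the Laurent phenomenon is proved for an arbitrary coefficient subring and then
  applied both to \<open>K\<close> and to the integers.\<close>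

definition subring_set :: "'f::field_char_0 set \<Rightarrow> bool" where
  "subring_set R \<longleftrightarrow> 1 \<in> R \<and> (\<forall>a\<in>R. \<forall>b\<in>R. a - b \<in> R \<and> a * b \<in> R)"

context
  fixes R :: "'f::field_char_0 set"
  assumes R: "subring_set R"
begin

lemma subring_set_1: "1 \<in> R" and
  subring_set_diff: "a \<in> R \<Longrightarrow> b \<in> R \<Longrightarrow> a - b \<in> R" and
  subring_set_mult: "a \<in> R \<Longrightarrow> b \<in> R \<Longrightarrow> a * b \<in> R"
  using R by (auto simp: subring_set_def)

lemma subring_set_0: "0 \<in> R"
  using subring_set_diff[OF subring_set_1 subring_set_1] by simp

lemma subring_set_uminus: "a \<in> R \<Longrightarrow> - a \<in> R"
  using subring_set_diff[OF subring_set_0] by force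

lemma subring_set_add: "a \<in> R \<Longrightarrow> b \<in> R \<Longrightarrow> a + b \<in> R"
  using subring_set_diff[OF _ subring_set_uminus] by force

lemma subring_set_sum: "(\<And>i. i \<in> I \<Longrightarrow> f i \<in> R) \<Longrightarrow> sum f I \<in> R"
  by (induction I rule: infinite_finite_induct) (auto intro: subring_set_0 subring_set_add)

lemma subring_set_prod: "(\<And>i. i \<in> I \<Longrightarrow> f i \<in> R) \<Longrightarrow> prod f I \<in> R"
  by (induction I rule: infinite_finite_induct) (auto intro: subring_set_1 subring_set_mult)

lemma subring_set_power: "a \<in> R \<Longrightarrow> a ^ k \<in> R"
  by (induction k) (auto intro: subring_set_1 subring_set_mult)

lemma subring_set_of_nat: "of_nat k \<in> R"
  by (induction k) (auto intro: subring_set_1 subring_set_0 subring_set_add)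

lemma subring_set_Ints: "\<int> \<subseteq> R"
proof
  fix a :: 'f assume "a \<in> \<int>"
  then obtain k where "a = of_int k" by (elim Ints_cases)
  then show "a \<in> R"
    by (cases k rule: int_cases2) (auto intro: subring_set_of_nat subring_set_uminus)
qed

lemma subring_set_powi: "a \<in> R \<Longrightarrow> inverse a \<in> R \<Longrightarrow> a powi k \<in> R"
  by (auto simp: power_int_def intro: subring_set_power)

end

lemmas subring_set_closed = subring_set_0 subring_set_1 subring_set_diff subring_set_mult
  subring_set_uminus subring_set_add subring_set_sum subring_set_prod subring_set_power
  subring_set_of_nat

lemma subring_set_Ints_self: "subring_set \<int>"
  by (auto simp: subring_set_def)

lemma a_inv_type_algebra: "\<ominus>\<^bsub>ring_of_type_algebra\<^esub> b = - (b :: 'f::field)"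
proof -
  interpret ring "ring_of_type_algebra :: 'f ring" by (rule ring_from_type_algebra)
  have "b + \<ominus>\<^bsub>ring_of_type_algebra\<^esub> b = 0"
    using r_neg[of b] by (simp add: ring_of_type_algebra_def)
  then show ?thesis by (simp add: eq_neg_iff_add_eq_0 add.commute)
qed

lemma subring_set_base_ring:
  assumes "base_ring K"
  shows "subring_set K"
proof -
  consider "K = \<int>" | "subfield K ring_of_type_algebra" using assms by (auto simp: base_ring_def)
  then show ?thesis
  proof cases
    case 2
    interpret ring "ring_of_type_algebra :: 'a ring" by (rule ring_from_type_algebra)
    have s: "subring K ring_of_type_algebra" by (rule subfieldE(1)[OF 2])
    have "a - b \<in> K" if "a \<in> K" "b \<in> K" for a b
      using subringE(7)[OF s that(1) subringE(5)[OF s that(2)]]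
      by (simp add: a_inv_type_algebra) (simp add: ring_of_type_algebra_def)
    then show ?thesis
      using subringE(3,6)[OF s] by (auto simp: subring_set_def ring_of_type_algebra_def)
  qed (simp add: subring_set_Ints_self)
qed


subsection \<open>Formal Laurent polynomials\<close>

type_synonym 'f laurent = "(nat \<Rightarrow>\<^sub>0 int) \<Rightarrow>\<^sub>0 'f"

abbreviation "lkp \<equiv> Poly_Mapping.lookup"
abbreviation "kys \<equiv> Poly_Mapping.keys"
abbreviation "sgl \<equiv> Poly_Mapping.single"

lemma poly_mapping_sum_single: "p = (\<Sum>e\<in>kys p. sgl e (lkp p e))"
  by (rule poly_mapping_eqI) (simp add: lookup_sum lookup_single when_def in_keys_iff)

lemma poly_mapping_add_induct [case_names zero single add]:
  fixes p :: "'a \<Rightarrow>\<^sub>0 'b::comm_monoid_add"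
  assumes "P 0" "\<And>e c. P (sgl e c)" "\<And>p q. P p \<Longrightarrow> P q \<Longrightarrow> P (p + q)"
  shows "P p"
proof -
  have "P (\<Sum>e\<in>A. sgl e (lkp p e))" for A
    by (induction A rule: infinite_finite_induct) (use assms in auto)
  then show ?thesis by (subst poly_mapping_sum_single)
qed

definition monom_eval :: "(nat \<Rightarrow> 'f) \<Rightarrow> (nat \<Rightarrow>\<^sub>0 int) \<Rightarrow> 'f::field" where
  "monom_eval x e = (\<Prod>i\<in>kys e. x i powi lkp e i)"

lemma monom_eval_superset: "finite A \<Longrightarrow> kys e \<subseteq> A \<Longrightarrow> monom_eval x e = (\<Prod>i\<in>A. x i powi lkp e i)"
  unfolding monom_eval_def by (rule prod.mono_neutral_left) (auto simp: in_keys_iff)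

lemma monom_eval_0 [simp]: "monom_eval x 0 = 1"
  by (simp add: monom_eval_def)

lemma monom_eval_single [simp]: "monom_eval x (sgl i k) = x i powi k"
  by (simp add: monom_eval_def)

lemma monom_eval_add:
  assumes "\<forall>i. x i \<noteq> 0"
  shows "monom_eval x (e + e') = monom_eval x e * monom_eval x e'"
proof -
  have "monom_eval x (e + e') = (\<Prod>i\<in>kys e \<union> kys e'. x i powi lkp (e + e') i)"
    using keys_add[of e e'] by (intro monom_eval_superset) auto
  also have "\<dots> = monom_eval x e * monom_eval x e'"
    using assms by (simp add: monom_eval_superset[of "kys e \<union> kys e'"] lookup_add power_int_add prod.distrib)
  finally show ?thesis .
qed

lemma monom_eval_nonzero: "\<forall>i. x i \<noteq> 0 \<Longrightarrow> monom_eval x e \<noteq> 0"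
  by (simp add: monom_eval_def)

lemma monom_eval_uminus: "\<forall>i. x i \<noteq> 0 \<Longrightarrow> monom_eval x (- e) = inverse (monom_eval x e)"
  using monom_eval_add[of x e "- e"] monom_eval_nonzero[of x e]
  by (simp add: field_simps)

lemma laurent_eval_alt: "laurent_eval x p = (\<Sum>e\<in>kys p. lkp p e * monom_eval x e)"
  by (simp add: laurent_eval_def monom_eval_def)

lemma laurent_eval_superset:
  "finite A \<Longrightarrow> kys p \<subseteq> A \<Longrightarrow> laurent_eval x p = (\<Sum>e\<in>A. lkp p e * monom_eval x e)"
  unfolding laurent_eval_alt by (rule sum.mono_neutral_left) (auto simp: in_keys_iff)

lemma laurent_eval_0 [simp]: "laurent_eval x 0 = 0"
  by (simp add: laurent_eval_def)

lemma laurent_eval_single [simp]: "laurent_eval x (sgl e c) = c * monom_eval x e"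
  by (cases "c = 0") (simp_all add: laurent_eval_alt)

lemma laurent_eval_1 [simp]: "laurent_eval x 1 = 1"
  by (simp flip: single_one)

lemma laurent_eval_add: "laurent_eval x (p + q) = laurent_eval x p + laurent_eval x q"
proof -
  have "laurent_eval x (p + q) = (\<Sum>e\<in>kys p \<union> kys q. lkp (p + q) e * monom_eval x e)"
    using keys_add[of p q] by (intro laurent_eval_superset) auto
  then show ?thesis
    by (simp add: laurent_eval_superset[of "kys p \<union> kys q"] lookup_add algebra_simps sum.distrib)
qed

lemma laurent_eval_uminus: "laurent_eval x (- p) = - laurent_eval x p"
  using laurent_eval_add[of x p "- p"] by (simp add: eq_neg_iff_add_eq_0 add.commute)

lemma laurent_eval_diff: "laurent_eval x (p - q) = laurent_eval x p - laurent_eval x q"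
  using laurent_eval_add[of x p "- q"] by (simp add: laurent_eval_uminus)

lemma laurent_eval_sum: "laurent_eval x (sum f A) = (\<Sum>a\<in>A. laurent_eval x (f a))"
  by (induction A rule: infinite_finite_induct) (auto simp: laurent_eval_add)

lemma laurent_eval_mult:
  assumes "\<forall>i. x i \<noteq> 0"
  shows "laurent_eval x (p * q) = laurent_eval x p * laurent_eval x q"
proof (induction p rule: poly_mapping_add_induct)
  case (single e c)
  show ?case
    by (induction q rule: poly_mapping_add_induct)
       (auto simp: laurent_eval_add ring_distribs mult_single monom_eval_add[OF assms])
qed (auto simp: laurent_eval_add ring_distribs)

lemma laurent_eval_power:
  "\<forall>i. x i \<noteq> 0 \<Longrightarrow> laurent_eval x (p ^ k) = laurent_eval x p ^ k"
  by (induction k) (auto simp: laurent_eval_mult)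

lemma laurent_eval_prod:
  "\<forall>i. x i \<noteq> 0 \<Longrightarrow> laurent_eval x (prod f A) = (\<Prod>a\<in>A. laurent_eval x (f a))"
  by (induction A rule: infinite_finite_induct) (auto simp: laurent_eval_mult)

definition laurent_over :: "'f::field_char_0 set \<Rightarrow> nat set \<Rightarrow> 'f laurent set" where
  "laurent_over K I = {p. (\<forall>e. lkp p e \<in> K) \<and> (\<forall>e\<in>kys p. kys e \<subseteq> I)}"

lemma laurent_over_mono: "K \<subseteq> K' \<Longrightarrow> I \<subseteq> I' \<Longrightarrow> laurent_over K I \<subseteq> laurent_over K' I'"
  by (auto simp: laurent_over_def) blast+

lemma laurent_eval_cong:
  assumes "p \<in> laurent_over K I" "\<And>i. i \<in> I \<Longrightarrow> x i = y i"
  shows "laurent_eval x p = laurent_eval y p"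
  unfolding laurent_eval_def using assms
  by (intro sum.cong refl arg_cong2[of _ _ _ _ "(*)"] prod.cong)
     (fastforce simp: laurent_over_def)+

context
  fixes K :: "'f::field_char_0 set"
  assumes K: "subring_set K"
begin

lemma laurent_over_single: "c \<in> K \<Longrightarrow> kys e \<subseteq> I \<Longrightarrow> sgl e c \<in> laurent_over K I"
  using subring_set_0[OF K] by (auto simp: laurent_over_def lookup_single when_def split: if_splits)

lemma laurent_over_0: "0 \<in> laurent_over K I"
  using subring_set_0[OF K] by (auto simp: laurent_over_def)

lemma laurent_over_1: "1 \<in> laurent_over K I"
  using laurent_over_single[OF subring_set_1[OF K], of 0 I] by simp

lemma laurent_over_add: "p \<in> laurent_over K I \<Longrightarrow> q \<in> laurent_over K I \<Longrightarrow> p + q \<in> laurent_over K I"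
  using subring_set_add[OF K] keys_add[of p q] by (auto simp: laurent_over_def lookup_add) blast

lemma laurent_over_uminus: "p \<in> laurent_over K I \<Longrightarrow> - p \<in> laurent_over K I"
  using subring_set_uminus[OF K] by (auto simp: laurent_over_def in_keys_iff)

lemma laurent_over_diff: "p \<in> laurent_over K I \<Longrightarrow> q \<in> laurent_over K I \<Longrightarrow> p - q \<in> laurent_over K I"
  using laurent_over_add[OF _ laurent_over_uminus] by force

lemma laurent_over_sum: "(\<And>a. a \<in> A \<Longrightarrow> f a \<in> laurent_over K I) \<Longrightarrow> sum f A \<in> laurent_over K I"
  by (induction A rule: infinite_finite_induct) (auto intro: laurent_over_0 laurent_over_add)

lemma laurent_over_mult:
  assumes "p \<in> laurent_over K I" "q \<in> laurent_over K I"
  shows "p * q \<in> laurent_over K I"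
proof -
  have "p * q = (\<Sum>e\<in>kys p. \<Sum>e'\<in>kys q. sgl (e + e') (lkp p e * lkp q e'))"
    by (subst (1) poly_mapping_sum_single[of p], subst (1) poly_mapping_sum_single[of q],
        subst sum.swap) (simp add: sum_distrib_left sum_distrib_right mult_single)
  also have "\<dots> \<in> laurent_over K I"
  proof (intro laurent_over_sum laurent_over_single)
    fix e e' assume e: "e \<in> kys p" "e' \<in> kys q"
    then have "kys e \<subseteq> I" "kys e' \<subseteq> I" using assms by (simp_all add: laurent_over_def)
    then show "kys (e + e') \<subseteq> I" using keys_add[of e e'] by blast
    show "lkp p e * lkp q e' \<in> K"
      using assms by (auto simp: laurent_over_def intro: subring_set_mult[OF K])
  qed
  finally show ?thesis .
qed

lemma laurent_over_power: "p \<in> laurent_over K I \<Longrightarrow> p ^ k \<in> laurent_over K I"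
  by (induction k) (auto intro: laurent_over_1 laurent_over_mult)

lemma laurent_over_prod: "(\<And>a. a \<in> A \<Longrightarrow> f a \<in> laurent_over K I) \<Longrightarrow> prod f A \<in> laurent_over K I"
  by (induction A rule: infinite_finite_induct) (auto intro: laurent_over_1 laurent_over_mult)

end


subsection \<open>Gradings\<close>

definition homog_part :: "('e \<Rightarrow> int) \<Rightarrow> int \<Rightarrow> ('e \<Rightarrow>\<^sub>0 'f::comm_monoid_add) \<Rightarrow> 'e \<Rightarrow>\<^sub>0 'f" where
  "homog_part l d p = (\<Sum>e | e \<in> kys p \<and> l e = d. sgl e (lkp p e))"

lemma lookup_homog_part: "lkp (homog_part l d p) e = (if l e = d then lkp p e else 0)"
  by (auto simp: homog_part_def lookup_sum lookup_single when_def in_keys_iff)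

lemma homog_part_add: "homog_part l d (p + q) = homog_part l d p + homog_part l d q"
  by (rule poly_mapping_eqI) (simp add: lookup_homog_part lookup_add)

lemma homog_part_eq_0: "(\<And>e. e \<in> kys p \<Longrightarrow> l e \<noteq> d) \<Longrightarrow> homog_part l d p = 0"
  by (rule poly_mapping_eqI) (auto simp: lookup_homog_part in_keys_iff)

lemma homog_part_id: "(\<And>e. e \<in> kys p \<Longrightarrow> l e = d) \<Longrightarrow> homog_part l d p = p"
  by (rule poly_mapping_eqI) (auto simp: lookup_homog_part in_keys_iff)

lemma keys_homog_part: "kys (homog_part l d p) = {e \<in> kys p. l e = d}"
  by (auto simp: in_keys_iff lookup_homog_part split: if_splits)

lemma laurent_over_homog_part:
  "subring_set K \<Longrightarrow> p \<in> laurent_over K I \<Longrightarrow> homog_part l d p \<in> laurent_over K I"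
  using subring_set_0 by (auto simp: laurent_over_def keys_homog_part lookup_homog_part)

context
  fixes l :: "(nat \<Rightarrow>\<^sub>0 int) \<Rightarrow> int"
  assumes l_add: "\<And>e e'. l (e + e') = l e + l e'"
begin

text \<open>The bounds \<open>a\<close> and \<open>b\<close> need not be attained. \<open>p'\<close>
  and \<open>q'\<close> collect the terms of smaller degree, and every product involving one of them
  falls below degree \<open>a + b\<close>.\<close>

lemma homog_part_mult_top:
  fixes p q :: "'f::field_char_0 laurent"
  assumes "\<And>e. e \<in> kys p \<Longrightarrow> l e \<le> a" "\<And>e. e \<in> kys q \<Longrightarrow> l e \<le> b"
  shows "homog_part l (a + b) (p * q) = homog_part l a p * homog_part l b q"
proof -
  define p' where "p' = p - homog_part l a p"
  define q' where "q' = q - homog_part l b q"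
  have p': "l e < a" if "e \<in> kys p'" for e
    using that assms(1)[of e] by (auto simp: p'_def in_keys_iff lookup_minus lookup_homog_part split: if_splits)
  have q': "l e < b" if "e \<in> kys q'" for e
    using that assms(2)[of e] by (auto simp: q'_def in_keys_iff lookup_minus lookup_homog_part split: if_splits)
  have "p * q = homog_part l a p * homog_part l b q + (homog_part l a p * q' + p' * q)"
    by (simp add: p'_def q'_def algebra_simps)
  moreover have "homog_part l (a + b) (homog_part l a p * homog_part l b q) = homog_part l a p * homog_part l b q"
    using keys_mult[of "homog_part l a p" "homog_part l b q"]
    by (intro homog_part_id) (auto simp: keys_homog_part l_add)
  moreover have "homog_part l (a + b) (homog_part l a p * q') = 0"
    using keys_mult[of "homog_part l a p" q'] q'
    by (intro homog_part_eq_0) (fastforce simp: keys_homog_part l_add)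
  moreover have "homog_part l (a + b) (p' * q) = 0"
    using keys_mult[of p' q] p' assms(2)
    by (intro homog_part_eq_0) (fastforce simp: keys_homog_part l_add)
  ultimately show ?thesis by (simp add: homog_part_add)
qed

lemma homog_part_mult_homog:
  fixes u h :: "'f::field_char_0 laurent"
  assumes "\<And>e. e \<in> kys u \<Longrightarrow> l e = c"
  shows "homog_part l (c + d) (u * h) = u * homog_part l d h"
proof -
  have 1: "homog_part l (c + d) (u * homog_part l d h) = u * homog_part l d h"
    using keys_mult[of u "homog_part l d h"] assms
    by (intro homog_part_id) (auto simp: keys_homog_part l_add)
  have 2: "homog_part l (c + d) (u * (h - homog_part l d h)) = 0"
    using keys_mult[of u "h - homog_part l d h"] assms
    by (intro homog_part_eq_0)
       (fastforce simp: in_keys_iff[of _ "h - _"] lookup_minus lookup_homog_part l_add)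
  have "u * h = u * homog_part l d h + u * (h - homog_part l d h)"
    by (simp add: algebra_simps)
  with 1 2 show ?thesis by (metis add.right_neutral homog_part_add)
qed

end

lemma top_degree:
  assumes "p \<noteq> 0"
  obtains d where "homog_part l d p \<noteq> 0" "\<And>e. e \<in> kys p \<Longrightarrow> l e \<le> d"
proof -
  have ne: "kys p \<noteq> {}" using assms by simp
  define d where "d = Max (l ` kys p)"
  have "d \<in> l ` kys p" using ne by (auto simp: d_def intro: Max_in)
  then obtain e where "e \<in> kys p" "l e = d" by auto
  then have "lkp (homog_part l d p) e \<noteq> 0" by (simp add: lookup_homog_part in_keys_iff)
  then have "homog_part l d p \<noteq> 0" by auto
  moreover have "l e \<le> d" if "e \<in> kys p" for e using that by (auto simp: d_def)
  ultimately show thesis using that by blast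
qed

lemma homog_part_uminus: "homog_part (\<lambda>e. - l e) (- d) p = homog_part l d p"
  by (simp add: homog_part_def)

lemma bot_degree:
  assumes "p \<noteq> 0"
  obtains d where "homog_part l d p \<noteq> 0" "\<And>e. e \<in> kys p \<Longrightarrow> d \<le> l e"
proof -
  obtain d where "homog_part (\<lambda>e. - l e) d p \<noteq> 0" "\<And>e. e \<in> kys p \<Longrightarrow> - l e \<le> d"
    using top_degree[OF assms] by metis
  then show thesis using that[of "- d"] homog_part_uminus[of l "- d" p] by fastforce
qed

context
  fixes l :: "(nat \<Rightarrow>\<^sub>0 int) \<Rightarrow> int"
  assumes l_add: "\<And>e e'. l (e + e') = l e + l e'"
begin

lemma homog_part_mult_bot:
  fixes p q :: "'f::field_char_0 laurent"
  assumes "\<And>e. e \<in> kys p \<Longrightarrow> a \<le> l e" "\<And>e. e \<in> kys q \<Longrightarrow> b \<le> l e"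
  shows "homog_part l (a + b) (p * q) = homog_part l a p * homog_part l b q"
  using homog_part_mult_top[of "\<lambda>e. - l e" p "- a" q "- b"] assms
  unfolding minus_add_distrib[symmetric] homog_part_uminus by (simp add: l_add)

text \<open>Laurent polynomials form a domain, so top degrees of the factors add up to a degree that
  occurs in the product, and so do bottom degrees. Both sums are \<open>c\<close>, which leaves no
  room between top and bottom in either factor.\<close>

lemma homog_factors:
  fixes p q :: "'f::field_char_0 laurent"
  assumes "p * q \<noteq> 0" "\<And>e. e \<in> kys (p * q) \<Longrightarrow> l e = c"
  obtains a b where "c = a + b" "\<And>e. e \<in> kys p \<Longrightarrow> l e = a" "\<And>e. e \<in> kys q \<Longrightarrow> l e = b"
proof -
  have nz: "p \<noteq> 0" "q \<noteq> 0" using assms(1) by auto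
  obtain a where a: "homog_part l a p \<noteq> 0" "\<And>e. e \<in> kys p \<Longrightarrow> l e \<le> a" using top_degree[OF nz(1)] by metis
  obtain b where b: "homog_part l b q \<noteq> 0" "\<And>e. e \<in> kys q \<Longrightarrow> l e \<le> b" using top_degree[OF nz(2)] by metis
  obtain a' where a': "homog_part l a' p \<noteq> 0" "\<And>e. e \<in> kys p \<Longrightarrow> a' \<le> l e" using bot_degree[OF nz(1)] by metis
  obtain b' where b': "homog_part l b' q \<noteq> 0" "\<And>e. e \<in> kys q \<Longrightarrow> b' \<le> l e" using bot_degree[OF nz(2)] by metis
  have "a + b = c"
    using homog_part_mult_top[of l p a q b] l_add a b homog_part_eq_0[of "p * q" l "a + b"] assms(2) by force
  moreover have "a' + b' = c"
    using homog_part_mult_bot[of p a' q b'] a' b' homog_part_eq_0[of "p * q" l "a' + b'"] assms(2) by force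
  moreover obtain e1 where "e1 \<in> kys p" using nz(1) by (metis all_not_in_conv keys_eq_empty)
  moreover obtain e2 where "e2 \<in> kys q" using nz(2) by (metis all_not_in_conv keys_eq_empty)
  ultimately have "a = a'" "b = b'"
    using a(2)[of e1] a'(2)[of e1] b(2)[of e2] b'(2)[of e2] by linarith+
  then show thesis using that[of a b] a(2) a'(2) b(2) b'(2) \<open>a + b = c\<close> by fastforce
qed

text \<open>The bottom part of \<open>p\<close> sits in degree 0 and is nonzero, so the bottom
  degree of \<open>q\<close> is that of the product. Applied to the exponent of one frozen variable,
  this keeps quotients free of negative powers.\<close>

lemma factor_nonneg_degree:
  fixes p q :: "'f::field_char_0 laurent"
  assumes "\<And>e. e \<in> kys p \<Longrightarrow> 0 \<le> l e" "homog_part l 0 p \<noteq> 0"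
    and "\<And>e. e \<in> kys (p * q) \<Longrightarrow> 0 \<le> l e"
  shows "e \<in> kys q \<Longrightarrow> 0 \<le> l e"
proof -
  assume e: "e \<in> kys q"
  then have "q \<noteq> 0" by auto
  then obtain b where b: "homog_part l b q \<noteq> 0" "\<And>e. e \<in> kys q \<Longrightarrow> b \<le> l e" using bot_degree by metis
  have "homog_part l (0 + b) (p * q) \<noteq> 0"
    using homog_part_mult_bot[of p 0 q b] assms b by simp
  then have "0 \<le> 0 + b" using homog_part_eq_0[of "p * q" l "0 + b"] assms(3) by force
  then show ?thesis using b(2)[OF e] by simp
qed

text \<open>The top-degree part of \<open>h\<close> is divisible by \<open>F\<close> because the top-degree part of
  \<open>X\<^sup>a + C\<close> is a unit.\<close>

lemma homog_dvd_cancel: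
  fixes F C h q :: "'f::field_char_0 laurent"
  assumes K: "subring_set K"
    and F: "\<And>e. e \<in> kys F \<Longrightarrow> l e = f"
    and C: "\<And>e. e \<in> kys C \<Longrightarrow> l e = c" "c < l a" "C \<in> laurent_over K I" "kys a \<subseteq> I"
    and "q \<in> laurent_over K I" "h \<in> laurent_over K I" "F * q = (sgl a 1 + C) * h"
  shows "\<exists>q'\<in>laurent_over K I. h = F * q'"
  using assms(7-9)
proof (induction "card (kys h)" arbitrary: h q rule: less_induct)
  case less
  show ?case
  proof (cases "h = 0")
    case True
    then show ?thesis by (intro bexI[of _ 0]) (auto intro: laurent_over_0[OF K])
  next
    case False
    then obtain d where d: "homog_part l d h \<noteq> 0" "\<And>e. e \<in> kys h \<Longrightarrow> l e \<le> d"
      using top_degree by metis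
    let ?G = "sgl a 1 + C" and ?h = "homog_part l d h"
    have G: "?G \<in> laurent_over K I"
      using C by (intro laurent_over_add laurent_over_single K subring_set_1) auto
    have kG: "l e \<le> l a" if "e \<in> kys ?G" for e
      using that keys_add[of "sgl a 1" C] C(1,2) by (auto split: if_splits)
    have "homog_part l (l a) (sgl a (1::'f)) = sgl a 1" by (rule homog_part_id) (auto split: if_splits)
    moreover have "homog_part l (l a) C = 0" by (rule homog_part_eq_0) (use C(1,2) in force)
    ultimately have "homog_part l (l a + d) (?G * h) = sgl a 1 * ?h"
      by (subst homog_part_mult_top[OF l_add kG d(2)]) (auto simp: homog_part_add)
    moreover define q0 where "q0 = homog_part l (l a + d - f) q"
    have "homog_part l (l a + d) (F * q) = F * q0"
      using homog_part_mult_homog[OF l_add, of F f "l a + d - f" q] F by (simp add: q0_def)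
    ultimately have "sgl a 1 * ?h = F * q0" using less.prems(3) by metis
    then have "sgl (-a) 1 * (sgl a 1 * ?h) = F * (sgl (-a) 1 * q0)" by (simp add: mult_ac)
    moreover define q1 where "q1 = sgl (-a) 1 * q0"
    ultimately have h: "?h = F * q1" by (simp add: mult_single flip: mult.assoc)
    have q1: "q1 \<in> laurent_over K I"
      unfolding q1_def q0_def using C less.prems
      by (intro laurent_over_mult laurent_over_single laurent_over_homog_part K subring_set_1)
         (auto simp: in_keys_iff)
    \<comment> \<open>Stripping off the top-degree part, a multiple of \<open>F\<close>, leaves an
      equation of the same shape with fewer terms in \<open>h\<close>.\<close>
    have "kys (h - ?h) \<subset> kys h"
    proof -
      have "kys (h - ?h) = kys h - kys ?h"
        by (auto simp: in_keys_iff lookup_minus lookup_homog_part split: if_splits)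
      moreover have "kys ?h \<noteq> {}" using d(1) by simp
      ultimately show ?thesis by (auto simp: keys_homog_part)
    qed
    then have "card (kys (h - ?h)) < card (kys h)" by (simp add: psubset_card_mono)
    moreover have "F * (q - ?G * q1) = ?G * (h - ?h)"
      using less.prems(3) by (subst h) (simp add: algebra_simps)
    moreover have "h - ?h \<in> laurent_over K I" "q - ?G * q1 \<in> laurent_over K I"
      using less.prems q1 G by (auto intro!: laurent_over_diff laurent_over_mult laurent_over_homog_part K)
    ultimately obtain q' where q': "q' \<in> laurent_over K I" "h - ?h = F * q'"
      using less.hyps[of "h - ?h" "q - ?G * q1"] by blast
    have "h = F * (q' + q1)" using q'(2) h by (simp add: algebra_simps)
    then show ?thesis using laurent_over_add[OF K q'(1) q1] by blast
  qed
qed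

end

text \<open>Each coordinate of the exponent is a grading for which the product is homogeneous. Hence
  every coordinate is constant on the support of each factor.\<close>

lemma monomial_factors:
  fixes p q :: "'f::field_char_0 laurent"
  assumes "p * q = sgl e c" "c \<noteq> 0"
  obtains a b where "e = a + b" "p = sgl a (lkp p a)" "q = sgl b (lkp q b)" "lkp p a * lkp q b = c"
proof -
  have nz: "p * q \<noteq> 0" using assms by (metis lookup_single_eq lookup_zero)
  then have "p \<noteq> 0" "q \<noteq> 0" by auto
  have coord: "(\<forall>a\<in>kys p. \<forall>a'\<in>kys p. lkp a i = lkp a' i) \<and> (\<forall>a\<in>kys q. \<forall>a'\<in>kys q. lkp a i = lkp a' i)" for i
  proof -
    obtain a b where "\<And>e. e \<in> kys p \<Longrightarrow> lkp e i = a" "\<And>e. e \<in> kys q \<Longrightarrow> lkp e i = b"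
    proof (rule homog_factors[of "\<lambda>e. lkp e i" p q "lkp e i"])
      show "\<And>a. a \<in> kys (p * q) \<Longrightarrow> lkp a i = lkp e i" using assms by auto
    qed (use nz in \<open>auto simp: lookup_add\<close>)
    then show ?thesis by simp
  qed
  obtain a where a: "a \<in> kys p" using \<open>p \<noteq> 0\<close> by (metis all_not_in_conv keys_eq_empty)
  obtain b where b: "b \<in> kys q" using \<open>q \<noteq> 0\<close> by (metis all_not_in_conv keys_eq_empty)
  have "a' = a" if "a' \<in> kys p" for a' using coord that a by (intro poly_mapping_eqI) blast
  then have "kys p = {a}" using a by blast
  then have p: "p = sgl a (lkp p a)" using poly_mapping_sum_single[of p] by simp
  have "b' = b" if "b' \<in> kys q" for b' using coord that b by (intro poly_mapping_eqI) blast
  then have "kys q = {b}" using b by blast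
  then have q: "q = sgl b (lkp q b)" using poly_mapping_sum_single[of q] by simp
  have "sgl (a + b) (lkp p a * lkp q b) = sgl e c" using assms(1) p q by (metis mult_single)
  then have "a + b = e \<and> lkp p a * lkp q b = c"
    using assms(2) by (metis lookup_single_eq lookup_single_not_eq)
  then show thesis using that p q by blast
qed

subsection \<open>Mutation of seeds\<close>

definition expo :: "nat set \<Rightarrow> (nat \<Rightarrow> int) \<Rightarrow> nat \<Rightarrow>\<^sub>0 int" where
  "expo I v = (\<Sum>i\<in>I. sgl i (v i))"

lemma lookup_expo: "finite I \<Longrightarrow> lkp (expo I v) i = (if i \<in> I then v i else 0)"
  by (simp add: expo_def lookup_sum lookup_single when_def)

lemma keys_expo: "finite I \<Longrightarrow> kys (expo I v) \<subseteq> I"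
  using lookup_expo[of I v] by (meson in_keys_iff subsetI)

lemma monom_eval_expo: "finite I \<Longrightarrow> monom_eval x (expo I v) = (\<Prod>i\<in>I. x i powi v i)"
  by (simp add: monom_eval_superset[OF _ keys_expo] lookup_expo)

abbreviation seed_idx :: "'f seed \<Rightarrow> nat set" where
  "seed_idx T \<equiv> {1..seed_n T + seed_m T}"

text \<open>Setting the meaningless values of \<open>seed_x\<close> to \<open>1\<close> makes evaluation a ring homomorphism
  on all Laurent polynomials.\<close>

definition seed_pt :: "'f::field_char_0 seed \<Rightarrow> nat \<Rightarrow> 'f" where
  "seed_pt T i = (if i \<in> seed_idx T then seed_x T i else 1)"

definition pos_exp :: "'f seed \<Rightarrow> nat \<Rightarrow> nat \<Rightarrow>\<^sub>0 int" where
  "pos_exp T k = expo (seed_idx T) (\<lambda>l. max 0 (seed_B T l k))"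

definition neg_exp :: "'f seed \<Rightarrow> nat \<Rightarrow> nat \<Rightarrow>\<^sub>0 int" where
  "neg_exp T k = expo (seed_idx T) (\<lambda>l. max 0 (- seed_B T l k))"

definition exch_laurent :: "'f::field_char_0 seed \<Rightarrow> nat \<Rightarrow> 'f laurent" where
  "exch_laurent T k = sgl (pos_exp T k) 1 + sgl (neg_exp T k) 1"

lemma prod_powi_max:
  "finite I \<Longrightarrow> (\<Prod>l\<in>I. y l powi max 0 (v l)) = (\<Prod>l | l \<in> I \<and> v l > (0::int). y l ^ nat (v l) :: 'f::field)"
proof -
  assume I: "finite I"
  have "(\<Prod>l | l \<in> I \<and> v l > 0. y l ^ nat (v l)) = (\<Prod>l | l \<in> I \<and> v l > 0. y l powi max 0 (v l))"
  proof (rule prod.cong[OF refl])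
    fix l assume "l \<in> {l. l \<in> I \<and> v l > 0}"
    then have "v l > 0" by simp
    then have "max 0 (v l) = v l" "v l \<ge> 0" by linarith+
    then show "y l ^ nat (v l) = y l powi max 0 (v l)" unfolding power_int_def by simp
  qed
  also have "\<dots> = (\<Prod>l\<in>I. y l powi max 0 (v l))"
  proof (rule prod.mono_neutral_left)
    show "\<forall>l\<in>I - {l. l \<in> I \<and> v l > 0}. y l powi max 0 (v l) = 1"
    proof
      fix l assume "l \<in> I - {l. l \<in> I \<and> v l > 0}"
      then have "max 0 (v l) = 0" by (auto simp: max_def)
      then show "y l powi max 0 (v l) = 1" by simp
    qed
  qed (use I in auto)
  finally show ?thesis ..
qed

lemma exchange_poly_alt:
  "exchange_poly T k = (\<Prod>l\<in>seed_idx T. seed_pt T l powi max 0 (seed_B T l k)) +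
     (\<Prod>l\<in>seed_idx T. seed_pt T l powi max 0 (- seed_B T l k))"
proof -
  have *: "(\<Prod>l\<in>seed_idx T. seed_pt T l powi w l) = (\<Prod>l\<in>seed_idx T. seed_x T l powi w l)" for w
    by (rule prod.cong) (auto simp: seed_pt_def)
  show ?thesis
    unfolding * by (subst (1 2) prod_powi_max) (auto simp: exchange_poly_def)
qed

lemma laurent_eval_exch: "laurent_eval (seed_pt T) (exch_laurent T k) = exchange_poly T k"
  by (simp add: exch_laurent_def laurent_eval_add pos_exp_def neg_exp_def monom_eval_expo exchange_poly_alt)

lemma exch_laurent_nonzero: "exch_laurent T k \<noteq> 0"
proof
  assume "exch_laurent T k = 0"
  then have "lkp (exch_laurent T k) (pos_exp T k) = 0" by simp
  then show False by (auto simp: exch_laurent_def lookup_add lookup_single when_def split: if_splits)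
qed

lemma exch_laurent_over:
  "subring_set K \<Longrightarrow> exch_laurent T k \<in> laurent_over K (seed_idx T)"
  unfolding exch_laurent_def pos_exp_def neg_exp_def
  by (intro laurent_over_add laurent_over_single subring_set_1 keys_expo) auto

lemma keys_exch_laurent: "kys (exch_laurent T k) \<subseteq> {pos_exp T k, neg_exp T k}"
  using keys_add[of "sgl (pos_exp T k) 1" "sgl (neg_exp T k) 1"]
  by (auto simp: exch_laurent_def split: if_splits)

section \<open>Mutation of matrices and seeds, and the properties it preserves\<close>

lemma mutate_simps [simp]:
  "seed_n (mutate k T) = seed_n T" "seed_m (mutate k T) = seed_m T"
  "seed_B (mutate k T) = mutate_matrix k (seed_B T)"
  by (auto simp: mutate_def)

lemma seed_pt_mutate:
  "k \<in> seed_idx T \<Longrightarrow> seed_pt (mutate k T) = (seed_pt T)(k := exchange_poly T k / seed_pt T k)"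
  by (auto simp: seed_pt_def mutate_def)

text \<open>A form without halving, whose only nonlinearity is \<open>max\<close>. Identities about
  mutation then follow by algebra from \<open>max 0 a = a + max 0 (- a)\<close>.\<close>

lemma mutate_matrix_alt:
  "mutate_matrix k b i j = (if i = k \<or> j = k then - b i j
     else b i j + max 0 (b i k) * b k j + b i k * max 0 (- b k j))"
proof -
  have "(\<bar>b i k\<bar> * b k j + b i k * \<bar>b k j\<bar>) div 2 = max 0 (b i k) * b k j + b i k * max 0 (- b k j)"
    by (cases "b i k \<ge> 0"; cases "b k j \<ge> 0") (auto simp: max_def)
  then show ?thesis by (simp add: mutate_matrix_def)
qed

lemma mutate_matrix_involutive: "mutate_matrix k (mutate_matrix k b) = b"
proof (intro ext)
  fix i j
  have "max 0 (b i k) = b i k + max 0 (- b i k)" "max 0 (b k j) = b k j + max 0 (- b k j)"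
    by (simp_all add: max_def)
  then show "mutate_matrix k (mutate_matrix k b) i j = b i j"
    by (simp add: mutate_matrix_alt algebra_simps)
qed

text \<open>Linear independence of the columns of the extended exchange matrix. Integer coefficients
  suffice to test independence over the rationals, by clearing denominators.\<close>

definition full_rank :: "'f seed \<Rightarrow> bool" where
  "full_rank T \<longleftrightarrow> (\<forall>c::nat \<Rightarrow> int. (\<forall>i\<in>seed_idx T. (\<Sum>j\<in>{1..seed_n T}. seed_B T i j * c j) = 0) \<longrightarrow>
     (\<forall>j\<in>{1..seed_n T}. c j = 0))"

text \<open>The invariant carried along mutations. Algebraic independence appears as injectivity of
  evaluation on formal Laurent polynomials, the form in which identities in the field are lifted to
  formal ones.\<close>

definition good_seed :: "'f::field_char_0 set \<Rightarrow> 'f seed \<Rightarrow> bool" where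
  "good_seed K T \<longleftrightarrow> (\<forall>i\<in>seed_idx T. seed_x T i \<noteq> 0) \<and>
     (\<forall>p\<in>laurent_over K (seed_idx T). laurent_eval (seed_pt T) p = 0 \<longrightarrow> p = 0) \<and>
     exchange_matrix (seed_n T) (seed_B T) \<and> full_rank T"

lemma good_seed_pt_nonzero: "good_seed K T \<Longrightarrow> seed_pt T i \<noteq> 0"
  by (auto simp: good_seed_def seed_pt_def)

lemma good_seed_kernel: "good_seed K T \<Longrightarrow> p \<in> laurent_over K (seed_idx T) \<Longrightarrow>
    laurent_eval (seed_pt T) p = 0 \<Longrightarrow> p = 0"
  by (auto simp: good_seed_def)

lemma good_seed_inj:
  "subring_set K \<Longrightarrow> good_seed K T \<Longrightarrow> p \<in> laurent_over K (seed_idx T) \<Longrightarrow> q \<in> laurent_over K (seed_idx T) \<Longrightarrow>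
    laurent_eval (seed_pt T) p = laurent_eval (seed_pt T) q \<Longrightarrow> p = q"
  using good_seed_kernel[of K T "p - q"] by (auto simp: laurent_eval_diff intro: laurent_over_diff)

lemma exchange_poly_nonzero:
  assumes "subring_set K" "good_seed K T"
  shows "exchange_poly T k \<noteq> 0"
  using good_seed_kernel[OF assms(2) exch_laurent_over[OF assms(1)]] exch_laurent_nonzero laurent_eval_exch
  by metis

lemma exchange_matrix_diag: "exchange_matrix n b \<Longrightarrow> k \<in> {1..n} \<Longrightarrow> b k k = 0"
proof -
  assume "exchange_matrix n b" "k \<in> {1..n}"
  then obtain d where "d k > 0" "d k * b k k = - (d k * b k k)"
    unfolding exchange_matrix_def by blast
  then have "d k * b k k = 0" by linarith
  with \<open>d k > 0\<close> show "b k k = 0" by simp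
qed

lemma exchange_matrix_sgn:
  assumes "exchange_matrix n b" "i \<in> {1..n}" "j \<in> {1..n}"
  shows "b i j > 0 \<longleftrightarrow> b j i < 0" "b i j = 0 \<longleftrightarrow> b j i = 0"
proof -
  obtain d where d: "d i > 0" "d j > 0" "d i * b i j = - (d j * b j i)"
    using assms unfolding exchange_matrix_def by blast
  have "b i j > 0 \<longleftrightarrow> d i * b i j > 0" using d(1) by (auto simp: zero_less_mult_iff)
  also have "\<dots> \<longleftrightarrow> d j * b j i < 0" using d(3) by linarith
  also have "\<dots> \<longleftrightarrow> b j i < 0" using d(2) by (auto simp: mult_less_0_iff)
  finally show "b i j > 0 \<longleftrightarrow> b j i < 0" .
  show "b i j = 0 \<longleftrightarrow> b j i = 0" using d by (metis mult_eq_0_iff neg_equal_0_iff_equal order_less_irrefl)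
qed

text \<open>Mutation at \<open>k\<close> negates column \<open>k\<close>, which swaps the two
  monomials, and the only changed variable \<open>x_k\<close> occurs in neither.\<close>

lemma exchange_poly_mutate_same:
  fixes T :: "'f::field_char_0 seed"
  assumes "seed_B T k k = 0" "k \<in> seed_idx T"
  shows "exchange_poly (mutate k T) k = exchange_poly T k"
proof -
  have "(\<Prod>l\<in>seed_idx T. seed_pt (mutate k T) l powi max 0 (c * seed_B T l k)) =
        (\<Prod>l\<in>seed_idx T. seed_pt T l powi max 0 (c * seed_B T l k))" for c :: int
    by (rule prod.cong) (use assms in \<open>auto simp: seed_pt_mutate\<close>)
  from this[of 1] this[of "- 1"] show ?thesis
    by (simp add: exchange_poly_alt mutate_matrix_alt add.commute)
qed

lemma mutate_mutate:
  assumes "subring_set K" "good_seed K T" "k \<in> {1..seed_n T}"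
  shows "mutate k (mutate k T) = T"
proof -
  have k: "k \<in> seed_idx T" "seed_B T k k = 0"
    using assms exchange_matrix_diag by (auto simp: good_seed_def)
  have "exchange_poly (mutate k T) k = exchange_poly T k"
    using exchange_poly_mutate_same k by blast
  moreover have "exchange_poly T k \<noteq> 0" using exchange_poly_nonzero assms by blast
  moreover have "seed_x T k \<noteq> 0" using assms k by (auto simp: good_seed_def)
  ultimately show ?thesis
    by (subst mutate_def) (simp add: mutate_def mutate_matrix_involutive)
qed

lemma exchange_matrix_mutate:
  assumes "exchange_matrix n b" "k \<in> {1..n}"
  shows "exchange_matrix n (mutate_matrix k b)"
proof -
  obtain d where d: "\<And>i. i \<in> {1..n} \<Longrightarrow> d i > 0"
    "\<And>i j. i \<in> {1..n} \<Longrightarrow> j \<in> {1..n} \<Longrightarrow> d i * b i j = - (d j * b j i)"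
    using assms(1) unfolding exchange_matrix_def by blast
  have "d i * mutate_matrix k b i j = - (d j * mutate_matrix k b j i)"
    if ij: "i \<in> {1..n}" "j \<in> {1..n}" for i j
  proof (cases "i = k \<or> j = k")
    case True
    then show ?thesis using d(2)[OF ij] by (auto simp: mutate_matrix_alt)
  next
    case False
    \<comment> \<open>Positive factors pass through \<open>max\<close>, so the symmetrizing relation
      also holds between positive and negative parts. The same \<open>d\<close> therefore serves the
      mutated matrix.\<close>
    have max_mult: "max 0 (c * x) = c * max 0 x" if "c > 0" for c x :: int
      using that by (auto simp: max_def mult_le_0_iff zero_le_mult_iff)
    have p: "d i * max 0 (b i k) = d k * max 0 (- b k i)"
      using max_mult[of "d i" "b i k"] max_mult[of "d k" "- b k i"] d(1)[OF ij(1)] d(1)[OF assms(2)] d(2)[OF ij(1) assms(2)]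
      by simp
    have q: "d j * max 0 (b j k) = d k * max 0 (- b k j)"
      using max_mult[of "d j" "b j k"] max_mult[of "d k" "- b k j"] d(1)[OF ij(2)] d(1)[OF assms(2)] d(2)[OF ij(2) assms(2)]
      by simp
    have "d i * (b i j + max 0 (b i k) * b k j + b i k * max 0 (- b k j)) =
      d i * b i j + (d i * max 0 (b i k)) * b k j + (d i * b i k) * max 0 (- b k j)" by (simp add: algebra_simps)
    also have "\<dots> = - (d j * b j i) + d k * max 0 (- b k i) * b k j - b k i * (d k * max 0 (- b k j))"
      using d(2)[OF ij] d(2)[OF ij(1) assms(2)] p by (simp add: mult_ac)
    also have "\<dots> = - (d j * b j i) - (d j * b j k) * max 0 (- b k i) - b k i * (d j * max 0 (b j k))"
      using d(2)[OF ij(2) assms(2)] q by (simp add: mult_ac)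
    also have "\<dots> = - (d j * (b j i + max 0 (b j k) * b k i + b j k * max 0 (- b k i)))" by (simp add: algebra_simps)
    finally show ?thesis using False by (simp add: mutate_matrix_alt)
  qed
  then show ?thesis using d(1) unfolding exchange_matrix_def by blast
qed

lemma full_rank_mutate:
  assumes "full_rank T" "k \<in> {1..seed_n T}" "seed_B T k k = 0"
  shows "full_rank (mutate k T)"
  unfolding full_rank_def mutate_simps
proof (intro allI impI)
  let ?n = "seed_n T" and ?b = "seed_B T"
  fix c :: "nat \<Rightarrow> int"
  assume c: "\<forall>i\<in>seed_idx T. (\<Sum>j\<in>{1..?n}. mutate_matrix k ?b i j * c j) = 0"
  \<comment> \<open>Away from row and column \<open>k\<close>, mutation adds multiples of row
    \<open>k\<close> and of column \<open>k\<close>. The multiples of row \<open>k\<close> drop out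
    because row \<open>k\<close> of the mutated matrix already annihilates \<open>c\<close>; the
    change at \<open>k\<close> absorbs the multiples of column \<open>k\<close>, so that
    \<open>c'\<close> is a kernel vector of the original matrix.\<close>
  define c' where "c' = c(k := (\<Sum>j\<in>{1..?n} - {k}. max 0 (- ?b k j) * c j) - c k)"
  have split: "(\<Sum>j\<in>{1..?n}. g j) = g k + (\<Sum>j\<in>{1..?n} - {k}. g j)" for g :: "nat \<Rightarrow> int"
    using assms(2) by (simp add: sum.remove)
  have "(\<Sum>j\<in>{1..?n}. mutate_matrix k ?b k j * c j) = 0" using c assms(2) by auto
  then have row: "(\<Sum>j\<in>{1..?n} - {k}. ?b k j * c j) = 0"
    using split[of "\<lambda>j. ?b k j * c j"] by (simp add: mutate_matrix_alt sum_negf assms(3))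
  have "(\<Sum>j\<in>{1..?n}. ?b i j * c' j) = 0" if i: "i \<in> seed_idx T" for i
  proof (cases "i = k")
    case True
    have "(\<Sum>j\<in>{1..?n}. ?b k j * c' j) = ?b k k * c' k + (\<Sum>j\<in>{1..?n} - {k}. ?b k j * c' j)"
      by (rule split)
    also have "(\<Sum>j\<in>{1..?n} - {k}. ?b k j * c' j) = (\<Sum>j\<in>{1..?n} - {k}. ?b k j * c j)"
      by (rule sum.cong) (auto simp: c'_def)
    finally show ?thesis using row True assms(3) by simp
  next
    case False
    have "0 = (\<Sum>j\<in>{1..?n}. mutate_matrix k ?b i j * c j)" using c i by simp
    also have "\<dots> = - ?b i k * c k + (\<Sum>j\<in>{1..?n} - {k}. mutate_matrix k ?b i j * c j)"
      by (subst split) (simp add: mutate_matrix_alt)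
    also have "(\<Sum>j\<in>{1..?n} - {k}. mutate_matrix k ?b i j * c j) =
        (\<Sum>j\<in>{1..?n} - {k}. ?b i j * c j + max 0 (?b i k) * (?b k j * c j) + ?b i k * (max 0 (- ?b k j) * c j))"
      by (rule sum.cong) (use False in \<open>auto simp: mutate_matrix_alt algebra_simps\<close>)
    also have "\<dots> = (\<Sum>j\<in>{1..?n} - {k}. ?b i j * c j) + ?b i k * (\<Sum>j\<in>{1..?n} - {k}. max 0 (- ?b k j) * c j)"
      using row by (simp add: sum.distrib flip: sum_distrib_left)
    finally have "?b i k * c' k + (\<Sum>j\<in>{1..?n} - {k}. ?b i j * c j) = 0"
      by (simp add: c'_def algebra_simps)
    also have "(\<Sum>j\<in>{1..?n} - {k}. ?b i j * c j) = (\<Sum>j\<in>{1..?n} - {k}. ?b i j * c' j)"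
      by (rule sum.cong) (auto simp: c'_def)
    finally show ?thesis by (subst split)
  qed
  then have c'0: "\<forall>j\<in>{1..?n}. c' j = 0" using assms(1) unfolding full_rank_def by blast
  then have *: "c j = 0" if "j \<in> {1..?n}" "j \<noteq> k" for j using that by (auto simp: c'_def dest!: bspec)
  have "c' k = - c k" using * by (simp add: c'_def)
  then show "\<forall>j\<in>{1..?n}. c j = 0" using * c'0 assms(2) by (metis neg_0_equal_iff_equal)
qed

text \<open>What becomes of an exponent vector when the mutated variable is rewritten as
  \<open>f_k / x_k\<close>, with the power of \<open>f_k\<close> set aside.\<close>

definition negate_at :: "nat \<Rightarrow> (nat \<Rightarrow>\<^sub>0 int) \<Rightarrow> nat \<Rightarrow>\<^sub>0 int" where
  "negate_at k e = e + sgl k (- 2 * lkp e k)"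

lemma lookup_negate_at: "lkp (negate_at k e) i = (if i = k then - lkp e i else lkp e i)"
  by (auto simp: negate_at_def lookup_add lookup_single when_def)

lemma inj_negate_at: "inj (negate_at k)"
  by (rule inj_onI, rule poly_mapping_eqI) (metis lookup_negate_at minus_equation_iff)

lemma monom_eval_mutate:
  assumes T: "good_seed K T" and kI: "k \<in> seed_idx T"
  shows "monom_eval (seed_pt (mutate k T)) e =
    monom_eval (seed_pt T) (negate_at k e) * exchange_poly T k powi lkp e k"
proof -
  have x': "seed_pt (mutate k T) = (seed_pt T)(k := exchange_poly T k / seed_pt T k)"
    by (rule seed_pt_mutate[OF kI])
  define A where "A = insert k (kys e)"
  have *: "finite A" "kys e \<subseteq> A" "kys (negate_at k e) \<subseteq> A"
    by (auto simp: A_def in_keys_iff lookup_negate_at split: if_splits)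
  have "monom_eval (seed_pt (mutate k T)) e =
      (\<Prod>i\<in>A. seed_pt T i powi lkp (negate_at k e) i * (if i = k then exchange_poly T k powi lkp e k else 1))"
    unfolding monom_eval_superset[OF *(1,2)]
    by (rule prod.cong) (auto simp: x' lookup_negate_at power_int_divide_distrib power_int_minus field_simps)
  also have "\<dots> = monom_eval (seed_pt T) (negate_at k e) * exchange_poly T k powi lkp e k"
    unfolding monom_eval_superset[OF *(1,3)] prod.distrib
    using *(1) by (simp add: A_def)
  finally show ?thesis .
qed

text \<open>A relation \<open>p\<close> in the mutated variables becomes, after multiplication by a
  power of \<open>f_k\<close>, a formal relation \<open>q = 0\<close> in the old ones. Since
  \<open>f_k\<close> is free of \<open>x_k\<close>, the part of \<open>q\<close> of degree
  \<open>- d\<close> in \<open>x_k\<close> collects exactly the terms of \<open>p\<close> with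
  exponent \<open>d\<close> at \<open>k\<close>, times one power of \<open>f_k\<close>. Cancelling
  that power kills the coefficients of \<open>p\<close>.\<close>

lemma good_seed_mutate:
  assumes K: "subring_set K" and T: "good_seed K T" and k: "k \<in> {1..seed_n T}"
  shows "good_seed K (mutate k T)"
proof -
  let ?I = "seed_idx T" and ?x = "seed_pt T" and ?x' = "seed_pt (mutate k T)"
  let ?f = "exchange_poly T k" and ?F = "exch_laurent T k"
  have kI: "k \<in> ?I" and diag: "seed_B T k k = 0"
    using k T exchange_matrix_diag by (auto simp: good_seed_def)
  have nz: "\<forall>i. ?x i \<noteq> 0" using good_seed_pt_nonzero[OF T] by blast
  have f0: "?f \<noteq> 0" using exchange_poly_nonzero[OF K T] .
  have x': "?x' = ?x(k := ?f / ?x k)" by (rule seed_pt_mutate[OF kI])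
  have nz': "\<forall>i. ?x' i \<noteq> 0" using nz f0 by (simp add: x')
  note mon = monom_eval_mutate[OF T kI]
  have F: "lkp e k = 0" if "e \<in> kys ?F" for e
    using that keys_exch_laurent[of T k] diag
    by (auto simp: pos_exp_def neg_exp_def lookup_expo)
  have "p = 0" if p: "p \<in> laurent_over K ?I" "laurent_eval ?x' p = 0" for p
  proof -
    \<comment> \<open>Large enough that no negative power of the exchange polynomial
      remains.\<close>
    define D where "D = (\<Sum>e\<in>kys p. \<bar>lkp e k\<bar>)"
    have D: "0 \<le> D + lkp e k" if "e \<in> kys p" for e
      using member_le_sum[of e "kys p" "\<lambda>e. \<bar>lkp e k\<bar>"] that by (auto simp: D_def)
    define q where "q = (\<Sum>e\<in>kys p. sgl (negate_at k e) (lkp p e) * ?F ^ nat (D + lkp e k))"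
    have neg: "kys (negate_at k e) \<subseteq> ?I" if "e \<in> kys p" for e
    proof -
      have "kys e \<subseteq> ?I" using that p(1) by (simp add: laurent_over_def)
      moreover have "kys (negate_at k e) \<subseteq> kys e"
        by (auto simp: in_keys_iff lookup_negate_at split: if_splits)
      ultimately show ?thesis by blast
    qed
    have q: "q \<in> laurent_over K ?I"
      unfolding q_def using p(1) neg
      by (intro laurent_over_sum laurent_over_mult laurent_over_single laurent_over_power exch_laurent_over K)
         (auto simp: laurent_over_def)
    have "laurent_eval ?x q = (\<Sum>e\<in>kys p. lkp p e * monom_eval ?x' e * ?f powi D)"
      unfolding q_def laurent_eval_sum
    proof (rule sum.cong)
      fix e assume "e \<in> kys p"
      then have "?f ^ nat (D + lkp e k) = ?f powi (D + lkp e k)" using D by (simp add: power_int_def)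
      then have "?f ^ nat (D + lkp e k) = ?f powi lkp e k * ?f powi D" using f0 by (simp add: power_int_add)
      then show "laurent_eval ?x (sgl (negate_at k e) (lkp p e) * ?F ^ nat (D + lkp e k)) =
          lkp p e * monom_eval ?x' e * ?f powi D"
        using nz by (simp add: laurent_eval_mult laurent_eval_power laurent_eval_exch mon)
    qed simp
    also have "\<dots> = 0" using p(2) by (simp add: laurent_eval_alt flip: sum_distrib_right)
    finally have q0: "q = 0" using good_seed_kernel[OF T q] by blast
    show "p = 0"
    proof (rule poly_mapping_eqI)
      fix e :: "nat \<Rightarrow>\<^sub>0 int"
      define d where "d = lkp e k"
      have "homog_part (\<lambda>e. lkp e k) (- d) q =
          (\<Sum>e\<in>kys p. homog_part (\<lambda>e. lkp e k) (- d) (sgl (negate_at k e) (lkp p e) * ?F ^ nat (D + lkp e k)))"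
        unfolding q_def
        by (rule poly_mapping_eqI) (simp add: lookup_homog_part lookup_sum)
      also have "\<dots> = (\<Sum>e\<in>kys p. if lkp e k = d then sgl (negate_at k e) (lkp p e) * ?F ^ nat (D + d) else 0)"
      proof (rule sum.cong[OF refl])
        fix e'
        have pw: "lkp a k = 0" if "a \<in> kys (?F ^ r)" for a r
          using that
        proof (induction r arbitrary: a)
          case (Suc r)
          then show ?case using keys_mult[of ?F "?F ^ r"] F by (auto simp: lookup_add)
        qed (auto split: if_splits)
        have "lkp a k = - lkp e' k" if a: "a \<in> kys (sgl (negate_at k e') (lkp p e') * ?F ^ r)" for a r
        proof -
          obtain b c where "a = b + c" "b \<in> kys (sgl (negate_at k e') (lkp p e'))" "c \<in> kys (?F ^ r)"
            using a keys_mult[of "sgl (negate_at k e') (lkp p e')" "?F ^ r"] by blast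
          then show ?thesis using pw[of c r] by (simp add: lookup_add lookup_negate_at split: if_splits)
        qed
        then show "homog_part (\<lambda>e. lkp e k) (- d) (sgl (negate_at k e') (lkp p e') * ?F ^ nat (D + lkp e' k)) =
          (if lkp e' k = d then sgl (negate_at k e') (lkp p e') * ?F ^ nat (D + d) else 0)"
          by (auto intro!: homog_part_eq_0 homog_part_id)
      qed
      also have "\<dots> = (\<Sum>e\<in>kys p. if lkp e k = d then sgl (negate_at k e) (lkp p e) else 0) * ?F ^ nat (D + d)"
        by (simp add: sum_distrib_right if_distrib[of "\<lambda>a. a * _"] cong: if_cong)
      finally have "(\<Sum>e\<in>kys p. if lkp e k = d then sgl (negate_at k e) (lkp p e) else 0) * ?F ^ nat (D + d) = 0"
        using q0 homog_part_eq_0[of 0 "\<lambda>e. lkp e k" "- d"] by (metis empty_iff keys_zero)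
      then have "(\<Sum>e\<in>kys p. if lkp e k = d then sgl (negate_at k e) (lkp p e) else 0) = 0"
        using exch_laurent_nonzero[of T k] by simp
      then have "0 = lkp (\<Sum>e\<in>kys p. if lkp e k = d then sgl (negate_at k e) (lkp p e) else 0) (negate_at k e)"
        by simp
      also have "\<dots> = (\<Sum>e'\<in>kys p. if e' = e then lkp p e else 0)"
        unfolding lookup_sum
        by (rule sum.cong) (auto simp: d_def lookup_single when_def inj_eq[OF inj_negate_at])
      also have "\<dots> = lkp p e" by (simp add: in_keys_iff)
      finally show "lkp p e = lkp 0 e" by simp
    qed
  qed
  moreover have "\<forall>i\<in>?I. seed_x (mutate k T) i \<noteq> 0"
    using nz' by (auto simp: seed_pt_def split: if_splits)
  ultimately show ?thesis
    using exchange_matrix_mutate full_rank_mutate[OF _ k diag] T k by (auto simp: good_seed_def)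
qed

section \<open>The initial seed\<close>

lemma full_rank_principal:
  assumes "principal_coefficients S"
  shows "full_rank S"
  unfolding full_rank_def
proof (intro allI impI ballI)
  fix c :: "nat \<Rightarrow> int" and i
  assume c: "\<forall>i\<in>seed_idx S. (\<Sum>j\<in>{1..seed_n S}. seed_B S i j * c j) = 0" and i: "i \<in> {1..seed_n S}"
  have "seed_n S + i \<in> seed_idx S" using i assms by (simp add: principal_coefficients_def)
  then have "0 = (\<Sum>j\<in>{1..seed_n S}. seed_B S (seed_n S + i) j * c j)"
    using c by metis
  also have "\<dots> = (\<Sum>j\<in>{1..seed_n S}. if i = j then c j else 0)"
    using assms i unfolding principal_coefficients_def by (intro sum.cong) auto
  also have "\<dots> = c i" using i by simp
  finally show "c i = 0" by simp
qed

lemma algebraically_independent_nonzero: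
  assumes K: "subring_set K" and S: "algebraically_independent K I x" and i: "i \<in> I"
  shows "x i \<noteq> 0"
proof
  assume "x i = 0"
  then have "poly_eval x (sgl (sgl i 1) 1) = 0" by (simp add: poly_eval_def)
  moreover have "\<forall>e. lkp (sgl (sgl i 1) 1) e \<in> K"
    using subring_set_0[OF K] subring_set_1[OF K] by (simp add: lookup_single when_def)
  moreover have "\<forall>e\<in>kys (sgl (sgl i 1) 1). kys e \<subseteq> I" using i by (auto split: if_splits)
  ultimately have "sgl (sgl i (1::nat)) (1::'a) = 0"
    using S unfolding algebraically_independent_def by blast
  then show False by (metis lookup_single_eq lookup_zero zero_neq_one)
qed

text \<open>\<open>D\<close> bounds all exponents in absolute value. Multiplication by the
  \<open>D\<close>-th power of the product of the variables turns \<open>p\<close> into an ordinary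
  polynomial; the shift of exponents is injective, so no coefficients merge.\<close>

lemma laurent_independent:
  assumes K: "subring_set K" and S: "algebraically_independent K I x" and I: "finite I"
    and p: "p \<in> laurent_over K I" "laurent_eval x p = 0"
  shows "p = 0"
proof -
  have nz: "x i \<noteq> 0" if "i \<in> I" for i using algebraically_independent_nonzero[OF K S that] .
  define D where "D = (\<Sum>e\<in>kys p. \<Sum>i\<in>I. \<bar>lkp e i\<bar>)"
  have D: "0 \<le> lkp e i + D" if "e \<in> kys p" "i \<in> I" for e i
  proof -
    have 1: "\<bar>lkp e i\<bar> \<le> (\<Sum>i\<in>I. \<bar>lkp e i\<bar>)" using that I member_le_sum[of i I "\<lambda>i. \<bar>lkp e i\<bar>"] by auto
    have "(\<Sum>i\<in>I. \<bar>lkp e i\<bar>) \<le> D" unfolding D_def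
      using that member_le_sum[of e "kys p" "\<lambda>e. \<Sum>i\<in>I. \<bar>lkp e i\<bar>"] by (auto intro: sum_nonneg)
    with 1 show ?thesis by linarith
  qed
  define h where "h e = (\<Sum>i\<in>I. sgl i (nat (lkp e i + D)))" for e
  have h: "lkp (h e) i = (if i \<in> I then nat (lkp e i + D) else 0)" for e i
    using I by (simp add: h_def lookup_sum lookup_single when_def)
  have kI: "lkp e i = 0" if "e \<in> kys p" "i \<notin> I" for e i
  proof -
    have "kys e \<subseteq> I" using that(1) p(1) by (simp add: laurent_over_def)
    then show ?thesis using that(2) by (auto simp: in_keys_iff)
  qed
  have inj: "inj_on h (kys p)"
  proof (rule inj_onI, rule poly_mapping_eqI)
    fix e e' i assume e: "e \<in> kys p" "e' \<in> kys p" "h e = h e'"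
    show "lkp e i = lkp e' i"
    proof (cases "i \<in> I")
      case True
      have "lkp (h e) i = lkp (h e') i" using e by simp
      then show ?thesis using True D[OF e(1) True] D[OF e(2) True] by (simp add: h eq_nat_nat_iff)
    qed (use kI e in auto)
  qed
  define q where "q = (\<Sum>e\<in>kys p. sgl (h e) (lkp p e))"
  have lq: "lkp q (h e) = lkp p e" if "e \<in> kys p" for e
  proof -
    have "lkp q (h e) = (\<Sum>e'\<in>kys p. if e' = e then lkp p e else 0)"
      unfolding q_def lookup_sum using that inj by (intro sum.cong) (auto simp: lookup_single when_def inj_on_def)
    then show ?thesis using that by simp
  qed
  have kq: "kys q = h ` kys p"
  proof
    show "kys q \<subseteq> h ` kys p"
      unfolding q_def by (rule subsetI) (auto simp: in_keys_iff[of _ "sum _ _"] lookup_sum lookup_single when_def elim!: sum.not_neutral_contains_not_neutral split: if_splits)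
    show "h ` kys p \<subseteq> kys q" using lq by (auto simp: in_keys_iff)
  qed
  have hk: "kys (h e) \<subseteq> I" for e by (auto simp: in_keys_iff h split: if_splits)
  have mon: "(\<Prod>i\<in>kys (h e). x i ^ lkp (h e) i) = monom_eval x e * (\<Prod>i\<in>I. x i powi D)" if e: "e \<in> kys p" for e
  proof -
    have "(\<Prod>i\<in>kys (h e). x i ^ lkp (h e) i) = (\<Prod>i\<in>I. x i ^ lkp (h e) i)"
      by (rule prod.mono_neutral_left) (use I hk in \<open>auto simp: in_keys_iff\<close>)
    also have "\<dots> = (\<Prod>i\<in>I. x i powi lkp e i * x i powi D)"
    proof (rule prod.cong[OF refl])
      fix i assume i: "i \<in> I"
      have "x i ^ nat (lkp e i + D) = x i powi (lkp e i + D)"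
        using D[OF e i] by (simp add: power_int_def)
      then show "x i ^ lkp (h e) i = x i powi lkp e i * x i powi D"
        using i nz by (simp add: h power_int_add)
    qed
    also have "\<dots> = monom_eval x e * (\<Prod>i\<in>I. x i powi D)"
      using p(1) e I by (subst monom_eval_superset[of I]) (auto simp: prod.distrib laurent_over_def)
    finally show ?thesis .
  qed
  have "poly_eval x q = (\<Sum>e\<in>kys p. lkp p e * (monom_eval x e * (\<Prod>i\<in>I. x i powi D)))"
    unfolding poly_eval_def kq sum.reindex[OF inj] o_def
    by (rule sum.cong) (simp_all add: lq mon)
  also have "\<dots> = laurent_eval x p * (\<Prod>i\<in>I. x i powi D)"
    by (simp add: laurent_eval_alt sum_distrib_right mult.assoc)
  finally have "poly_eval x q = 0" using p(2) by simp
  moreover have "\<forall>e. lkp q e \<in> K"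
  proof
    fix e show "lkp q e \<in> K"
    proof (cases "e \<in> kys q")
      case True
      then show ?thesis using lq kq p(1) by (auto simp: laurent_over_def)
    qed (use subring_set_0[OF K] in \<open>auto simp: in_keys_iff\<close>)
  qed
  moreover have "\<forall>e\<in>kys q. kys e \<subseteq> I" using kq hk by auto
  ultimately have "q = 0" using S unfolding algebraically_independent_def by blast
  then have "kys p = {}" using kq by auto
  then show ?thesis by simp
qed

lemma good_seed_principal:
  assumes K: "subring_set K" and S: "is_seed K S" "principal_coefficients S"
  shows "good_seed K S"
proof -
  have ai: "algebraically_independent K (seed_idx S) (seed_x S)" using S by (simp add: is_seed_def)
  have "laurent_eval (seed_pt S) p = laurent_eval (seed_x S) p" if "p \<in> laurent_over K (seed_idx S)" for p
    using that by (rule laurent_eval_cong) (auto simp: seed_pt_def)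
  then show ?thesis
    using algebraically_independent_nonzero[OF K ai] laurent_independent[OF K ai] full_rank_principal[OF S(2)] S(1)
    by (auto simp: good_seed_def is_seed_def)
qed

subsection \<open>The Laurent phenomenon\<close>

definition laurent_ring :: "'f::field_char_0 set \<Rightarrow> 'f seed \<Rightarrow> 'f set" where
  "laurent_ring K T = laurent_eval (seed_pt T) ` laurent_over K (seed_idx T)"

lemma laurent_ringI:
  "p \<in> laurent_over K (seed_idx T) \<Longrightarrow> laurent_eval (seed_pt T) p = a \<Longrightarrow> a \<in> laurent_ring K T"
  unfolding laurent_ring_def by blast

lemma laurent_ringE:
  assumes "a \<in> laurent_ring K T"
  obtains p where "p \<in> laurent_over K (seed_idx T)" "a = laurent_eval (seed_pt T) p"
  using assms unfolding laurent_ring_def by blast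

lemma seed_pt_nz: "good_seed K T \<Longrightarrow> \<forall>i. seed_pt T i \<noteq> 0"
  using good_seed_pt_nonzero by blast

context
  fixes K :: "'f::field_char_0 set" and T :: "'f seed"
  assumes K: "subring_set K" and T: "good_seed K T"
begin

lemma subring_laurent_ring: "subring_set (laurent_ring K T)"
  unfolding subring_set_def
proof (intro conjI ballI)
  show "1 \<in> laurent_ring K T"
    by (rule laurent_ringI[OF laurent_over_1[OF K]]) simp
next
  fix a b assume "a \<in> laurent_ring K T" "b \<in> laurent_ring K T"
  then obtain p q where p: "p \<in> laurent_over K (seed_idx T)" "a = laurent_eval (seed_pt T) p"
    and q: "q \<in> laurent_over K (seed_idx T)" "b = laurent_eval (seed_pt T) q"
    by (elim laurent_ringE) blast
  show "a - b \<in> laurent_ring K T"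
    by (rule laurent_ringI[OF laurent_over_diff[OF K p(1) q(1)]]) (simp add: p q laurent_eval_diff)
  show "a * b \<in> laurent_ring K T"
    by (rule laurent_ringI[OF laurent_over_mult[OF K p(1) q(1)]])
       (simp add: p q laurent_eval_mult[OF seed_pt_nz[OF T]])
qed

lemma laurent_ring_base: "c \<in> K \<Longrightarrow> c \<in> laurent_ring K T"
  by (rule laurent_ringI[OF laurent_over_single[OF K, of c 0]]) simp_all

lemma laurent_ring_monom: "kys e \<subseteq> seed_idx T \<Longrightarrow> monom_eval (seed_pt T) e \<in> laurent_ring K T"
  by (rule laurent_ringI[OF laurent_over_single[OF K subring_set_1[OF K]]]) simp_all

lemma laurent_ring_var: "seed_pt T i \<in> laurent_ring K T"
proof (cases "i \<in> seed_idx T")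
  case True
  then show ?thesis using laurent_ring_monom[of "sgl i 1"] by simp
next
  case False
  then have "seed_pt T i = 1" unfolding seed_pt_def by (rule if_not_P)
  then show ?thesis using subring_set_1[OF subring_laurent_ring] by simp
qed

lemma laurent_ring_inverse_var: "inverse (seed_pt T i) \<in> laurent_ring K T"
proof (cases "i \<in> seed_idx T")
  case True
  then show ?thesis using laurent_ring_monom[of "sgl i (- 1)"] by (simp add: power_int_minus)
next
  case False
  then have "seed_pt T i = 1" unfolding seed_pt_def by (rule if_not_P)
  then show ?thesis using subring_set_1[OF subring_laurent_ring] by simp
qed

lemma laurent_ring_exch: "exchange_poly T k \<in> laurent_ring K T"
  by (rule laurent_ringI[OF exch_laurent_over[OF K] laurent_eval_exch])

end

text \<open>One \<open>d\<close> that clears each single inverse clears every Laurent polynomial. It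
  is applied with one or two exchanged variables for the Laurent phenomenon, and with the product of
  the initial variables to reach \<open>A\<close>.\<close>

lemma clear_denominators:
  fixes R :: "'f::field_char_0 set"
  assumes R: "subring_set R" and "K \<subseteq> R" and d: "d \<in> R"
    and x: "\<And>i. i \<in> I \<Longrightarrow> x i \<in> R" "\<And>i. i \<in> I \<Longrightarrow> d * inverse (x i) \<in> R"
    and p: "p \<in> laurent_over K I"
  obtains a where "d ^ a * laurent_eval x p \<in> R"
proof -
  have pw: "\<exists>a. d ^ a * x i powi v \<in> R" if i: "i \<in> I" for i v
  proof (cases "v \<ge> 0")
    case True
    then have "d ^ 0 * x i powi v \<in> R"
      using subring_set_power[OF R x(1)[OF i]] by (simp add: power_int_def)
    then show ?thesis by blast
  next
    case False
    then have "d ^ nat (- v) * x i powi v = (d * inverse (x i)) ^ nat (- v)"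
      by (simp add: power_int_def power_mult_distrib)
    then show ?thesis using subring_set_power[OF R x(2)[OF i]] by metis
  qed
  have mon: "\<exists>a. d ^ a * (\<Prod>i\<in>A. x i powi v i) \<in> R" if "finite A" "A \<subseteq> I" for A v
    using that
  proof (induction A rule: finite_induct)
    case empty
    then show ?case using subring_set_1[OF R] by (intro exI[of _ 0]) simp
  next
    case (insert i A)
    obtain a where a: "d ^ a * (\<Prod>i\<in>A. x i powi v i) \<in> R" using insert by blast
    obtain b where b: "d ^ b * x i powi v i \<in> R" using pw insert by blast
    have "d ^ (b + a) * (\<Prod>i\<in>insert i A. x i powi v i) = (d ^ b * x i powi v i) * (d ^ a * (\<Prod>i\<in>A. x i powi v i))"
      using insert by (simp add: power_add mult_ac)
    then show ?case using subring_set_mult[OF R b a] by metis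
  qed
  have "\<exists>a. d ^ a * (\<Sum>e\<in>E. lkp p e * monom_eval x e) \<in> R" if "finite E" "E \<subseteq> kys p" for E
    using that
  proof (induction E rule: finite_induct)
    case empty
    then show ?case using subring_set_0[OF R] by (intro exI[of _ 0]) simp
  next
    case (insert e E)
    obtain a where a: "d ^ a * (\<Sum>e\<in>E. lkp p e * monom_eval x e) \<in> R" using insert by blast
    have "kys e \<subseteq> I" using insert p by (simp add: laurent_over_def)
    then obtain b where b: "d ^ b * monom_eval x e \<in> R" unfolding monom_eval_def using mon[of "kys e"] by auto
    have c: "lkp p e \<in> R" using p assms(2) unfolding laurent_over_def by blast
    have "d ^ (b + a) * (\<Sum>e\<in>insert e E. lkp p e * monom_eval x e) =
      d ^ a * (lkp p e * (d ^ b * monom_eval x e)) + d ^ b * (d ^ a * (\<Sum>e\<in>E. lkp p e * monom_eval x e))"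
      using insert by (simp add: power_add algebra_simps)
    moreover have "\<dots> \<in> R"
      by (intro subring_set_add[OF R] subring_set_mult[OF R] subring_set_power[OF R] d a b c)
    ultimately show ?case by metis
  qed
  from this[of "kys p"] show thesis using that by (auto simp: laurent_eval_alt)
qed

text \<open>Injectivity of multiplication by \<open>g\<close> on \<open>R/uR\<close>. In a factorial
  ring with \<open>u\<close> nonzero this is coprimality of \<open>u\<close> and \<open>g\<close>;
  the present form makes sense without factoriality.\<close>

definition nonzerodivisor_mod :: "'f::field set \<Rightarrow> 'f \<Rightarrow> 'f \<Rightarrow> bool" where
  "nonzerodivisor_mod R u g \<longleftrightarrow> (\<forall>h\<in>R. \<forall>q\<in>R. g * h = u * q \<longrightarrow> (\<exists>q'\<in>R. h = u * q'))"

lemma nonzerodivisor_modD: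
  "nonzerodivisor_mod R u g \<Longrightarrow> h \<in> R \<Longrightarrow> q \<in> R \<Longrightarrow> g * h = u * q \<Longrightarrow> \<exists>q'\<in>R. h = u * q'"
  unfolding nonzerodivisor_mod_def by blast

context
  fixes R :: "'f::field_char_0 set"
  assumes R: "subring_set R"
begin

lemma nonzerodivisor_mod_1: "nonzerodivisor_mod R u 1"
  unfolding nonzerodivisor_mod_def by auto

lemma nonzerodivisor_mod_mult:
  assumes "nonzerodivisor_mod R u g" "nonzerodivisor_mod R u g'" "g' \<in> R"
  shows "nonzerodivisor_mod R u (g * g')"
  unfolding nonzerodivisor_mod_def
proof (intro ballI impI)
  fix h q assume h: "h \<in> R" "q \<in> R" "g * g' * h = u * q"
  then obtain q' where "q' \<in> R" "g' * h = u * q'"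
    using nonzerodivisor_modD[OF assms(1), of "g' * h" q] subring_set_mult[OF R assms(3) h(1)]
    by (auto simp: mult.assoc)
  then show "\<exists>q'\<in>R. h = u * q'" using nonzerodivisor_modD[OF assms(2) h(1)] by blast
qed

lemma nonzerodivisor_mod_power:
  "nonzerodivisor_mod R u g \<Longrightarrow> g \<in> R \<Longrightarrow> nonzerodivisor_mod R u (g ^ k)"
  by (induction k) (auto intro!: nonzerodivisor_mod_1 nonzerodivisor_mod_mult subring_set_power[OF R])

lemma nonzerodivisor_mod_unit:
  assumes "nonzerodivisor_mod R f g" "c \<in> R" "inverse c \<in> R" "c \<noteq> 0"
  shows "nonzerodivisor_mod R (f * c) g"
  unfolding nonzerodivisor_mod_def
proof (intro ballI impI)
  fix h q assume h: "h \<in> R" "q \<in> R" "g * h = f * c * q"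
  then obtain q' where q': "q' \<in> R" "h = f * q'"
    using nonzerodivisor_modD[OF assms(1), of h "c * q"] subring_set_mult[OF R assms(2) h(2)]
    by (auto simp: mult.assoc)
  then have "h = f * c * (inverse c * q')" using assms(4) by (simp add: field_simps)
  then show "\<exists>q'\<in>R. h = f * c * q'" using subring_set_mult[OF R assms(3) q'(1)] by blast
qed

lemma nonzerodivisor_mod_cong:
  assumes "nonzerodivisor_mod R u g" "c \<in> R" "inverse c \<in> R" "c \<noteq> 0" "D \<in> R"
  shows "nonzerodivisor_mod R u (c * (g + u * D))"
  unfolding nonzerodivisor_mod_def
proof (intro ballI impI)
  fix h q assume h: "h \<in> R" "q \<in> R" "c * (g + u * D) * h = u * q"
  then have "g * (c * h) = u * (q - D * (c * h))" by (simp add: algebra_simps)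
  moreover have "c * h \<in> R" "q - D * (c * h) \<in> R"
    using h assms by (auto intro!: subring_set_mult[OF R] subring_set_diff[OF R])
  ultimately obtain q' where q': "q' \<in> R" "c * h = u * q'"
    using nonzerodivisor_modD[OF assms(1)] by blast
  then have "h = u * (inverse c * q')" using assms(4) by (simp add: field_simps)
  then show "\<exists>q'\<in>R. h = u * q'" using subring_set_mult[OF R assms(3) q'(1)] by blast
qed

text \<open>An element with both a power of \<open>u\<close> and a power of \<open>d\<close> as
  denominator has neither: the factors \<open>u\<close> are removed one at a time, each division by
  \<open>u\<close> being possible because it is possible after multiplication by
  \<open>d ^ b\<close>.\<close>

lemma nonzerodivisor_mod_cancel:
  assumes d: "nonzerodivisor_mod R u d" "d \<in> R" and u: "u \<in> R" "u \<noteq> 0"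
    and "u ^ a * a0 \<in> R" "d ^ b * a0 \<in> R"
  shows "a0 \<in> R"
  using assms(5)
proof (induction a)
  case (Suc a)
  have "d ^ b * (u ^ Suc a * a0) = u * (u ^ a * (d ^ b * a0))" by (simp add: mult_ac)
  moreover have "u ^ a * (d ^ b * a0) \<in> R"
    by (intro subring_set_mult[OF R] subring_set_power[OF R] u assms(6))
  ultimately obtain q' where "q' \<in> R" "u ^ Suc a * a0 = u * q'"
    using nonzerodivisor_modD[OF nonzerodivisor_mod_power[OF d] Suc.prems] by blast
  then show ?case using Suc.IH u(2) by simp
qed simp

end

text \<open>The criterion behind all coprimality proofs: \<open>homog_dvd_cancel\<close> carried
  from formal Laurent polynomials to their values. The coefficient 1 of the leading monomial makes
  it a unit over the integers as well.\<close>

lemma nonzerodivisor_mod_homog: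
  fixes l :: "(nat \<Rightarrow>\<^sub>0 int) \<Rightarrow> int"
  assumes K: "subring_set K" and T: "good_seed K T"
    and l: "\<And>e e'. l (e + e') = l e + l e'"
    and F: "F \<in> laurent_over K (seed_idx T)" "\<And>e. e \<in> kys F \<Longrightarrow> l e = f"
    and C: "C \<in> laurent_over K (seed_idx T)" "\<And>e. e \<in> kys C \<Longrightarrow> l e = c"
    and a: "c < l a" "kys a \<subseteq> seed_idx T"
  shows "nonzerodivisor_mod (laurent_ring K T) (laurent_eval (seed_pt T) F)
           (laurent_eval (seed_pt T) (sgl a 1 + C))"
  unfolding nonzerodivisor_mod_def
proof (intro ballI impI)
  let ?ev = "laurent_eval (seed_pt T)" and ?L = "laurent_over K (seed_idx T)"
  fix h q assume "h \<in> laurent_ring K T" "q \<in> laurent_ring K T" and eq: "?ev (sgl a 1 + C) * h = ?ev F * q"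
  then obtain h' q' where h: "h' \<in> ?L" "h = ?ev h'" and q: "q' \<in> ?L" "q = ?ev q'"
    by (elim laurent_ringE) blast
  note mult = laurent_eval_mult[OF seed_pt_nz[OF T]]
  have G: "sgl a 1 + C \<in> ?L"
    by (intro laurent_over_add laurent_over_single K subring_set_1 C a)
  have "?ev (F * q') = ?ev ((sgl a 1 + C) * h')" using eq h q by (simp add: mult)
  then have "F * q' = (sgl a 1 + C) * h'"
    using good_seed_inj[OF K T] laurent_over_mult[OF K F(1) q(1)] laurent_over_mult[OF K G h(1)] by blast
  then obtain q1 where "q1 \<in> ?L" "h' = F * q1"
    using homog_dvd_cancel[OF l K, of F f C c a "seed_idx T" q' h'] F C a h q by blast
  then show "\<exists>q'\<in>laurent_ring K T. h = ?ev F * q'"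
    using h(2) mult laurent_ringI[of q1 K T] by auto
qed

section \<open>Coprimality from full rank\<close>

lemma exchange_poly_mutate_indep:
  fixes T :: "'f::field_char_0 seed"
  assumes "seed_B T j k = 0" "j \<in> seed_idx T" "j \<noteq> k"
  shows "exchange_poly (mutate j T) k = exchange_poly T k"
proof -
  have B: "seed_B (mutate j T) i k = seed_B T i k" for i
    using assms by (simp add: mutate_matrix_alt)
  have "(\<Prod>l\<in>seed_idx T. seed_pt (mutate j T) l powi max 0 (c * seed_B T l k)) =
        (\<Prod>l\<in>seed_idx T. seed_pt T l powi max 0 (c * seed_B T l k))" for c :: int
    by (rule prod.cong) (use assms in \<open>auto simp: seed_pt_mutate\<close>)
  from this[of 1] this[of "- 1"] show ?thesis
    unfolding exchange_poly_alt B by simp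
qed

lemma full_rank_column:
  assumes "full_rank T" "j \<in> {1..seed_n T}"
  obtains i where "i \<in> seed_idx T" "seed_B T i j \<noteq> 0"
proof -
  have "\<exists>i\<in>seed_idx T. seed_B T i j \<noteq> 0"
  proof (rule ccontr)
    let ?c = "\<lambda>j'. if j' = j then 1 else 0 :: int"
    assume "\<not> (\<exists>i\<in>seed_idx T. seed_B T i j \<noteq> 0)"
    then have "\<forall>i\<in>seed_idx T. (\<Sum>j'\<in>{1..seed_n T}. seed_B T i j' * ?c j') = 0"
      by (intro ballI sum.neutral) simp
    with assms(1) have "\<forall>j'\<in>{1..seed_n T}. ?c j' = 0" unfolding full_rank_def by (elim allE[of _ ?c] mp)
    from bspec[OF this assms(2)] show False by simp
  qed
  then show thesis using that by blast
qed

lemma full_rank_minor: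
  assumes "full_rank T" "j \<in> {1..seed_n T}" "k \<in> {1..seed_n T}" "j \<noteq> k"
  obtains a b where "a \<in> seed_idx T" "b \<in> seed_idx T"
    "seed_B T a j * seed_B T b k - seed_B T b j * seed_B T a k \<noteq> 0"
proof -
  let ?B = "seed_B T" and ?n = "seed_n T"
  have ex: "\<exists>i\<in>seed_idx T. (\<Sum>j\<in>{1..?n}. ?B i j * c j) \<noteq> 0" if "c j0 \<noteq> 0" "j0 \<in> {1..?n}" for c j0
    using assms(1) that unfolding full_rank_def by blast
  obtain a where a: "a \<in> seed_idx T" "?B a j \<noteq> 0" using full_rank_column[OF assms(1,2)] .
  \<comment> \<open>The combination of columns \<open>j\<close> and \<open>k\<close> that cancels in
    row \<open>a\<close>. It is nontrivial, so it survives in some row \<open>b\<close>, and its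
    entry there is the minor.\<close>
  define c where "c j' = (if j' = k then ?B a j else if j' = j then - ?B a k else 0)" for j'
  have sm: "(\<Sum>j'\<in>{1..?n}. ?B i j' * c j') = ?B i k * ?B a j - ?B i j * ?B a k" for i
  proof -
    have "(\<Sum>j'\<in>{1..?n}. ?B i j' * c j') =
        (\<Sum>j'\<in>{1..?n}. (if j' = k then ?B i k * ?B a j else 0) + (if j' = j then - ?B i j * ?B a k else 0))"
      by (rule sum.cong) (use assms(4) in \<open>auto simp: c_def\<close>)
    also have "\<dots> = ?B i k * ?B a j - ?B i j * ?B a k"
      using assms(2,3) by (simp add: sum.distrib)
    finally show ?thesis .
  qed
  obtain b where "b \<in> seed_idx T" "?B b k * ?B a j - ?B b j * ?B a k \<noteq> 0"
    using ex[of c k] a assms(3) unfolding sm by (auto simp: c_def)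
  then show thesis using that[OF a(1)] by (simp add: mult.commute)
qed

text \<open>Only exponent differences matter: the two monomials of \<open>f_r\<close> differ by
  column \<open>r\<close>. A weight orthogonal to column \<open>j\<close> but not to column
  \<open>k\<close> makes \<open>f_j\<close> homogeneous and gives \<open>f_k\<close> a leading
  monomial.\<close>

lemma nonzerodivisor_mod_exchange_polys:
  assumes K: "subring_set K" and T: "good_seed K T"
    and jk: "j \<in> {1..seed_n T}" "k \<in> {1..seed_n T}" "j \<noteq> k"
  shows "nonzerodivisor_mod (laurent_ring K T) (exchange_poly T j) (exchange_poly T k)"
proof -
  let ?B = "seed_B T"
  obtain a b where ab: "a \<in> seed_idx T" "b \<in> seed_idx T" and d: "?B a j * ?B b k - ?B b j * ?B a k \<noteq> 0"
    using full_rank_minor[OF _ jk] T unfolding good_seed_def by blast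
  \<comment> \<open>The weight of column \<open>j\<close> is 0 identically, that of column
    \<open>k\<close> is the minor.\<close>
  define l where "l e = ?B a j * lkp e b - ?B b j * lkp e a" for e
  have l: "l (e + e') = l e + l e'" for e e' by (simp add: l_def lookup_add algebra_simps)
  have pn: "lkp (pos_exp T r) i - lkp (neg_exp T r) i = ?B i r" if "i \<in> seed_idx T" for i r
    using that by (simp add: pos_exp_def neg_exp_def lookup_expo max_def)
  have diff: "l (pos_exp T r) - l (neg_exp T r) = ?B a j * ?B b r - ?B b j * ?B a r" for r
  proof -
    have "l (pos_exp T r) - l (neg_exp T r) =
        ?B a j * (lkp (pos_exp T r) b - lkp (neg_exp T r) b) - ?B b j * (lkp (pos_exp T r) a - lkp (neg_exp T r) a)"
      by (simp add: l_def algebra_simps)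
    then show ?thesis using pn ab by simp
  qed
  have "l e = l (pos_exp T j)" if "e \<in> kys (exch_laurent T j)" for e
    using that keys_exch_laurent[of T j] diff[of j] by auto
  note F = exch_laurent_over[OF K, of T j] this
  have ks: "kys (pos_exp T k) \<subseteq> seed_idx T" "kys (neg_exp T k) \<subseteq> seed_idx T"
    unfolding pos_exp_def neg_exp_def by (simp_all add: keys_expo)
  note over = laurent_over_single[OF K subring_set_1[OF K]]
  consider "l (pos_exp T k) < l (neg_exp T k)" | "l (pos_exp T k) > l (neg_exp T k)"
    using diff[of k] d by linarith
  then have "nonzerodivisor_mod (laurent_ring K T) (laurent_eval (seed_pt T) (exch_laurent T j))
     (laurent_eval (seed_pt T) (exch_laurent T k))"
  proof cases
    case 1
    have "nonzerodivisor_mod (laurent_ring K T) (laurent_eval (seed_pt T) (exch_laurent T j))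
       (laurent_eval (seed_pt T) (sgl (neg_exp T k) 1 + sgl (pos_exp T k) 1))"
      by (rule nonzerodivisor_mod_homog[OF K T l F over[OF ks(1)] _ 1 ks(2)]) auto
    then show ?thesis by (simp add: exch_laurent_def add.commute)
  next
    case 2
    have "nonzerodivisor_mod (laurent_ring K T) (laurent_eval (seed_pt T) (exch_laurent T j))
       (laurent_eval (seed_pt T) (sgl (pos_exp T k) 1 + sgl (neg_exp T k) 1))"
      by (rule nonzerodivisor_mod_homog[OF K T l F over[OF ks(2)] _ 2 ks(1)]) auto
    then show ?thesis by (simp add: exch_laurent_def)
  qed
  then show ?thesis unfolding laurent_eval_exch .
qed

text \<open>Needed with \<open>t\<close> a multiple of \<open>u\<close>: the twice exchanged
  variable has \<open>u\<close> in its denominator, so its class modulo \<open>u\<close> depends on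
  the linear term of the power.\<close>

lemma binomial_second_order:
  fixes Q t :: "'f::field_char_0"
  assumes R: "subring_set R" and "Q \<in> R" "t \<in> R"
  obtains G where "G \<in> R" "(Q + t) ^ c = Q ^ c + of_nat c * Q ^ (c - 1) * t + t ^ 2 * G"
proof -
  have "\<exists>G\<in>R. (Q + t) ^ c = Q ^ c + of_nat c * Q ^ (c - 1) * t + t ^ 2 * G"
  proof (induction c)
    case 0
    then show ?case using subring_set_0[OF R] by (intro bexI[of _ 0]) auto
  next
    case (Suc c)
    then obtain G where G: "G \<in> R" "(Q + t) ^ c = Q ^ c + of_nat c * Q ^ (c - 1) * t + t ^ 2 * G" by blast
    \<comment> \<open>For \<open>c = 0\<close> both sides vanish, so the truncated
      \<open>c - 1\<close> does no harm.\<close>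
    have Q: "of_nat c * Q ^ (c - 1) * Q = of_nat c * Q ^ c" by (cases c) auto
    have "(Q + t) ^ Suc c = (Q + t) * (Q ^ c + of_nat c * Q ^ (c - 1) * t + t ^ 2 * G)" using G(2) by simp
    also have "\<dots> = Q ^ Suc c + (of_nat c * Q ^ (c - 1) * Q) * t + Q ^ c * t +
        t ^ 2 * (of_nat c * Q ^ (c - 1) + (Q + t) * G)"
      by (simp add: algebra_simps power2_eq_square)
    also have "\<dots> = Q ^ Suc c + of_nat (Suc c) * Q ^ (Suc c - 1) * t + t ^ 2 * (of_nat c * Q ^ (c - 1) + (Q + t) * G)"
      unfolding Q by (simp add: algebra_simps)
    finally show ?case
      using G(1) assms by (intro bexI[of _ "of_nat c * Q ^ (c - 1) + (Q + t) * G"])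
        (auto intro!: subring_set_add[OF R] subring_set_mult[OF R] subring_set_power[OF R] subring_set_of_nat[OF R])
  qed
  then show thesis using that by blast
qed

text \<open>In the chain of the overview \<open>T\<close> is \<open>t_1\<close> and \<open>R\<close>
  belongs to \<open>t_0\<close>. Passing from \<open>t_0\<close> to \<open>t_1\<close> brings in
  \<open>u\<close>, and passing from \<open>t_1\<close> to \<open>t_3\<close> brings in
  \<open>w\<close> and \<open>s\<close>. So \<open>u\<close> clears denominators from
  \<open>t_1\<close>, and \<open>w * s\<close> clears those from \<open>t_3\<close>.\<close>

definition exchange_coprime :: "'f::field_char_0 set \<Rightarrow> 'f seed \<Rightarrow> nat \<Rightarrow> nat \<Rightarrow> bool" where
  "exchange_coprime K T j k \<longleftrightarrow>
     (let R = laurent_ring K (mutate j T); u = seed_pt T j; w = seed_pt (mutate k T) k;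
          s = seed_pt (mutate j (mutate k T)) j
      in u \<in> R \<and> w \<in> R \<and> s \<in> R \<and> nonzerodivisor_mod R u w \<and> nonzerodivisor_mod R u s)"

context
  fixes K :: "'f::field_char_0 set" and T :: "'f seed" and j k :: nat
  assumes K: "subring_set K" and T: "good_seed K T"
    and j: "j \<in> {1..seed_n T}" and k: "k \<in> {1..seed_n T}" and jk: "j \<noteq> k"
begin

text \<open>Neither of \<open>x_j\<close>, \<open>x_k\<close> enters the exchange polynomial of the
  other, so \<open>s\<close> is the variable \<open>x_j\<close> of \<open>mutate j T\<close>, a unit
  of \<open>R\<close>. Up to units, \<open>u\<close> and \<open>w\<close> are the exchange
  polynomials of \<open>mutate j T\<close> at \<open>j\<close> and \<open>k\<close>.\<close>

lemma exchange_coprime_zero: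
  assumes "seed_B T k j = 0"
  shows "exchange_coprime K T j k"
proof -
  let ?T0 = "mutate j T" and ?R = "laurent_ring K (mutate j T)"
  let ?u = "seed_pt T j" and ?v = "seed_pt T k" and ?x = "seed_pt (mutate j T) j"
  have em: "exchange_matrix (seed_n T) (seed_B T)" using T by (simp add: good_seed_def)
  have b: "seed_B T j k = 0" "seed_B T j j = 0"
    using exchange_matrix_sgn(2)[OF em k j] assms exchange_matrix_diag[OF em j] by auto
  have idx: "j \<in> seed_idx T" "k \<in> seed_idx T" using j k by auto
  note idx = idx idx[simplified]
  have T0: "good_seed K ?T0" using good_seed_mutate[OF K T j] .
  note R = subring_laurent_ring[OF K T0]
  have nz: "?u \<noteq> 0" "?v \<noteq> 0" "?x \<noteq> 0" using seed_pt_nz[OF T] seed_pt_nz[OF T0] by blast+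
  have f: "exchange_poly ?T0 j = exchange_poly T j" using exchange_poly_mutate_same[OF b(2) idx(1)] .
  have fk: "exchange_poly ?T0 k = exchange_poly T k" using exchange_poly_mutate_indep[OF b(1) idx(1) jk] .
  have x: "?x = exchange_poly T j / ?u" by (simp add: seed_pt_mutate idx)
  have u: "?u = exchange_poly ?T0 j * inverse ?x"
    unfolding f x using nz exchange_poly_nonzero[OF K T, of j] by simp
  have v: "?v = seed_pt ?T0 k" using jk by (simp add: seed_pt_mutate idx)
  have w: "seed_pt (mutate k T) k = exchange_poly ?T0 k * inverse ?v"
    by (simp add: seed_pt_mutate idx fk divide_inverse)
  have "exchange_poly (mutate k T) j = exchange_poly T j"
    using exchange_poly_mutate_indep[OF assms idx(2)] jk by auto
  then have s: "seed_pt (mutate j (mutate k T)) j = ?x"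
    using jk by (simp add: seed_pt_mutate idx x)
  note mems = laurent_ring_var[OF K T0] laurent_ring_inverse_var[OF K T0] laurent_ring_exch[OF K T0]
  have nzd: "nonzerodivisor_mod ?R ?u (exchange_poly ?T0 k)"
    unfolding u using nonzerodivisor_mod_exchange_polys[OF K T0, of j k] j k jk mems nz
    by (intro nonzerodivisor_mod_unit[OF R]) auto
  have "nonzerodivisor_mod ?R ?u (inverse ?v * (exchange_poly ?T0 k + ?u * 0))"
    using nzd nz mems v by (intro nonzerodivisor_mod_cong[OF R]) (auto intro: subring_set_0[OF R])
  then have 1: "nonzerodivisor_mod ?R ?u (seed_pt (mutate k T) k)" by (simp add: w mult.commute)
  have "nonzerodivisor_mod ?R ?u (?x * (1 + ?u * 0))"
    using nz mems by (intro nonzerodivisor_mod_cong[OF R] nonzerodivisor_mod_1[OF R]) (auto intro: subring_set_0[OF R])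
  then have 2: "nonzerodivisor_mod ?R ?u ?x" by simp
  have "?u \<in> ?R" unfolding u by (intro subring_set_mult[OF R] mems)
  moreover have "seed_pt (mutate k T) k \<in> ?R" unfolding w v by (intro subring_set_mult[OF R] mems)
  ultimately show ?thesis
    using 1 2 mems(1)[of j] unfolding exchange_coprime_def Let_def s by blast
qed

text \<open>Modulo \<open>u\<close>, the variable \<open>w\<close> is a unit and \<open>s\<close> is, up to a unit,
  \<open>A x + C\<close> with \<open>A\<close> a monomial free of \<open>x\<close> and \<open>C\<close> free of \<open>x\<close>.\<close>

lemma exchange_coprime_pos:
  assumes pos: "seed_B T k j > 0"
  shows "exchange_coprime K T j k"
proof -
  let ?T0 = "mutate j T" and ?R = "laurent_ring K (mutate j T)" and ?B = "seed_B T"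
  define u where "u = seed_pt T j"
  define v where "v = seed_pt T k"
  define x where "x = seed_pt ?T0 j"
  define w where "w = seed_pt (mutate k T) k"
  define s where "s = seed_pt (mutate j (mutate k T)) j"
  define f where "f = exchange_poly T j"
  \<comment> \<open>Indices of the variables common to all four seeds. The monomials
    \<open>mm a\<close> in them are units of every Laurent ring involved.\<close>
  define I' where "I' = seed_idx T - {j, k}"
  define mm where "mm a = monom_eval (seed_pt ?T0) (expo I' a)" for a
  define c where "c = nat (?B k j)"
  define b where "b = nat (- ?B j k)"
  have em: "exchange_matrix (seed_n T) ?B" using T by (simp add: good_seed_def)
  have neg: "?B j k < 0" using exchange_matrix_sgn(1)[OF em k j] pos by simp
  have diag: "?B j j = 0" "?B k k = 0" using exchange_matrix_diag[OF em] j k by auto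
  have idx: "j \<in> seed_idx T" "k \<in> seed_idx T" using j k by auto
  note idx = idx idx[simplified]
  have T0: "good_seed K ?T0" using good_seed_mutate[OF K T j] .
  note R = subring_laurent_ring[OF K T0]
  note mems = laurent_ring_var[OF K T0] laurent_ring_inverse_var[OF K T0] laurent_ring_exch[OF K T0]
  have fin: "finite I'" by (simp add: I'_def)
  have nz: "u \<noteq> 0" "v \<noteq> 0" "x \<noteq> 0" using seed_pt_nz[OF T] seed_pt_nz[OF T0] by (auto simp: u_def v_def x_def)
  have mm: "mm a = (\<Prod>i\<in>I'. seed_pt T i powi a i)" for a
    unfolding mm_def monom_eval_expo[OF fin] by (rule prod.cong) (auto simp: seed_pt_mutate idx I'_def)
  have mm_add: "mm (\<lambda>i. a i + a' i) = mm a * mm a'" for a a'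
    using seed_pt_nz[OF T] by (simp add: mm power_int_add prod.distrib)
  have mm_pow: "mm (\<lambda>i. int r * a i) = mm a ^ r" for a r
    unfolding mm prod_power_distrib
    by (intro prod.cong refl) (metis mult.commute power_int_mult power_int_of_nat)
  have mm_nz: "mm a \<noteq> 0" for a unfolding mm_def using monom_eval_nonzero[OF seed_pt_nz[OF T0]] by blast
  have kI: "kys (expo I' a) \<subseteq> seed_idx T" for a
    using keys_expo[OF fin, of a] unfolding I'_def by blast
  have mm_R: "mm a \<in> ?R" for a unfolding mm_def by (rule laurent_ring_monom[OF K T0]) (use kI in simp)
  have mm_inv: "inverse (mm a) = mm (\<lambda>i. - a i)" for a
    using mm_add[of a "\<lambda>i. - a i"] mm_nz[of a] by (simp add: mm[of "\<lambda>i. 0"] field_simps)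
  have v': "v = seed_pt ?T0 k" using jk by (simp add: v_def seed_pt_mutate idx)
  have v_R: "v \<in> ?R" "inverse v \<in> ?R" unfolding v' by (rule mems)+
  have x_R: "x \<in> ?R" "inverse x \<in> ?R" unfolding x_def by (rule mems)+
  have split: "(\<Prod>l\<in>seed_idx T. y l powi a l) = y j powi a j * y k powi a k * (\<Prod>l\<in>I'. y l powi a l)"
    for y :: "nat \<Rightarrow> 'f" and a
  proof -
    have "seed_idx T = insert j (insert k I')" using idx by (auto simp: I'_def)
    moreover have "j \<notin> I'" "k \<notin> I'" by (auto simp: I'_def)
    ultimately show ?thesis using jk fin by (simp add: mult.assoc)
  qed
  \<comment> \<open>Names for the parts of three exchange polynomials:
    \<open>f = M * (E * v ^ c + 1)\<close>, the one at \<open>k\<close> is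
    \<open>Q + u ^ b * P\<close>, and the one at \<open>j\<close> after mutation at \<open>k\<close>
    is \<open>N * (E * Q ^ c + w ^ c)\<close>.\<close>
  define M where "M = mm (\<lambda>i. max 0 (- ?B i j))"
  define E where "E = mm (\<lambda>i. ?B i j)"
  define Q where "Q = mm (\<lambda>i. max 0 (?B i k))"
  define P where "P = mm (\<lambda>i. max 0 (- ?B i k))"
  define N where "N = mm (\<lambda>i. max 0 (- (?B i j + max 0 (?B i k) * ?B k j)))"
  have kj: "?B k j = int c" "?B j k = - int b" "c > 0" "b > 0" using pos neg by (auto simp: c_def b_def)
  have max_split: "max 0 z = max 0 (- z) + z" for z :: int by (simp add: max_def)
  have M: "mm (\<lambda>i. max 0 (?B i j)) = M * E"
    unfolding M_def E_def mm_add[symmetric] by (subst max_split) simp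
  have f: "f = M * (E * v ^ c + 1)"
  proof -
    have "f = M * E * v ^ c + M"
      unfolding f_def exchange_poly_alt split mm[symmetric] M M_def[symmetric]
      by (simp add: diag kj v_def power_int_def)
    then show ?thesis by (simp add: algebra_simps)
  qed
  have x: "x = f / u" by (simp add: x_def f_def u_def seed_pt_mutate idx)
  have fk: "exchange_poly T k = Q + u ^ b * P"
    unfolding exchange_poly_alt split mm[symmetric] Q_def P_def
    by (simp add: diag kj u_def power_int_def)
  have w: "w = (Q + u ^ b * P) / v" by (simp add: w_def fk v_def seed_pt_mutate idx)
  have f2: "exchange_poly (mutate k T) j = N * (E * Q ^ c + w ^ c)"
  proof -
    define B' where "B' i = seed_B (mutate k T) i j" for i
    have B'k: "B' k = - int c" by (simp add: B'_def mutate_matrix_alt kj)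
    have B'j: "B' j = 0" using jk by (simp add: B'_def mutate_matrix_alt diag kj)
    have B'i: "B' i = ?B i j + max 0 (?B i k) * ?B k j" if "i \<in> I'" for i
      using that jk by (simp add: B'_def mutate_matrix_alt I'_def kj)
    have pt: "seed_pt (mutate k T) i = seed_pt T i" if "i \<in> I'" for i
      using that by (auto simp: seed_pt_mutate idx I'_def)
    have pr: "(\<Prod>l\<in>I'. seed_pt (mutate k T) l powi max 0 (r * B' l)) =
        mm (\<lambda>i. max 0 (r * (?B i j + max 0 (?B i k) * ?B k j)))" for r
      unfolding mm by (rule prod.cong) (simp_all add: B'i pt)
    have mE: "mm (\<lambda>i. max 0 (?B i j + max 0 (?B i k) * ?B k j)) = N * (E * Q ^ c)"
      unfolding N_def E_def Q_def mm_pow[symmetric] mm_add[symmetric]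
      by (subst max_split) (simp add: kj mult.commute)
    have p1: "(\<Prod>l\<in>I'. seed_pt (mutate k T) l powi max 0 (B' l)) = N * (E * Q ^ c)"
      using pr[of 1] mE by simp
    have p2: "(\<Prod>l\<in>I'. seed_pt (mutate k T) l powi max 0 (- B' l)) = N"
      unfolding N_def using pr[of "-1"] by simp
    have "exchange_poly (mutate k T) j =
       (\<Prod>l\<in>seed_idx T. seed_pt (mutate k T) l powi max 0 (B' l)) +
       (\<Prod>l\<in>seed_idx T. seed_pt (mutate k T) l powi max 0 (- B' l))"
      unfolding exchange_poly_alt B'_def by simp
    also have "\<dots> = N * (E * Q ^ c) + w ^ c * N"
      unfolding split p1 p2 by (simp add: B'k B'j w_def[symmetric] power_int_def)
    finally show ?thesis by (simp add: algebra_simps)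
  qed
  have s_eq: "s = N * (E * Q ^ c + w ^ c) / u"
    unfolding s_def using jk f2 by (simp add: seed_pt_mutate idx u_def)
  have MM: "M \<in> ?R" "E \<in> ?R" "Q \<in> ?R" "P \<in> ?R" "N \<in> ?R" "inverse M \<in> ?R" "inverse N \<in> ?R" "inverse Q \<in> ?R"
     "M \<noteq> 0" "N \<noteq> 0" "Q \<noteq> 0"
    by (auto simp: M_def E_def Q_def P_def N_def mm_R mm_nz mm_inv)
  have f0: "f \<noteq> 0" unfolding f_def by (rule exchange_poly_nonzero[OF K T])
  have f': "f = exchange_poly ?T0 j" using exchange_poly_mutate_same[OF diag(1) idx(1)] by (simp add: f_def)
  have u_eq: "u = f * inverse x" using x nz f0 by (simp add: field_simps)
  have u_R: "u \<in> ?R" unfolding u_eq f' by (intro subring_set_mult[OF R] mems x_R)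
  have w_R: "w \<in> ?R"
    unfolding w divide_inverse using u_R MM v_R
    by (intro subring_set_mult[OF R] subring_set_add[OF R] subring_set_power[OF R])
  \<comment> \<open>Since \<open>b > 0\<close>, one factor \<open>u\<close> can be split off
    \<open>u ^ b * P\<close>.\<close>
  define t where "t = u ^ (b - 1) * P"
  have t_R: "t \<in> ?R" unfolding t_def using u_R MM by (intro subring_set_mult[OF R] subring_set_power[OF R])
  have ut: "u ^ b * P = u * t" using kj(4) by (simp add: t_def power_eq_if)
  obtain G where G: "G \<in> ?R" "(Q + u * t) ^ c = Q ^ c + of_nat c * Q ^ (c - 1) * (u * t) + (u * t)\<^sup>2 * G"
    using binomial_second_order[OF R MM(3) subring_set_mult[OF R u_R t_R]] by blast
  \<comment> \<open>The denominator \<open>u\<close> cancels: the terms of order 0 in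
    \<open>u\<close> combine to \<open>Q ^ c * (E * v ^ c + 1)\<close>, which is
    \<open>Q ^ c * x * u / M\<close> because \<open>f = x * u\<close>.\<close>
  have s1: "s = N / v ^ c * (Q ^ c / M * x + of_nat c * Q ^ (c - 1) * t + u * (t\<^sup>2 * G))"
  proof -
    have "w ^ c = (Q + u * t) ^ c / v ^ c" by (simp add: w ut power_divide)
    then have "s * u = N * (E * Q ^ c + (Q + u * t) ^ c / v ^ c)" using nz by (simp add: s_eq)
    also have "\<dots> = N / v ^ c * (Q ^ c * (E * v ^ c + 1) + (of_nat c * Q ^ (c - 1) * (u * t) + (u * t)\<^sup>2 * G))"
      using nz unfolding G(2) by (simp add: field_simps)
    also have "E * v ^ c + 1 = x * u / M" using f x nz MM by (simp add: field_simps)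
    also have "N / v ^ c * (Q ^ c * (x * u / M) + (of_nat c * Q ^ (c - 1) * (u * t) + (u * t)\<^sup>2 * G)) =
        (N / v ^ c * (Q ^ c / M * x + of_nat c * Q ^ (c - 1) * t + u * (t\<^sup>2 * G))) * u"
      by (simp add: algebra_simps power2_eq_square)
    finally show ?thesis using mult_right_cancel[OF nz(1)] by blast
  qed
  define va where "va i = int c * max 0 (?B i k) + - max 0 (- ?B i j)" for i
  define vc where "vc i = int (c - 1) * max 0 (?B i k) + max 0 (- ?B i k)" for i
  have va: "mm va = Q ^ c / M"
    unfolding va_def mm_add mm_inv[symmetric] mm_pow Q_def M_def by (simp add: divide_inverse)
  have vc: "mm vc = Q ^ (c - 1) * P" unfolding vc_def mm_add mm_pow Q_def P_def ..
  \<comment> \<open>The linear term \<open>of_nat c * Q ^ (c - 1) * t\<close> survives modulo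
    \<open>u\<close> only for \<open>b = 1\<close>, when \<open>t = P\<close>. For
    \<open>b > 1\<close> it is a multiple of \<open>u\<close> and moves into
    \<open>D\<close>.\<close>
  define C where "C = (if b = 1 then sgl (expo I' vc) (of_nat c) else (0 :: 'f laurent))"
  define D where "D = (if b = 1 then 0 else of_nat c * Q ^ (c - 1) * (u ^ (b - 2) * P)) + t\<^sup>2 * G"
  define a where "a = expo I' va + sgl j 1"
  have C: "laurent_eval (seed_pt ?T0) C + u * D = of_nat c * Q ^ (c - 1) * t + u * (t\<^sup>2 * G)"
  proof (cases "b = 1")
    case True
    then show ?thesis using vc by (simp add: C_def D_def t_def mm_def algebra_simps)
  next
    case False
    then have "b - 1 = Suc (b - 2)" using kj(4) by linarith
    then have "t = u * (u ^ (b - 2) * P)" by (simp add: t_def)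
    then show ?thesis using False by (simp add: C_def D_def algebra_simps)
  qed
  have A: "laurent_eval (seed_pt ?T0) (sgl a 1) = Q ^ c / M * x"
    using va by (simp add: a_def monom_eval_add[OF seed_pt_nz[OF T0]] mm_def x_def)
  have s2: "s = N / v ^ c * (laurent_eval (seed_pt ?T0) (sgl a 1 + C) + u * D)"
    unfolding s1 laurent_eval_add A using C by (simp add: add.assoc)
  have D_R: "D \<in> ?R"
    unfolding D_def using MM u_R t_R G
    by (auto intro!: subring_set_mult[OF R] subring_set_add[OF R] subring_set_power[OF R]
        subring_set_of_nat[OF R] subring_set_0[OF R])
  have C_over: "C \<in> laurent_over K (seed_idx ?T0)"
    unfolding C_def using kI by (auto intro: laurent_over_single[OF K] laurent_over_0[OF K] subring_set_of_nat[OF K])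
  have a_keys: "kys a \<subseteq> seed_idx ?T0"
    unfolding a_def using keys_add[of "expo I' va" "sgl j 1"] kI[of va] idx by auto
  have "nonzerodivisor_mod ?R (laurent_eval (seed_pt ?T0) (exch_laurent ?T0 j)) (laurent_eval (seed_pt ?T0) (sgl a 1 + C))"
  \<comment> \<open>Graded by the exponent of \<open>x\<close>: the exchange polynomial at
    \<open>j\<close> and \<open>C\<close> have degree 0, the monomial of \<open>a\<close> has degree
    1.\<close>
  proof (rule nonzerodivisor_mod_homog[OF K T0, where l = "\<lambda>e. lkp e j" and f = 0 and c = 0])
    show "\<And>e. e \<in> kys (exch_laurent ?T0 j) \<Longrightarrow> lkp e j = 0"
      using keys_exch_laurent[of ?T0 j] diag idx
      by (auto simp: pos_exp_def neg_exp_def lookup_expo mutate_matrix_alt)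
    show "\<And>e. e \<in> kys C \<Longrightarrow> lkp e j = 0"
      using fin by (auto simp: C_def lookup_expo I'_def split: if_splits)
    show "0 < lkp a j" using fin by (simp add: a_def lookup_add lookup_expo I'_def)
  qed (rule lookup_add exch_laurent_over[OF K] C_over a_keys)+
  then have "nonzerodivisor_mod ?R f (laurent_eval (seed_pt ?T0) (sgl a 1 + C))"
    by (simp only: laurent_eval_exch f')
  then have nzd: "nonzerodivisor_mod ?R u (laurent_eval (seed_pt ?T0) (sgl a 1 + C))"
    unfolding u_eq using x_R nz by (intro nonzerodivisor_mod_unit[OF R]) auto
  have nv: "N / v ^ c \<in> ?R" "inverse (N / v ^ c) \<in> ?R" "N / v ^ c \<noteq> 0"
  proof -
    have "inverse v ^ c \<in> ?R" "v ^ c \<in> ?R" using v_R subring_set_power[OF R] by blast+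
    then show "N / v ^ c \<in> ?R" "inverse (N / v ^ c) \<in> ?R"
      using subring_set_mult[OF R] MM by (auto simp: divide_inverse power_inverse)
    show "N / v ^ c \<noteq> 0" using MM nz by simp
  qed
  have s_nzd: "nonzerodivisor_mod ?R u s"
    unfolding s2 by (rule nonzerodivisor_mod_cong[OF R nzd nv D_R])
  have s_R: "s \<in> ?R"
    unfolding s1 divide_inverse[of _ M] using nv MM x_R u_R t_R G
    by (intro subring_set_mult[OF R] subring_set_add[OF R] subring_set_power[OF R]
        subring_set_of_nat[OF R]) auto
  \<comment> \<open>A unit times something congruent to 1 modulo \<open>u\<close>.\<close>
  have "w = Q / v * (1 + u * (t * inverse Q))"
    unfolding w ut using MM nz by (simp add: field_simps)
  moreover have "Q / v \<noteq> 0" using MM nz by simp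
  moreover have "Q / v \<in> ?R" "inverse (Q / v) \<in> ?R" "t * inverse Q \<in> ?R"
    using MM v_R t_R by (auto simp: divide_inverse intro!: subring_set_mult[OF R])
  ultimately have w_nzd: "nonzerodivisor_mod ?R u w"
    using nonzerodivisor_mod_cong[OF R nonzerodivisor_mod_1[OF R], of "Q / v" "t * inverse Q" u] by metis
  show ?thesis
    using u_R w_R s_R w_nzd s_nzd unfolding exchange_coprime_def Let_def u_def w_def s_def by blast
qed

end

text \<open>Negating the matrix swaps the two monomials of every exchange polynomial and commutes
  with mutation, so it changes no variable. This reduces \<open>b_kj < 0\<close> to
  \<open>b_kj > 0\<close>.\<close>

definition flip_seed :: "'f seed \<Rightarrow> 'f seed" where
  "flip_seed T = T\<lparr>seed_B := \<lambda>i j. - seed_B T i j\<rparr>"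

lemma flip_seed_simps [simp]:
  "seed_n (flip_seed T) = seed_n T" "seed_m (flip_seed T) = seed_m T" "seed_x (flip_seed T) = seed_x T"
  "seed_B (flip_seed T) = (\<lambda>i j. - seed_B T i j)"
  by (simp_all add: flip_seed_def)

lemma seed_pt_flip [simp]: "seed_pt (flip_seed T) = seed_pt T"
  by (rule ext) (simp add: seed_pt_def)

lemma exchange_poly_flip:
  fixes T :: "'f::field_char_0 seed"
  shows "exchange_poly (flip_seed T) k = exchange_poly T k"
  by (simp add: exchange_poly_alt add.commute)

lemma mutate_matrix_uminus: "mutate_matrix k (\<lambda>i j. - b i j) = (\<lambda>i j. - mutate_matrix k b i j)"
proof (intro ext)
  fix i j
  have "max 0 (b i k) = b i k + max 0 (- b i k)" "max 0 (b k j) = b k j + max 0 (- b k j)"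
    by (simp_all add: max_def)
  then show "mutate_matrix k (\<lambda>i j. - b i j) i j = - mutate_matrix k b i j"
    by (simp add: mutate_matrix_alt algebra_simps)
qed

lemma mutate_flip:
  fixes T :: "'f::field_char_0 seed"
  shows "mutate k (flip_seed T) = flip_seed (mutate k T)"
  using exchange_poly_flip[of T k]
  by (simp add: mutate_def flip_seed_def mutate_matrix_uminus)

lemma good_seed_flip: "good_seed K T \<Longrightarrow> good_seed K (flip_seed T)"
proof -
  assume T: "good_seed K T"
  have "exchange_matrix n (\<lambda>i j. - b i j)" if em: "exchange_matrix n b" for n b
  proof -
    obtain d :: "nat \<Rightarrow> int" where d: "\<forall>i\<in>{1..n}. d i > 0" "\<forall>i\<in>{1..n}. \<forall>j\<in>{1..n}. d i * b i j = - (d j * b j i)"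
      using em unfolding exchange_matrix_def by blast
    have "d i * - b i j = - (d j * - b j i)" if "i \<in> {1..n}" "j \<in> {1..n}" for i j
      unfolding mult_minus_right using d(2) that by metis
    then show ?thesis unfolding exchange_matrix_def using d(1) by blast
  qed
  moreover have "full_rank (flip_seed T)" if "full_rank T"
  proof -
    have "(\<Sum>j\<in>A. - seed_B T i j * c j) = - (\<Sum>j\<in>A. seed_B T i j * c j)" for A i and c :: "nat \<Rightarrow> int"
      by (simp add: sum_negf)
    then show ?thesis using that unfolding full_rank_def flip_seed_simps neg_equal_0_iff_equal by simp
  qed
  ultimately show ?thesis using T unfolding good_seed_def flip_seed_simps seed_pt_flip by blast
qed

lemma laurent_ring_flip: "laurent_ring K (flip_seed T) = laurent_ring K T"
  by (simp add: laurent_ring_def)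

lemma exchange_coprime:
  assumes K: "subring_set K" and T: "good_seed K T"
    and jk: "j \<in> {1..seed_n T}" "k \<in> {1..seed_n T}" "j \<noteq> k"
  shows "exchange_coprime K T j k"
proof -
  consider "seed_B T k j = 0" | "seed_B T k j > 0" | "seed_B T k j < 0" by linarith
  then show ?thesis
  proof cases
    case 3
    then have "exchange_coprime K (flip_seed T) j k"
      using exchange_coprime_pos[OF K good_seed_flip[OF T]] jk by simp
    then show ?thesis by (simp add: exchange_coprime_def mutate_flip laurent_ring_flip)
  qed (use exchange_coprime_zero[OF assms] exchange_coprime_pos[OF assms] in auto)
qed

lemma laurent_ring_exchange:
  assumes K: "subring_set K" and T: "good_seed K T"
    and jk: "j \<in> {1..seed_n T}" "k \<in> {1..seed_n T}" "j \<noteq> k"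
    and a0: "a0 \<in> laurent_ring K T" "a0 \<in> laurent_ring K (mutate j (mutate k T))"
  shows "a0 \<in> laurent_ring K (mutate j T)"
proof -
  let ?R = "laurent_ring K (mutate j T)"
  define u where "u = seed_pt T j"
  define w where "w = seed_pt (mutate k T) k"
  define s where "s = seed_pt (mutate j (mutate k T)) j"
  have T0: "good_seed K (mutate j T)" and T2: "good_seed K (mutate k T)"
    using good_seed_mutate[OF K T] jk by auto
  then have T3: "good_seed K (mutate j (mutate k T))" using good_seed_mutate[OF K T2] jk by auto
  note R = subring_laurent_ring[OF K T0]
  have cop: "u \<in> ?R" "w \<in> ?R" "s \<in> ?R" "nonzerodivisor_mod ?R u w" "nonzerodivisor_mod ?R u s"
    using exchange_coprime[OF K T jk] unfolding exchange_coprime_def Let_def u_def w_def s_def by auto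
  have nz: "u \<noteq> 0" "w \<noteq> 0" "s \<noteq> 0"
    using seed_pt_nz[OF T] seed_pt_nz[OF T2] seed_pt_nz[OF T3] by (auto simp: u_def w_def s_def)
  have KR: "K \<subseteq> ?R" using laurent_ring_base[OF K T0] by blast
  have idx: "j \<in> seed_idx T" "k \<in> seed_idx T" using jk by auto
  note idx = idx idx[simplified]
  \<comment> \<open>All variables of \<open>T\<close> except \<open>x_j\<close> are shared with
    \<open>mutate j T\<close>, so \<open>u\<close> is the only possible denominator.\<close>
  have vars: "seed_pt T i \<in> ?R \<and> inverse (seed_pt T i) \<in> ?R" if "i \<noteq> j" for i
    using laurent_ring_var[OF K T0, of i] laurent_ring_inverse_var[OF K T0, of i] that
    by (simp add: seed_pt_mutate idx)
  obtain p where p: "p \<in> laurent_over K (seed_idx T)" "a0 = laurent_eval (seed_pt T) p"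
    using a0(1) by (rule laurent_ringE)
  obtain a where a: "u ^ a * a0 \<in> ?R"
  proof (rule clear_denominators[OF R KR cop(1) _ _ p(1), of "seed_pt T"])
    fix i
    show "seed_pt T i \<in> ?R" using vars[of i] cop(1) u_def by (cases "i = j") auto
    show "u * inverse (seed_pt T i) \<in> ?R"
    proof (cases "i = j")
      case True
      then show ?thesis using nz subring_set_1[OF R] u_def by simp
    qed (use vars cop(1) in \<open>auto intro!: subring_set_mult[OF R]\<close>)
  qed (use p(2) in auto)
  have pt3: "seed_pt (mutate j (mutate k T)) i = (if i = j then s else if i = k then w else seed_pt T i)" for i
    using jk(3) by (simp add: s_def w_def seed_pt_mutate idx)
  obtain q where q: "q \<in> laurent_over K (seed_idx T)" "a0 = laurent_eval (seed_pt (mutate j (mutate k T))) q"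
    using a0(2) by (rule laurent_ringE) auto
  have ws: "w * s \<in> ?R" using subring_set_mult[OF R] cop by blast
  obtain b where b: "(w * s) ^ b * a0 \<in> ?R"
  proof (rule clear_denominators[OF R KR ws _ _ q(1), of "seed_pt (mutate j (mutate k T))"])
    fix i
    show "seed_pt (mutate j (mutate k T)) i \<in> ?R" using vars[of i] cop unfolding pt3 by auto
    consider "i = j" | "i = k" | "i \<noteq> j" "i \<noteq> k" by blast
    then show "w * s * inverse (seed_pt (mutate j (mutate k T)) i) \<in> ?R"
    proof cases
      case 1
      then show ?thesis using nz cop by (simp add: pt3 mult.assoc)
    next
      case 2
      then show ?thesis using nz cop jk by (simp add: pt3 mult.commute[of w s] mult.assoc)
    next
      case 3
      then show ?thesis using vars[of i] ws unfolding pt3 by (auto intro!: subring_set_mult[OF R])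
    qed
  qed (use q(2) in auto)
  have "nonzerodivisor_mod ?R u (w * s)" using nonzerodivisor_mod_mult[OF R] cop by blast
  then show ?thesis using nonzerodivisor_mod_cancel[OF R _ ws cop(1) nz(1) a b] by blast
qed

section \<open>Mutation sequences and the Laurent phenomenon\<close>

abbreviation mutate_seq :: "nat list \<Rightarrow> 'f::field_char_0 seed \<Rightarrow> 'f seed" where
  "mutate_seq \<equiv> fold mutate"

lemma mutate_seq_simps [simp]:
  "seed_n (mutate_seq ks T) = seed_n T" "seed_m (mutate_seq ks T) = seed_m T"
  by (induction ks arbitrary: T) auto

lemma good_seed_mutate_seq:
  "subring_set K \<Longrightarrow> good_seed K T \<Longrightarrow> set ks \<subseteq> {1..seed_n T} \<Longrightarrow> good_seed K (mutate_seq ks T)"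
proof (induction ks arbitrary: T)
  case (Cons k ks)
  have "good_seed K (mutate k T)" using good_seed_mutate Cons.prems by force
  then show ?case using Cons by simp
qed simp

text \<open>The target seed stays fixed while the seed of reference moves. For a sequence
  \<open>j, k, rest\<close> from \<open>T\<close> with \<open>j\<close> and \<open>k\<close>
  distinct, the target is reached from \<open>mutate j T\<close> by \<open>k, rest\<close> and from
  the seed beyond \<open>j, k, j\<close> by \<open>j, rest\<close>, both one step shorter.
  \<open>laurent_ring_exchange\<close> then brings the expansion back to \<open>T\<close>.\<close>

lemma laurent_phenomenon_seq:
  assumes "subring_set K" "good_seed K T" "set ks \<subseteq> {1..seed_n T}"
  shows "seed_pt (mutate_seq ks T) i \<in> laurent_ring K T"
  using assms(2,3)
proof (induction ks arbitrary: T rule: length_induct)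
  case (1 ks T)
  note K = assms(1)
  note T = 1(2)
  show ?case
  proof (cases ks)
    case Nil
    then show ?thesis using laurent_ring_var[OF K T] by simp
  next
    case ks: (Cons j ks')
    then have j: "j \<in> {1..seed_n T}" "j \<in> seed_idx T" using 1(3) by auto
    let ?T1 = "mutate j T"
    have T1: "good_seed K ?T1" using good_seed_mutate[OF K T j(1)] .
    show ?thesis
    proof (cases ks')
      case Nil
      have "exchange_poly T j / seed_pt T j \<in> laurent_ring K T"
        unfolding divide_inverse using laurent_ring_exch[OF K T] laurent_ring_inverse_var[OF K T]
        by (rule subring_set_mult[OF subring_laurent_ring[OF K T]])
      then show ?thesis using laurent_ring_var[OF K T, of i] Nil ks j by (simp add: seed_pt_mutate)
    next
      case ks': (Cons k rest)
      have k: "k \<in> {1..seed_n T}" "set rest \<subseteq> {1..seed_n T}" using 1(3) ks ks' by auto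
      have inv: "mutate j (mutate j T) = T" using mutate_mutate[OF K T j(1)] .
      show ?thesis
      proof (cases "j = k")
        case True
        then have "mutate_seq ks T = mutate_seq rest T" using ks ks' inv by simp
        then show ?thesis using 1(1)[rule_format, of rest T] T k ks ks' by simp
      next
        case False
        let ?T2 = "mutate k ?T1" and ?X = "seed_pt (mutate_seq ks T) i"
        have T2: "good_seed K ?T2" using good_seed_mutate[OF K T1] k by simp
        have T3: "good_seed K (mutate j ?T2)" using good_seed_mutate[OF K T2] j by simp
        have inv2: "mutate j (mutate j ?T2) = ?T2" using mutate_mutate[OF K T2] j by simp
        have "seed_pt (mutate_seq ks' ?T1) i \<in> laurent_ring K ?T1"
          using 1(1)[rule_format, of ks' ?T1] T1 1(3) ks by simp
        then have Y1: "?X \<in> laurent_ring K ?T1" using ks by simp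
        \<comment> \<open>The leading \<open>j\<close> undoes the last mutation of
          \<open>mutate j ?T2\<close>, which returns to \<open>?T2\<close> before continuing with
          \<open>rest\<close>.\<close>
        have "seed_pt (mutate_seq (j # rest) (mutate j ?T2)) i \<in> laurent_ring K (mutate j ?T2)"
          using 1(1)[rule_format, of "j # rest" "mutate j ?T2"] T3 j k ks ks' by simp
        then have Y3: "?X \<in> laurent_ring K (mutate j ?T2)" using ks ks' inv2 by simp
        show ?thesis
          using laurent_ring_exchange[OF K T1 _ _ False Y1 Y3] j k inv by simp
      qed
    qed
  qed
qed

lemma mutation_class_seq:
  assumes "T \<in> mutation_class (S :: 'f::field_char_0 seed)"
  obtains ks where "set ks \<subseteq> {1..seed_n S}" "T = mutate_seq ks S"
proof -
  have "\<exists>ks. set ks \<subseteq> {1..seed_n S} \<and> T = mutate_seq ks S"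
    using assms
  proof induction
    case initial
    then show ?case by (intro exI[of _ "[]"]) simp
  next
    case (mutation T i)
    then obtain ks where "set ks \<subseteq> {1..seed_n S}" "T = mutate_seq ks S" by blast
    with mutation(2) show ?case by (intro exI[of _ "ks @ [i]"]) auto
  qed
  then show thesis using that by blast
qed

lemma mutate_seq_rev:
  assumes "subring_set K" "good_seed K S" "set ks \<subseteq> {1..seed_n S}"
  shows "mutate_seq (rev ks) (mutate_seq ks S) = S"
  using assms(2,3)
proof (induction ks arbitrary: S)
  case (Cons k ks)
  have "mutate_seq (rev ks) (mutate_seq ks (mutate k S)) = mutate k S"
    using Cons good_seed_mutate[OF assms(1)] by simp
  then show ?case using mutate_mutate[OF assms(1) Cons.prems(1)] Cons.prems(2) by simp
qed simp

lemma good_seed_class: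
  assumes "subring_set K" "good_seed K S" "T \<in> mutation_class S"
  shows "good_seed K T" "seed_n T = seed_n S" "seed_m T = seed_m S"
proof -
  obtain ks where ks: "set ks \<subseteq> {1..seed_n S}" "T = mutate_seq ks S"
    using assms(3) by (rule mutation_class_seq)
  then show "good_seed K T" using good_seed_mutate_seq assms by blast
  show "seed_n T = seed_n S" "seed_m T = seed_m S" using ks by simp_all
qed

lemma laurent_phenomenon:
  assumes "subring_set K" "good_seed K S" "T \<in> mutation_class S" "T' \<in> mutation_class S"
  shows "seed_pt T' i \<in> laurent_ring K T"
proof -
  obtain ks where ks: "set ks \<subseteq> {1..seed_n S}" "T = mutate_seq ks S"
    using assms(3) by (rule mutation_class_seq)
  obtain ks' where ks': "set ks' \<subseteq> {1..seed_n S}" "T' = mutate_seq ks' S"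
    using assms(4) by (rule mutation_class_seq)
  have T': "T' = mutate_seq (rev ks @ ks') T"
    using mutate_seq_rev[OF assms(1,2) ks(1)] ks ks' by simp
  have "set (rev ks @ ks') \<subseteq> {1..seed_n T}"
    using ks(1) ks'(1) good_seed_class(2)[OF assms(1-3)] by simp
  then have "seed_pt (mutate_seq (rev ks @ ks') T) i \<in> laurent_ring K T"
    by (rule laurent_phenomenon_seq[OF assms(1) good_seed_class(1)[OF assms(1-3)]])
  then show ?thesis unfolding T' .
qed

subsection \<open>Laurent expansions of the cluster variables\<close>

text \<open>Expansions are taken over the integers whatever \<open>K\<close> is, so that
  specializations of them have integer values and signs.\<close>

definition laurent_lift :: "'f::field_char_0 seed \<Rightarrow> 'f \<Rightarrow> 'f laurent" where
  "laurent_lift S a = (SOME p. p \<in> laurent_over \<int> (seed_idx S) \<and> laurent_eval (seed_pt S) p = a)"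

lemma keys_addE: "e \<in> kys (p + q) \<Longrightarrow> e \<in> kys p \<or> e \<in> kys q"
  using keys_add[of p q] by blast

lemma keys_prod_homog:
  fixes l :: "(nat \<Rightarrow>\<^sub>0 int) \<Rightarrow> int" and p :: "'i \<Rightarrow> 'f::field_char_0 laurent"
  assumes l: "\<And>e e'. l (e + e') = l e + l e'"
    and "\<And>i e. i \<in> A \<Longrightarrow> e \<in> kys (p i) \<Longrightarrow> l e = d i"
    and "e \<in> kys (\<Prod>i\<in>A. p i ^ a i)"
  shows "l e = (\<Sum>i\<in>A. int (a i) * d i)"
proof -
  have 0: "l 0 = 0" using l[of 0 0] by simp
  have one: "l e = 0" if "e \<in> kys (1 :: 'f laurent)" for e using that 0 by (simp split: if_splits)
  have mult: "l e = x + y" if "\<And>e. e \<in> kys q \<Longrightarrow> l e = x" "\<And>e. e \<in> kys r \<Longrightarrow> l e = y"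
    and e: "e \<in> kys (q * r)" for q r :: "'f laurent" and x y e
  proof -
    obtain b c where "e = b + c" "b \<in> kys q" "c \<in> kys r" using keys_mult[of q r] e by blast
    then show ?thesis using that(1,2) l by simp
  qed
  have pow: "l e = int r * x" if q: "\<And>e. e \<in> kys q \<Longrightarrow> l e = x" and e: "e \<in> kys (q ^ r)"
    for q :: "'f laurent" and x r e
    using e
  proof (induction r arbitrary: e)
    case 0
    then show ?case using one[of e] by simp
  next
    case (Suc r)
    have "l e = x + int r * x" by (rule mult[OF q Suc.IH]) (use Suc.prems in simp_all)
    then show ?case by (simp add: algebra_simps)
  qed
  show ?thesis
    using assms(2,3)
  proof (induction A arbitrary: e rule: infinite_finite_induct)
    case (insert i A)
    have "l e = int (a i) * d i + (\<Sum>i\<in>A. int (a i) * d i)"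
    proof (rule mult[of "p i ^ a i" _ "\<Prod>i\<in>A. p i ^ a i"])
      show "\<And>e. e \<in> kys (p i ^ a i) \<Longrightarrow> l e = int (a i) * d i"
        using pow[of "p i" "d i"] insert.prems(1) by blast
      show "\<And>e. e \<in> kys (\<Prod>i\<in>A. p i ^ a i) \<Longrightarrow> l e = (\<Sum>i\<in>A. int (a i) * d i)"
        using insert by blast
    qed (use insert in simp)
    then show ?case using insert by simp
  qed (use one in auto)
qed

lemma powi_max_0: "y powi max 0 v = y ^ nat (max 0 v)"
  unfolding power_int_def by simp

lemma mutation_class_induct_from:
  assumes S: "subring_set K" "good_seed K S" and "T \<in> mutation_class S"
    and "P S"
    and "\<And>T k. T \<in> mutation_class S \<Longrightarrow> good_seed K T \<Longrightarrow> seed_n T = seed_n S \<Longrightarrow> seed_m T = seed_m S \<Longrightarrow>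
      k \<in> {1..seed_n S} \<Longrightarrow> P T \<Longrightarrow> P (mutate k T)"
  shows "P T"
  using assms(3)
proof (induction rule: mutation_class.induct)
  case initial
  show ?case by (rule assms(4))
next
  case (mutation T i)
  note g = good_seed_class[OF S mutation(1)]
  show ?case using assms(5)[OF mutation(1) g _ mutation(3)] mutation(2) g(2) by simp
qed

context
  fixes S :: "'f::field_char_0 seed"
  assumes S: "good_seed \<int> S"
begin

lemma laurent_lift:
  assumes "T \<in> mutation_class S"
  shows "laurent_lift S (seed_pt T i) \<in> laurent_over \<int> (seed_idx S)"
    "laurent_eval (seed_pt S) (laurent_lift S (seed_pt T i)) = seed_pt T i"
proof -
  have "seed_pt T i \<in> laurent_ring \<int> S"
    by (rule laurent_phenomenon[OF subring_set_Ints_self S mutation_class.initial assms])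
  then have "\<exists>p. p \<in> laurent_over \<int> (seed_idx S) \<and> laurent_eval (seed_pt S) p = seed_pt T i"
    unfolding laurent_ring_def by auto
  from someI_ex[OF this] show "laurent_lift S (seed_pt T i) \<in> laurent_over \<int> (seed_idx S)"
    "laurent_eval (seed_pt S) (laurent_lift S (seed_pt T i)) = seed_pt T i"
    unfolding laurent_lift_def by blast+
qed

lemma laurent_lift_unique:
  assumes "p \<in> laurent_over \<int> (seed_idx S)" "laurent_eval (seed_pt S) p = seed_pt T i" "T \<in> mutation_class S"
  shows "laurent_lift S (seed_pt T i) = p"
  using good_seed_inj[OF subring_set_Ints_self S laurent_lift(1)[OF assms(3)] assms(1)]
    laurent_lift(2)[OF assms(3)] assms(2) by simp

lemma laurent_lift_initial:
  assumes "i \<in> seed_idx S"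
  shows "laurent_lift S (seed_pt S i) = sgl (sgl i 1) 1"
  using assms
  by (intro laurent_lift_unique laurent_over_single[OF subring_set_Ints_self] mutation_class.initial) auto

lemma laurent_lift_nonzero:
  assumes "T \<in> mutation_class S"
  shows "laurent_lift S (seed_pt T i) \<noteq> 0"
proof
  assume "laurent_lift S (seed_pt T i) = 0"
  then have "seed_pt T i = 0" using laurent_lift(2)[OF assms, of i] by simp
  then show False using seed_pt_nz[OF good_seed_class(1)[OF subring_set_Ints_self S assms]] by blast
qed

text \<open>The exchange relation multiplied out, hence an identity of formal Laurent polynomials.
  Gradings and specializations are applied to it in place of an explicit formula for the new
  variable.\<close>

lemma laurent_lift_exchange:
  assumes T: "T \<in> mutation_class S" and k: "k \<in> {1..seed_n S}"
  shows "laurent_lift S (seed_pt T k) * laurent_lift S (seed_pt (mutate k T) k) =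
     (\<Prod>l\<in>seed_idx S. laurent_lift S (seed_pt T l) ^ nat (max 0 (seed_B T l k))) +
     (\<Prod>l\<in>seed_idx S. laurent_lift S (seed_pt T l) ^ nat (max 0 (- seed_B T l k)))" (is "?l = ?r")
proof -
  note g = good_seed_class[OF subring_set_Ints_self S T]
  have T': "mutate k T \<in> mutation_class S" using mutation_class.mutation[OF T] k g by simp
  have kI: "k \<in> seed_idx T" using k g by simp
  note nz = seed_pt_nz[OF S]
  have "laurent_eval (seed_pt S) ?l = seed_pt T k * (exchange_poly T k / seed_pt T k)"
    using laurent_lift(2)[OF T] laurent_lift(2)[OF T', of k] seed_pt_mutate[OF kI]
    by (simp add: laurent_eval_mult[OF nz])
  also have "\<dots> = exchange_poly T k" using seed_pt_nz[OF g(1)] by simp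
  also have "\<dots> = laurent_eval (seed_pt S) ?r"
    unfolding exchange_poly_alt powi_max_0 laurent_eval_add laurent_eval_prod[OF nz] laurent_eval_power[OF nz]
      laurent_lift(2)[OF T] g ..
  finally have eq: "laurent_eval (seed_pt S) ?l = laurent_eval (seed_pt S) ?r" .
  have "?l \<in> laurent_over \<int> (seed_idx S)"
    by (intro laurent_over_mult laurent_lift T T' subring_set_Ints_self)
  moreover have "?r \<in> laurent_over \<int> (seed_idx S)"
    by (intro laurent_over_add laurent_over_prod laurent_over_power laurent_lift T subring_set_Ints_self)
  ultimately show ?thesis by (rule good_seed_inj[OF subring_set_Ints_self S _ _ eq])
qed

lemma laurent_lift_other:
  assumes T: "T \<in> mutation_class S" and k: "k \<in> {1..seed_n S}" and "i \<noteq> k"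
  shows "laurent_lift S (seed_pt (mutate k T) i) = laurent_lift S (seed_pt T i)"
proof -
  have "k \<in> seed_idx T" using k good_seed_class[OF subring_set_Ints_self S T] by simp
  then have "seed_pt (mutate k T) i = seed_pt T i" using assms(3) by (subst seed_pt_mutate) simp_all
  then show ?thesis by simp
qed

end

text \<open>The grading \<open>deg x_i = e_i\<close>, \<open>deg y_j = - \<Sum>\<^sub>i b_{ij} e_i\<close> makes every exchange relation
  homogeneous; it is treated one coordinate \<open>r\<close> at a time.\<close>

definition principal_degree :: "'f seed \<Rightarrow> nat \<Rightarrow> (nat \<Rightarrow>\<^sub>0 int) \<Rightarrow> int" where
  "principal_degree S r e = lkp e r - (\<Sum>j\<in>{1..seed_n S}. seed_B S r j * lkp e (seed_n S + j))"

lemma principal_degree_add: "principal_degree S r (e + e') = principal_degree S r e + principal_degree S r e'"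
  by (simp add: principal_degree_def lookup_add algebra_simps sum.distrib)

lemma principal_degree_0: "principal_degree S r 0 = 0"
  by (simp add: principal_degree_def)

lemma principal_degree_single: "principal_degree S r (sgl i c) = c * principal_degree S r (sgl i 1)"
proof -
  have *: "(\<Sum>j\<in>{1..seed_n S}. seed_B S r j * lkp (sgl i c) (seed_n S + j)) =
      c * (\<Sum>j\<in>{1..seed_n S}. seed_B S r j * lkp (sgl i 1) (seed_n S + j))"
    unfolding sum_distrib_left by (rule sum.cong) (simp_all add: lookup_single when_def)
  have "lkp (sgl i c) r = c * lkp (sgl i 1) r" by (simp add: lookup_single when_def)
  with * show ?thesis unfolding principal_degree_def by (simp only: right_diff_distrib)
qed

lemma principal_degree_expo:
  "finite I \<Longrightarrow> principal_degree S r (expo I v) = (\<Sum>i\<in>I. v i * principal_degree S r (sgl i 1))"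
proof (induction I rule: finite_induct)
  case (insert i I)
  then have "expo (insert i I) v = sgl i (v i) + expo I v" by (simp add: expo_def)
  then show ?case using insert principal_degree_single[of S r i "v i"] by (simp add: principal_degree_add)
qed (simp add: expo_def principal_degree_0)

text \<open>The balance condition on the columns of the matrix strengthens the induction: it says
  that the two monomials of each exchange relation of \<open>T\<close> have equal degree.\<close>

lemma laurent_lift_homogeneous:
  assumes S: "good_seed \<int> S" and "principal_coefficients S" "r \<in> {1..seed_n S}" "T \<in> mutation_class S"
  shows "\<exists>d. (\<forall>i\<in>seed_idx S. \<forall>e\<in>kys (laurent_lift S (seed_pt T i)). principal_degree S r e = d i) \<and>
     (\<forall>j\<in>{1..seed_n S}. (\<Sum>i\<in>seed_idx S. seed_B T i j * d i) = 0)"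
  using assms(4)
proof (rule mutation_class_induct_from[OF subring_set_Ints_self S])
  let ?n = "seed_n S"
  define d where "d i = principal_degree S r (sgl i 1)" for i
  have "principal_degree S r e = d i" if "i \<in> seed_idx S" "e \<in> kys (laurent_lift S (seed_pt S i))" for i e
    using that(2) unfolding laurent_lift_initial[OF S that(1)] by (simp add: d_def split: if_splits)
  moreover have "(\<Sum>i\<in>seed_idx S. seed_B S i j * d i) = 0" if j: "j \<in> {1..?n}" for j
  proof -
    have "(\<Sum>i\<in>seed_idx S. seed_B S i j * d i) = principal_degree S r (expo (seed_idx S) (\<lambda>i. seed_B S i j))"
      unfolding d_def by (rule principal_degree_expo[symmetric]) simp
    also have "\<dots> = seed_B S r j - (\<Sum>j'\<in>{1..?n}. seed_B S r j' * seed_B S (?n + j') j)"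
    proof -
      have "?n + j' \<in> seed_idx S" if "j' \<in> {1..?n}" for j'
        using that assms(2) by (simp add: principal_coefficients_def)
      moreover have "r \<in> seed_idx S" using assms(3) by simp
      ultimately show ?thesis
        unfolding principal_degree_def lookup_expo[OF finite_atLeastAtMost] by (auto intro!: sum.cong)
    qed
    also have "(\<Sum>j'\<in>{1..?n}. seed_B S r j' * seed_B S (?n + j') j) = (\<Sum>j'\<in>{1..?n}. if j' = j then seed_B S r j else 0)"
      using assms(2) j unfolding principal_coefficients_def by (intro sum.cong) auto
    also have "\<dots> = seed_B S r j" using j by simp
    finally show ?thesis by simp
  qed
  ultimately show "\<exists>d. (\<forall>i\<in>seed_idx S. \<forall>e\<in>kys (laurent_lift S (seed_pt S i)). principal_degree S r e = d i) \<and>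
     (\<forall>j\<in>{1..?n}. (\<Sum>i\<in>seed_idx S. seed_B S i j * d i) = 0)" by blast
next
  fix T k
  let ?n = "seed_n S" and ?I = "seed_idx S" and ?B = "seed_B T" and ?P = "\<lambda>i. laurent_lift S (seed_pt T i)"
  assume T: "T \<in> mutation_class S" "good_seed \<int> T" "seed_n T = seed_n S" "seed_m T = seed_m S"
    and k: "k \<in> {1..?n}"
    and "\<exists>d. (\<forall>i\<in>?I. \<forall>e\<in>kys (?P i). principal_degree S r e = d i) \<and>
     (\<forall>j\<in>{1..?n}. (\<Sum>i\<in>?I. ?B i j * d i) = 0)"
  then obtain d where d: "\<And>i e. i \<in> ?I \<Longrightarrow> e \<in> kys (?P i) \<Longrightarrow> principal_degree S r e = d i"
    and bal: "\<And>j. j \<in> {1..?n} \<Longrightarrow> (\<Sum>i\<in>?I. ?B i j * d i) = 0" by blast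
  have diag: "?B k k = 0" using exchange_matrix_diag[of ?n ?B k] T k by (simp add: good_seed_def)
  have kI: "k \<in> ?I" using k by simp
  have T': "mutate k T \<in> mutation_class S" using mutation_class.mutation[OF T(1)] k T by simp
  let ?q = "laurent_lift S (seed_pt (mutate k T) k)"
  define D where "D = (\<Sum>i\<in>?I. max 0 (?B i k) * d i)"
  have D': "(\<Sum>i\<in>?I. max 0 (- ?B i k) * d i) = D"
  proof -
    have "D - (\<Sum>i\<in>?I. max 0 (- ?B i k) * d i) = (\<Sum>i\<in>?I. ?B i k * d i)"
      unfolding D_def sum_subtractf[symmetric]
      by (rule sum.cong) (simp_all add: max_def)
    then show ?thesis using bal[OF k] by simp
  qed
  have hom: "principal_degree S r e = (\<Sum>i\<in>?I. int (a i) * d i)" if "e \<in> kys (\<Prod>i\<in>?I. ?P i ^ a i)" for a e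
    by (rule keys_prod_homog[OF principal_degree_add d that])
  have "principal_degree S r e = D" if "e \<in> kys (?P k * ?q)" for e
  proof -
    have "e \<in> kys (\<Prod>i\<in>?I. ?P i ^ nat (max 0 (?B i k))) \<or> e \<in> kys (\<Prod>i\<in>?I. ?P i ^ nat (max 0 (- ?B i k)))"
      using that unfolding laurent_lift_exchange[OF S T(1) k] by (rule keys_addE)
    then show ?thesis using hom[of e] D' by (auto simp: D_def)
  qed
  moreover have "?P k * ?q \<noteq> 0" using laurent_lift_nonzero[OF S T(1)] laurent_lift_nonzero[OF S T'] by simp
  \<comment> \<open>The new variable is homogeneous because it is a factor of a homogeneous
    product.\<close>
  ultimately obtain a b where ab: "D = a + b" "\<And>e. e \<in> kys (?P k) \<Longrightarrow> principal_degree S r e = a"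
    "\<And>e. e \<in> kys ?q \<Longrightarrow> principal_degree S r e = b"
    using homog_factors[of "principal_degree S r" "?P k" ?q D] principal_degree_add by metis
  obtain e where "e \<in> kys (?P k)" using laurent_lift_nonzero[OF S T(1)] by (metis all_not_in_conv keys_eq_empty)
  then have "a = d k" using ab(2) d[OF kI] by force
  then have b: "b = D - d k" using ab(1) by simp
  define d' where "d' = d(k := b)"
  have "principal_degree S r e = d' i" if i: "i \<in> ?I" and e: "e \<in> kys (laurent_lift S (seed_pt (mutate k T) i))" for i e
  proof (cases "i = k")
    case True
    then show ?thesis using e ab(3) by (simp add: d'_def)
  next
    case False
    then show ?thesis using e d[OF i] laurent_lift_other[OF S T(1) k False] by (simp add: d'_def)
  qed
  moreover have "(\<Sum>i\<in>?I. mutate_matrix k ?B i j * d' i) = 0" if j: "j \<in> {1..?n}" for j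
  proof -
    have split: "(\<Sum>i\<in>?I. g i) = g k + (\<Sum>i\<in>?I - {k}. g i)" for g :: "nat \<Rightarrow> int"
      using kI by (simp add: sum.remove)
    have D2: "(\<Sum>i\<in>?I - {k}. max 0 (?B i k) * d i) = D"
      using split[of "\<lambda>i. max 0 (?B i k) * d i"] diag by (simp add: D_def)
    have z: "(\<Sum>i\<in>?I - {k}. ?B i k * d i) = 0"
      using split[of "\<lambda>i. ?B i k * d i"] diag bal[OF k] by simp
    show ?thesis
    proof (cases "j = k")
      case True
      have "(\<Sum>i\<in>?I - {k}. mutate_matrix k ?B i k * d' i) = (\<Sum>i\<in>?I - {k}. - (?B i k * d i))"
        by (rule sum.cong) (simp_all add: mutate_matrix_alt d'_def)
      then show ?thesis
        using z by (simp only: True split[of "\<lambda>i. mutate_matrix k ?B i k * d' i"] sum_negf)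
          (simp add: mutate_matrix_alt diag)
    next
      case False
      have "(\<Sum>i\<in>?I - {k}. mutate_matrix k ?B i j * d' i) =
        (\<Sum>i\<in>?I - {k}. ?B i j * d i + ?B k j * (max 0 (?B i k) * d i) + max 0 (- ?B k j) * (?B i k * d i))"
        using False by (intro sum.cong) (simp_all add: mutate_matrix_alt d'_def algebra_simps)
      also have "\<dots> = (\<Sum>i\<in>?I - {k}. ?B i j * d i) + ?B k j * D"
        by (simp only: sum.distrib sum_distrib_left[symmetric] D2 z mult_zero_right add_0_right)
      finally have "(\<Sum>i\<in>?I. mutate_matrix k ?B i j * d' i) =
          - ?B k j * (D - d k) + ((\<Sum>i\<in>?I - {k}. ?B i j * d i) + ?B k j * D)"
        by (simp only: split[of "\<lambda>i. mutate_matrix k ?B i j * d' i"]) (simp add: mutate_matrix_alt d'_def b)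
      also have "\<dots> = ?B k j * d k + (\<Sum>i\<in>?I - {k}. ?B i j * d i)" by (simp add: algebra_simps)
      also have "\<dots> = 0" using split[of "\<lambda>i. ?B i j * d i"] bal[OF j] by simp
      finally show ?thesis .
    qed
  qed
  ultimately show "\<exists>d. (\<forall>i\<in>?I. \<forall>e\<in>kys (laurent_lift S (seed_pt (mutate k T) i)). principal_degree S r e = d i) \<and>
     (\<forall>j\<in>{1..?n}. (\<Sum>i\<in>?I. seed_B (mutate k T) i j * d i) = 0)"
    unfolding mutate_simps by blast
qed

section \<open>Specialization at a vanishing frozen variable\<close>

definition eval_at_zero :: "nat \<Rightarrow> 'f::field_char_0 laurent \<Rightarrow> 'f" where
  "eval_at_zero r p = laurent_eval (\<lambda>_. 1) (homog_part (\<lambda>e. lkp e r) 0 p)"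

definition regular_at :: "nat \<Rightarrow> 'f::field_char_0 laurent \<Rightarrow> bool" where
  "regular_at r p \<longleftrightarrow> (\<forall>e\<in>kys p. 0 \<le> lkp e r)"

lemma eval_at_zero_add: "eval_at_zero r (p + q) = eval_at_zero r p + eval_at_zero r q"
  by (simp add: eval_at_zero_def homog_part_add laurent_eval_add)

lemma regular_at_add: "regular_at r p \<Longrightarrow> regular_at r q \<Longrightarrow> regular_at r (p + q)"
  unfolding regular_at_def by (blast dest: keys_addE)

lemma regular_at_factor:
  assumes "regular_at r p" "homog_part (\<lambda>e. lkp e r) 0 p \<noteq> 0" "regular_at r (p * q)"
  shows "regular_at r q"
  unfolding regular_at_def
proof
  fix e assume e: "e \<in> kys q"
  show "0 \<le> lkp e r"
    using assms unfolding regular_at_def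
    by (intro factor_nonneg_degree[where l = "\<lambda>e. lkp e r", OF lookup_add _ assms(2) _ e]) blast+
qed

text \<open>For Laurent polynomials regular at \<open>r\<close> the part of degree 0 is the bottom
  part, and bottom parts multiply. On these, \<open>eval_at_zero\<close> is evaluation at the point
  with coordinate \<open>r\<close> equal to 0 and all others equal to 1.\<close>

lemma eval_at_zero_mult:
  assumes "regular_at r p" "regular_at r q"
  shows "eval_at_zero r (p * q) = eval_at_zero r p * eval_at_zero r q" "regular_at r (p * q)"
proof -
  have "homog_part (\<lambda>e. lkp e r) (0 + 0) (p * q) = homog_part (\<lambda>e. lkp e r) 0 p * homog_part (\<lambda>e. lkp e r) 0 q"
    by (rule homog_part_mult_bot) (use assms in \<open>auto simp: lookup_add regular_at_def\<close>)
  then show "eval_at_zero r (p * q) = eval_at_zero r p * eval_at_zero r q"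
    by (simp add: eval_at_zero_def laurent_eval_mult)
  show "regular_at r (p * q)"
    unfolding regular_at_def
  proof
    fix e assume "e \<in> kys (p * q)"
    then obtain b c where "e = b + c" "b \<in> kys p" "c \<in> kys q" using keys_mult[of p q] by blast
    then show "0 \<le> lkp e r" using assms by (auto simp: regular_at_def lookup_add)
  qed
qed

lemma eval_at_zero_single:
  "eval_at_zero r (sgl e c) = (if lkp e r = 0 then c else 0)"
proof (cases "lkp e r = 0")
  case True
  then have "homog_part (\<lambda>e. lkp e r) 0 (sgl e c) = sgl e c"
    by (intro homog_part_id) (simp split: if_splits)
  then show ?thesis using True by (simp add: eval_at_zero_def monom_eval_def)
next
  case False
  then have "homog_part (\<lambda>e. lkp e r) 0 (sgl e c) = 0"
    by (intro homog_part_eq_0) (simp split: if_splits)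
  then show ?thesis using False by (simp add: eval_at_zero_def)
qed

lemma eval_at_zero_1: "eval_at_zero r (1 :: 'f::field_char_0 laurent) = 1" "regular_at r (1 :: 'f::field_char_0 laurent)"
  using eval_at_zero_single[of r 0 "1 :: 'f"] by (auto simp: regular_at_def split: if_splits)

lemma eval_at_zero_power:
  "regular_at r p \<Longrightarrow> eval_at_zero r (p ^ a) = eval_at_zero r p ^ a \<and> regular_at r (p ^ a)"
  by (induction a) (auto simp: eval_at_zero_1 eval_at_zero_mult)

lemma eval_at_zero_prod:
  "(\<And>i. i \<in> A \<Longrightarrow> regular_at r (p i)) \<Longrightarrow>
    eval_at_zero r (\<Prod>i\<in>A. p i) = (\<Prod>i\<in>A. eval_at_zero r (p i)) \<and> regular_at r (\<Prod>i\<in>A. p i)"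
  by (induction A rule: infinite_finite_induct) (auto simp: eval_at_zero_1 eval_at_zero_mult)

lemma eval_at_zero_Ints:
  assumes "p \<in> laurent_over \<int> I"
  shows "eval_at_zero r p \<in> \<int>"
proof -
  have "homog_part (\<lambda>e. lkp e r) 0 p \<in> laurent_over \<int> I"
    by (rule laurent_over_homog_part[OF subring_set_Ints_self assms])
  then show ?thesis
    unfolding eval_at_zero_def laurent_eval_alt laurent_over_def
    by (intro Ints_sum) (simp add: monom_eval_def)
qed

text \<open>Evaluating at \<open>y_r = 0\<close> and \<open>1\<close> elsewhere, at most one of the two terms of an exchange
  relation vanishes. So by subtraction-free induction the values of the cluster variables are
  positive, which makes them regular at \<open>y_r = 0\<close> and not divisible by \<open>y_r\<close>.\<close>

lemma laurent_lift_regular: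
  assumes S: "good_seed \<int> S" and r: "r \<in> seed_idx S" "r \<notin> {1..seed_n S}" and T: "T \<in> mutation_class S"
  shows "\<forall>i\<in>seed_idx S. regular_at r (laurent_lift S (seed_pt T i)) \<and>
     (\<exists>k::int. eval_at_zero r (laurent_lift S (seed_pt T i)) = of_int k \<and> 0 \<le> k \<and> (i \<noteq> r \<longrightarrow> 0 < k))"
  using T
proof (rule mutation_class_induct_from[OF subring_set_Ints_self S])
  show "\<forall>i\<in>seed_idx S. regular_at r (laurent_lift S (seed_pt S i)) \<and>
     (\<exists>k::int. eval_at_zero r (laurent_lift S (seed_pt S i)) = of_int k \<and> 0 \<le> k \<and> (i \<noteq> r \<longrightarrow> 0 < k))"
  proof
    fix i assume i: "i \<in> seed_idx S"
    have "regular_at r (sgl (sgl i 1) (1 :: 'a))"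
      by (simp add: regular_at_def lookup_single when_def)
    moreover have "eval_at_zero r (sgl (sgl i 1) (1 :: 'a)) = of_int (if i = r then 0 else 1)"
      by (simp add: eval_at_zero_single lookup_single when_def)
    ultimately show "regular_at r (laurent_lift S (seed_pt S i)) \<and>
     (\<exists>k::int. eval_at_zero r (laurent_lift S (seed_pt S i)) = of_int k \<and> 0 \<le> k \<and> (i \<noteq> r \<longrightarrow> 0 < k))"
      unfolding laurent_lift_initial[OF S i] by (metis order_refl zero_less_one zero_le_one)
  qed
next
  fix T k
  let ?n = "seed_n S" and ?I = "seed_idx S" and ?B = "seed_B T" and ?P = "\<lambda>i. laurent_lift S (seed_pt T i)"
  assume T: "T \<in> mutation_class S" "good_seed \<int> T" "seed_n T = seed_n S" "seed_m T = seed_m S"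
    and k: "k \<in> {1..?n}"
    and IH: "\<forall>i\<in>?I. regular_at r (?P i) \<and>
     (\<exists>k::int. eval_at_zero r (?P i) = of_int k \<and> 0 \<le> k \<and> (i \<noteq> r \<longrightarrow> 0 < k))"
  have T': "mutate k T \<in> mutation_class S" using mutation_class.mutation[OF T(1)] k T by simp
  have kI: "k \<in> ?I" and kr: "k \<noteq> r" using k r by auto
  let ?q = "laurent_lift S (seed_pt (mutate k T) k)"
  obtain v where v: "\<And>i. i \<in> ?I \<Longrightarrow> eval_at_zero r (?P i) = of_int (v i)" "\<And>i. i \<in> ?I \<Longrightarrow> 0 \<le> v i"
    "\<And>i. i \<in> ?I \<Longrightarrow> i \<noteq> r \<Longrightarrow> 0 < v i"
    using IH by metis
  have reg: "regular_at r (?P i)" if "i \<in> ?I" for i using IH that by blast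
  define V where "V a = (\<Prod>i\<in>?I. v i ^ a i)" for a :: "nat \<Rightarrow> nat"
  have prod: "eval_at_zero r (\<Prod>i\<in>?I. ?P i ^ a i) = of_int (V a)" "regular_at r (\<Prod>i\<in>?I. ?P i ^ a i)"
    for a
  proof -
    have "eval_at_zero r (\<Prod>i\<in>?I. ?P i ^ a i) = (\<Prod>i\<in>?I. eval_at_zero r (?P i ^ a i)) \<and>
        regular_at r (\<Prod>i\<in>?I. ?P i ^ a i)"
      using eval_at_zero_power reg by (intro eval_at_zero_prod) blast
    moreover have "(\<Prod>i\<in>?I. eval_at_zero r (?P i ^ a i)) = (\<Prod>i\<in>?I. of_int (v i ^ a i))"
      using eval_at_zero_power[OF reg] v(1) by (intro prod.cong refl) (simp only: of_int_power)
    ultimately show "eval_at_zero r (\<Prod>i\<in>?I. ?P i ^ a i) = of_int (V a)" "regular_at r (\<Prod>i\<in>?I. ?P i ^ a i)"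
      by (simp_all add: V_def)
  qed
  have V0: "0 \<le> V a" for a unfolding V_def using v(2) by (intro prod_nonneg) simp
  have V1: "0 < V a" if "a r = 0" for a
    unfolding V_def
  proof (rule prod_pos)
    fix i assume "i \<in> ?I"
    then show "0 < v i ^ a i" using v(3) that by (cases "i = r") auto
  qed
  define w where "w = V (\<lambda>i. nat (max 0 (?B i k))) + V (\<lambda>i. nat (max 0 (- ?B i k)))"
  have w: "w > 0"
  \<comment> \<open>The sign of \<open>b_rk\<close> decides which of the two monomials is free of
    \<open>y_r\<close> and therefore positive.\<close>
  proof (cases "?B r k \<ge> 0")
    case True
    then have "V (\<lambda>i. nat (max 0 (- ?B i k))) > 0" by (intro V1) simp
    then show ?thesis unfolding w_def using V0[of "\<lambda>i. nat (max 0 (?B i k))"] by linarith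
  next
    case False
    then have "V (\<lambda>i. nat (max 0 (?B i k))) > 0" by (intro V1) simp
    then show ?thesis unfolding w_def using V0[of "\<lambda>i. nat (max 0 (- ?B i k))"] by linarith
  qed
  have ev: "eval_at_zero r (?P k * ?q) = of_int w"
    unfolding laurent_lift_exchange[OF S T(1) k] eval_at_zero_add prod w_def by simp
  have rg: "regular_at r (?P k * ?q)"
    unfolding laurent_lift_exchange[OF S T(1) k] by (intro regular_at_add prod)
  have "homog_part (\<lambda>e. lkp e r) 0 (?P k) \<noteq> 0"
  proof
    assume "homog_part (\<lambda>e. lkp e r) 0 (?P k) = 0"
    then have "eval_at_zero r (?P k) = 0" by (simp add: eval_at_zero_def)
    then show False using v(1,3)[OF kI] kr by simp
  qed
  then have rq: "regular_at r ?q"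
    by (intro regular_at_factor[OF reg[OF kI] _ rg])
  \<comment> \<open>The field carries no order; positivity of the quotient is that of an integer, so
    its integrality has to be known first.\<close>
  have "eval_at_zero r ?q \<in> \<int>" by (rule eval_at_zero_Ints[OF laurent_lift(1)[OF S T']])
  then obtain u where u: "eval_at_zero r ?q = of_int u" by (elim Ints_cases)
  have "of_int (v k * u) = (of_int w :: 'a)"
    using ev eval_at_zero_mult(1)[OF reg[OF kI] rq] v(1)[OF kI] u by simp
  then have "v k * u = w" using of_int_eq_iff by blast
  then have "u > 0" using w v(3)[OF kI kr] by (metis zero_less_mult_pos)
  then have qk: "regular_at r ?q \<and> (\<exists>k'::int. eval_at_zero r ?q = of_int k' \<and> 0 \<le> k' \<and> (k \<noteq> r \<longrightarrow> 0 < k'))"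
    using rq u by (auto intro: exI[of _ u])
  show "\<forall>i\<in>?I. regular_at r (laurent_lift S (seed_pt (mutate k T) i)) \<and>
     (\<exists>k'::int. eval_at_zero r (laurent_lift S (seed_pt (mutate k T) i)) = of_int k' \<and> 0 \<le> k' \<and> (i \<noteq> r \<longrightarrow> 0 < k'))"
  proof
    fix i assume i: "i \<in> ?I"
    show "regular_at r (laurent_lift S (seed_pt (mutate k T) i)) \<and>
     (\<exists>k'::int. eval_at_zero r (laurent_lift S (seed_pt (mutate k T) i)) = of_int k' \<and> 0 \<le> k' \<and> (i \<noteq> r \<longrightarrow> 0 < k'))"
    proof (cases "i = k")
      case True
      then show ?thesis using qk by blast
    next
      case False
      then show ?thesis using IH i unfolding laurent_lift_other[OF S T(1) k False] by blast
    qed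
  qed
qed

subsection \<open>Factorization in the cluster algebra\<close>

lemma ring_of_type_algebra_simps [simp]:
  "x \<otimes>\<^bsub>ring_of_type_algebra\<^esub> y = x * y"
  "\<one>\<^bsub>ring_of_type_algebra\<^esub> = 1" "\<zero>\<^bsub>ring_of_type_algebra\<^esub> = 0"
  by (simp_all add: ring_of_type_algebra_def)

lemma Units_subring_of: "a \<in> Units (subring_of A) \<longleftrightarrow> a \<in> A \<and> a \<noteq> 0 \<and> inverse a \<in> A"
proof
  assume "a \<in> Units (subring_of A)"
  then obtain b where "a \<in> A" "b \<in> A" "b * a = 1" by (auto simp: Units_def)
  then show "a \<in> A \<and> a \<noteq> 0 \<and> inverse a \<in> A"
    using inverse_unique[of a b] by (auto simp: mult.commute)
next
  assume "a \<in> A \<and> a \<noteq> 0 \<and> inverse a \<in> A"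
  then show "a \<in> Units (subring_of A)" by (auto simp: Units_def intro!: bexI[of _ "inverse a"])
qed

lemma subring_set_adjoin: "subring_set (adjoin K Y)"
  unfolding subring_set_def
proof (intro conjI ballI)
  let ?R = "ring_of_type_algebra :: 'a ring"
  show "1 \<in> adjoin K Y"
    using generate_ring.one[of ?R "K \<union> Y"] by (simp add: adjoin_def ring_of_type_algebra_def)
  fix a b assume ab: "a \<in> adjoin K Y" "b \<in> adjoin K Y"
  show "a * b \<in> adjoin K Y"
    using generate_ring.eng_mult[of a ?R "K \<union> Y" b] ab by (simp add: adjoin_def ring_of_type_algebra_def)
  have "- b \<in> adjoin K Y"
    using generate_ring.a_inv[of b ?R "K \<union> Y"] ab by (simp add: adjoin_def a_inv_type_algebra)
  then have "a + - b \<in> adjoin K Y"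
    using generate_ring.eng_add[of a ?R "K \<union> Y" "- b"] ab by (simp add: adjoin_def ring_of_type_algebra_def)
  then show "a - b \<in> adjoin K Y" by simp
qed

lemma adjoin_incl: "a \<in> K \<Longrightarrow> a \<in> adjoin K Y" "a \<in> Y \<Longrightarrow> a \<in> adjoin K Y"
  unfolding adjoin_def by (auto intro: generate_ring.incl)

lemma adjoin_least:
  assumes R: "subring_set R" and "K \<subseteq> R" "Y \<subseteq> R"
  shows "adjoin K Y \<subseteq> R"
proof
  fix a assume "a \<in> adjoin K Y"
  then show "a \<in> R"
    unfolding adjoin_def
  proof (induction rule: generate_ring.induct)
    case one
    then show ?case using subring_set_1[OF R] by (simp add: ring_of_type_algebra_def)
  next
    case (a_inv h)
    then show ?case using subring_set_uminus[OF R] by (simp add: a_inv_type_algebra)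
  next
    case (eng_add h1 h2)
    then show ?case using subring_set_add[OF R] by (simp add: ring_of_type_algebra_def)
  next
    case (eng_mult h1 h2)
    then show ?case using subring_set_mult[OF R] by (simp add: ring_of_type_algebra_def)
  qed (use assms in blast)
qed

lemma factorial_irreducible_dvd:
  assumes fd: "factorial_domain (subring_of A)"
    and z: "z \<in> A" "z \<noteq> 0" "inverse z \<notin> A"
    and irr: "\<And>a b. a \<in> A \<Longrightarrow> b \<in> A \<Longrightarrow> a * b = z \<Longrightarrow> inverse a \<in> A \<or> inverse b \<in> A"
    and ab: "a \<in> A" "b \<in> A" "q \<in> A" "a * b = z * q"
  shows "(\<exists>r\<in>A. a = z * r) \<or> (\<exists>r\<in>A. b = z * r)"
proof -
  interpret factorial_domain "subring_of A" by (rule fd)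
  have "ring_irreducible\<^bsub>subring_of A\<^esub> z"
  proof (rule ring_irreducibleI)
    show "z \<in> carrier (subring_of A) - {\<zero>\<^bsub>subring_of A\<^esub>}" "z \<notin> Units (subring_of A)"
      using z by (simp_all add: Units_subring_of)
    fix a b assume "a \<in> carrier (subring_of A)" "b \<in> carrier (subring_of A)" "z = a \<otimes>\<^bsub>subring_of A\<^esub> b"
    then show "a \<in> Units (subring_of A) \<or> b \<in> Units (subring_of A)"
      using irr[of a b] z(2) by (auto simp: Units_subring_of)
  qed
  then have "prime (mult_of (subring_of A)) z"
    using irreducible_prime[of z] ring_irreducibleE(3)[of z] z by simp
  then have "prime (subring_of A) z" using prime_eq_prime_mult[of z] z by simp
  then have "z divides\<^bsub>subring_of A\<^esub> a \<or> z divides\<^bsub>subring_of A\<^esub> b"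
    using ab by (elim primeE) (auto simp: factor_def)
  then show ?thesis by (auto simp: factor_def)
qed

section \<open>Cluster variables are irreducible\<close>

locale principal_seed =
  fixes K :: "'f::field_char_0 set" and S :: "'f seed"
  assumes base: "base_ring K" and seed: "is_seed K S" and principal: "principal_coefficients S"
begin

abbreviation "A \<equiv> cluster_algebra K S"
abbreviation "n \<equiv> seed_n S"
abbreviation "I \<equiv> seed_idx S"

lemma K: "subring_set K"
  by (rule subring_set_base_ring[OF base])

lemma S: "good_seed K S"
  by (rule good_seed_principal[OF K seed principal])

lemma S_Ints: "good_seed \<int> S"
  using S laurent_over_mono[OF subring_set_Ints[OF K] order_refl, of I] by (auto simp: good_seed_def)

lemma A: "subring_set A"
  unfolding cluster_algebra_def by (rule subring_set_adjoin)

lemma K_A: "K \<subseteq> A"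
  unfolding cluster_algebra_def using adjoin_incl(1) by blast

lemma seed_pt_exchangeable:
  assumes "T \<in> mutation_class S" "l \<in> {1..n}"
  shows "seed_pt T l = seed_x T l"
  using assms(2) good_seed_class(2,3)[OF K S assms(1)] unfolding seed_pt_def by auto

lemma cluster_var_A:
  assumes "T \<in> mutation_class S" "l \<in> {1..n}"
  shows "seed_pt T l \<in> A"
proof -
  have "seed_x T l \<in> cluster_variables S"
    using assms good_seed_class(2)[OF K S assms(1)] unfolding cluster_variables_def exchangeable_vars_def by force
  then show ?thesis
    unfolding seed_pt_exchangeable[OF assms] cluster_algebra_def by (intro adjoin_incl(2)) blast
qed

lemma frozen_idx: "i \<in> I \<Longrightarrow> i \<notin> {1..n} \<Longrightarrow> i \<in> {n + 1..n + seed_m S}"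
  by auto

lemma frozen_pt:
  assumes "i \<in> I" "i \<notin> {1..n}"
  shows "seed_pt S i \<in> frozen_vars S"
  using assms frozen_idx[OF assms] unfolding frozen_vars_def seed_pt_def by simp

lemma frozen_A:
  assumes "i \<in> I" "i \<notin> {1..n}"
  shows "seed_pt S i \<in> A" "inverse (seed_pt S i) \<in> A"
  using frozen_pt[OF assms] unfolding cluster_algebra_def by (auto intro: adjoin_incl(2))

lemma frozen_pt_class:
  assumes T: "T \<in> mutation_class S" and i: "i \<notin> {1..n}"
  shows "seed_pt T i = seed_pt S i"
  using T
proof (rule mutation_class_induct_from[OF K S])
  fix T k assume "T \<in> mutation_class S" "seed_n T = n" "seed_m T = seed_m S" "k \<in> {1..n}" "seed_pt T i = seed_pt S i"
  moreover from this have "k \<in> seed_idx T" by simp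
  moreover have "i \<noteq> k" using i \<open>k \<in> {1..n}\<close> by blast
  ultimately show "seed_pt (mutate k T) i = seed_pt S i" by (subst seed_pt_mutate) simp_all
qed simp

lemma A_laurent_ring:
  assumes T: "T \<in> mutation_class S"
  shows "A \<subseteq> laurent_ring K T"
  unfolding cluster_algebra_def
proof (rule adjoin_least)
  note g = good_seed_class[OF K S T]
  show "subring_set (laurent_ring K T)" by (rule subring_laurent_ring[OF K g(1)])
  show "K \<subseteq> laurent_ring K T" using laurent_ring_base[OF K g(1)] by blast
  have fr: "a \<in> laurent_ring K T \<and> inverse a \<in> laurent_ring K T" if fa: "a \<in> frozen_vars S" for a
  proof -
    obtain i where i: "a = seed_x S i" "i \<in> {n + 1..n + seed_m S}" using fa unfolding frozen_vars_def by blast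
    then have "a = seed_pt T i" using frozen_pt_class[OF T, of i] by (simp add: seed_pt_def)
    then show ?thesis using laurent_ring_var[OF K g(1)] laurent_ring_inverse_var[OF K g(1)] by simp
  qed
  moreover have "cluster_variables S \<subseteq> laurent_ring K T"
  proof
    fix a assume "a \<in> cluster_variables S"
    then obtain T' l where T': "T' \<in> mutation_class S" "l \<in> {1..seed_n T'}" "a = seed_x T' l"
      by (auto simp: cluster_variables_def exchangeable_vars_def)
    then have "a = seed_pt T' l" using seed_pt_exchangeable good_seed_class(2)[OF K S T'(1)] by simp
    then show "a \<in> laurent_ring K T" using laurent_phenomenon[OF K S T T'(1)] by simp
  qed
  ultimately show "cluster_variables S \<union> frozen_vars S \<union> inverse ` frozen_vars S \<subseteq> laurent_ring K T" by blast
qed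

lemma frozen_monom_A:
  assumes T: "T \<in> mutation_class S" and e: "kys e \<subseteq> I" "\<forall>j\<in>{1..n}. lkp e j = 0"
  shows "monom_eval (seed_pt T) e \<in> A"
  unfolding monom_eval_def
proof (intro subring_set_prod[OF A] subring_set_powi[OF A])
  fix i assume "i \<in> kys e"
  then have i: "i \<in> I" "i \<notin> {1..n}" using e by (auto simp: in_keys_iff)
  show "seed_pt T i \<in> A" "inverse (seed_pt T i) \<in> A"
    using frozen_A[OF i] frozen_pt_class[OF T i(2)] by simp_all
qed

text \<open>In the Laurent ring of the seed mutated at \<open>j\<close>, a negative power of \<open>x_j\<close> is a negative power
  of a binomial, which is not a monomial.\<close>

lemma monom_A_nonneg:
  assumes T: "T \<in> mutation_class S" and j: "j \<in> {1..n}"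
    and c: "c \<in> K" "c \<noteq> 0" and e: "kys e \<subseteq> I"
    and mem: "c * monom_eval (seed_pt T) e \<in> A"
  shows "0 \<le> lkp e j"
proof (rule ccontr)
  assume neg: "\<not> 0 \<le> lkp e j"
  define N where "N = nat (- lkp e j)"
  have N: "N > 0" "lkp e j = - int N" using neg by (simp_all add: N_def)
  note g = good_seed_class[OF K S T]
  let ?T = "mutate j T" and ?F = "exch_laurent (mutate j T) j"
  have T': "?T \<in> mutation_class S" using mutation_class.mutation[OF T] j g by simp
  note g' = good_seed_class[OF K S T']
  have jI: "j \<in> seed_idx ?T" "j \<in> {1..seed_n ?T}" using j g' by simp_all
  have inv: "mutate j ?T = T" using mutate_mutate[OF K g(1)] j g by simp
  have f0: "exchange_poly ?T j \<noteq> 0" by (rule exchange_poly_nonzero[OF K g'(1)])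
  have nz: "\<forall>i. seed_pt ?T i \<noteq> 0" by (rule seed_pt_nz[OF g'(1)])
  have "c * monom_eval (seed_pt T) e \<in> laurent_ring K ?T" using mem A_laurent_ring[OF T'] by blast
  then obtain p where p: "p \<in> laurent_over K (seed_idx ?T)" "c * monom_eval (seed_pt T) e = laurent_eval (seed_pt ?T) p"
    by (rule laurent_ringE)
  have "monom_eval (seed_pt T) e = monom_eval (seed_pt ?T) (negate_at j e) * exchange_poly ?T j powi lkp e j"
    using monom_eval_mutate[OF g'(1) jI(1), of e] inv by simp
  also have "\<dots> = monom_eval (seed_pt ?T) (negate_at j e) / exchange_poly ?T j ^ N"
    by (simp add: N(2) power_int_minus divide_inverse)
  finally have "laurent_eval (seed_pt ?T) (p * ?F ^ N) = laurent_eval (seed_pt ?T) (sgl (negate_at j e) c)"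
    using f0 p(2)[symmetric]
    by (simp add: laurent_eval_mult[OF nz] laurent_eval_power[OF nz] laurent_eval_exch)
  moreover have "p * ?F ^ N \<in> laurent_over K (seed_idx ?T)"
    by (intro laurent_over_mult laurent_over_power exch_laurent_over K p(1))
  moreover have "kys (negate_at j e) \<subseteq> seed_idx ?T"
  proof -
    have "kys (negate_at j e) \<subseteq> kys e" by (auto simp: in_keys_iff lookup_negate_at split: if_splits)
    then show ?thesis using e g'(2,3) by auto
  qed
  then have "sgl (negate_at j e) c \<in> laurent_over K (seed_idx ?T)" by (intro laurent_over_single[OF K c(1)])
  ultimately have "p * ?F ^ N = sgl (negate_at j e) c" using good_seed_inj[OF K g'(1)] by blast
  \<comment> \<open>Since \<open>N > 0\<close>, at least one factor \<open>?F\<close> divides the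
    monomial, which forces \<open>?F\<close> itself to be a monomial.\<close>
  moreover have "?F ^ N = ?F * ?F ^ (N - 1)" using N(1) by (cases N) simp_all
  ultimately have "?F * (?F ^ (N - 1) * p) = sgl (negate_at j e) c" by (simp add: mult_ac)
  then obtain a where a: "?F = sgl a (lkp ?F a)" using monomial_factors c(2) by metis
  \<comment> \<open>The two exponents differ by column \<open>j\<close>, which is nonzero by full
    rank.\<close>
  have "pos_exp ?T j \<noteq> neg_exp ?T j"
  proof
    assume eq: "pos_exp ?T j = neg_exp ?T j"
    have "seed_B ?T i j = 0" if i: "i \<in> seed_idx ?T" for i
    proof -
      have "lkp (pos_exp ?T j) i = lkp (neg_exp ?T j) i" using eq by simp
      then have "max 0 (seed_B ?T i j) = max 0 (- seed_B ?T i j)"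
        using i unfolding pos_exp_def neg_exp_def lookup_expo[OF finite_atLeastAtMost] by metis
      then show ?thesis by linarith
    qed
    moreover have "full_rank ?T" using g'(1) by (simp add: good_seed_def)
    ultimately show False using full_rank_column[of ?T j] jI(2) by blast
  qed
  then have "lkp ?F (pos_exp ?T j) = 1" "lkp ?F (neg_exp ?T j) = 1"
    by (simp_all add: exch_laurent_def lookup_add lookup_single when_def)
  then have "pos_exp ?T j = a" "neg_exp ?T j = a"
    using a lookup_single_not_eq by (metis zero_neq_one)+
  then show False using \<open>pos_exp ?T j \<noteq> neg_exp ?T j\<close> by simp
qed

lemma cluster_var_not_unit:
  assumes T: "T \<in> mutation_class S" and l: "l \<in> {1..n}"
  shows "inverse (seed_pt T l) \<notin> A"
proof
  assume "inverse (seed_pt T l) \<in> A"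
  then have "1 * monom_eval (seed_pt T) (sgl l (- 1)) \<in> A" by (simp add: power_int_minus)
  then have "0 \<le> lkp (sgl l (- 1 :: int)) l"
    using monom_A_nonneg[OF T l subring_set_1[OF K] one_neq_zero, of "sgl l (- 1)"] l by simp
  then show False by simp
qed

text \<open>\<open>monom_A_nonneg\<close> applies to both factors, and their exponents add up to
  that of \<open>x_l\<close>, which bounds them from above too. Frozen exponents stay unrestricted,
  since frozen variables are units of \<open>A\<close>.\<close>

lemma cluster_var_factors:
  assumes T: "T \<in> mutation_class S" and l: "l \<in> {1..n}"
    and ab: "a \<in> A" "b \<in> A" "a * b = seed_pt T l"
  obtains e c where "kys e \<subseteq> I" "c \<in> K" "inverse c \<in> K" "c \<noteq> 0" "a = c * monom_eval (seed_pt T) e"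
    "\<forall>j\<in>{1..n}. 0 \<le> lkp e j \<and> lkp e j \<le> (if j = l then 1 else 0)"
proof -
  note g = good_seed_class[OF K S T]
  have idx: "seed_idx T = I" using g by simp
  note nz = seed_pt_nz[OF g(1)]
  have "a \<in> laurent_ring K T" "b \<in> laurent_ring K T" using A_laurent_ring[OF T] ab by blast+
  then obtain p q where p: "p \<in> laurent_over K I" "a = laurent_eval (seed_pt T) p"
    and q: "q \<in> laurent_over K I" "b = laurent_eval (seed_pt T) q"
    unfolding idx[symmetric] by (elim laurent_ringE) blast
  have "laurent_eval (seed_pt T) (p * q) = laurent_eval (seed_pt T) (sgl (sgl l 1) 1)"
    using ab(3) p q by (simp add: laurent_eval_mult[OF nz])
  moreover have "sgl (sgl l 1) 1 \<in> laurent_over K I"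
    using l by (intro laurent_over_single[OF K] subring_set_1[OF K]) auto
  ultimately have "p * q = sgl (sgl l 1) 1"
    using good_seed_inj[OF K g(1), unfolded idx] laurent_over_mult[OF K p(1) q(1)] by blast
  then obtain d e where de: "sgl l 1 = d + e" "p = sgl d (lkp p d)" "q = sgl e (lkp q e)" "lkp p d * lkp q e = 1"
    using monomial_factors[of p q "sgl l 1" 1] by auto
  have c0: "lkp p d \<noteq> 0" "lkp q e \<noteq> 0" using de(4) by auto
  have cK: "lkp p d \<in> K" "lkp q e \<in> K" using p q by (auto simp: laurent_over_def)
  have ke: "kys d \<subseteq> I" "kys e \<subseteq> I"
    using p(1) q(1) c0 by (auto simp: laurent_over_def in_keys_iff)
  have a: "a = lkp p d * monom_eval (seed_pt T) d" unfolding p(2) by (subst de(2)) simp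
  have b: "b = lkp q e * monom_eval (seed_pt T) e" unfolding q(2) by (subst de(3)) simp
  have "0 \<le> lkp d j \<and> lkp d j \<le> (if j = l then 1 else 0)" if j: "j \<in> {1..n}" for j
  proof -
    have "0 \<le> lkp d j" by (rule monom_A_nonneg[OF T j cK(1) c0(1) ke(1)]) (use ab a in simp)
    moreover have "0 \<le> lkp e j" by (rule monom_A_nonneg[OF T j cK(2) c0(2) ke(2)]) (use ab b in simp)
    moreover have "lkp d j + lkp e j = (if j = l then 1 else 0)"
      using arg_cong[OF de(1), of "\<lambda>e. lkp e j"] by (simp add: lookup_add lookup_single when_def)
    ultimately show ?thesis by simp
  qed
  moreover have "inverse (lkp p d) = lkp q e" using de(4) by (rule inverse_unique)
  ultimately show thesis using that[of d "lkp p d"] ke cK c0 a by metis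
qed

text \<open>The exponent of \<open>x_l\<close> goes entirely to one factor. The other is a unit of
  \<open>K\<close> times a monomial in frozen variables.\<close>

lemma cluster_var_irreducible:
  assumes T: "T \<in> mutation_class S" and l: "l \<in> {1..n}"
    and ab: "a \<in> A" "b \<in> A" "a * b = seed_pt T l"
  shows "inverse a \<in> A \<or> inverse b \<in> A"
proof -
  note g = good_seed_class[OF K S T]
  note nz = seed_pt_nz[OF g(1)]
  obtain e c where e: "kys e \<subseteq> I" "c \<in> K" "inverse c \<in> K" "c \<noteq> 0" "a = c * monom_eval (seed_pt T) e"
    "\<And>j. j \<in> {1..n} \<Longrightarrow> 0 \<le> lkp e j \<and> lkp e j \<le> (if j = l then 1 else 0)"
    using cluster_var_factors[OF T l ab] by metis
  define b' where "b' = inverse c * monom_eval (seed_pt T) (sgl l 1 - e)"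
  have "monom_eval (seed_pt T) (sgl l 1) = monom_eval (seed_pt T) e * monom_eval (seed_pt T) (sgl l 1 - e)"
    using monom_eval_add[OF nz, of e "sgl l 1 - e"] by simp
  then have b: "b = b'"
    using ab(3) e(4,5) monom_eval_nonzero[OF nz, of e] by (simp add: b'_def field_simps)
  have inv: "inverse (d * monom_eval (seed_pt T) f) \<in> A"
    if "inverse d \<in> K" "kys f \<subseteq> I" "\<forall>j\<in>{1..n}. lkp f j = 0" for d f
  proof -
    have "monom_eval (seed_pt T) (- f) \<in> A"
      using that by (intro frozen_monom_A[OF T]) (simp_all add: keys_minus)
    then show ?thesis
      using that(1) K_A subring_set_mult[OF A] by (simp add: monom_eval_uminus[OF nz] subset_iff)
  qed
  have "lkp e l = 0 \<or> lkp e l = 1" using e(6)[OF l] by auto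
  then show ?thesis
  proof
    assume "lkp e l = 0"
    then have "\<forall>j\<in>{1..n}. lkp e j = 0" using e(6) by (metis order_antisym)
    then show ?thesis using inv[OF e(3,1)] e(5) by simp
  next
    assume "lkp e l = 1"
    then have "lkp (sgl l 1 - e) j = 0" if "j \<in> {1..n}" for j
      using e(6)[OF that] by (cases "j = l") (simp_all add: lookup_minus lookup_single when_def)
    then have "\<forall>j\<in>{1..n}. lkp (sgl l 1 - e) j = 0" by blast
    moreover have "kys (sgl l 1 - e) \<subseteq> I"
    proof -
      have "kys (sgl l 1 :: nat \<Rightarrow>\<^sub>0 int) \<union> kys e \<subseteq> I" using e(1) l by simp
      with keys_diff show ?thesis by (rule subset_trans)
    qed
    ultimately show ?thesis using inv[of "inverse c" "sgl l 1 - e"] e(2) b b'_def by simp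
  qed
qed

end

subsection \<open>Monomial substitutions\<close>

text \<open>The monomial substitution induced by \<open>h\<close>; a ring homomorphism when
  \<open>h\<close> is additive.\<close>

definition exponent_map :: "((nat \<Rightarrow>\<^sub>0 int) \<Rightarrow> nat \<Rightarrow>\<^sub>0 int) \<Rightarrow> 'f::field_char_0 laurent \<Rightarrow> 'f laurent" where
  "exponent_map h p = (\<Sum>e\<in>kys p. sgl (h e) (lkp p e))"

lemma exponent_map_superset:
  "finite B \<Longrightarrow> kys p \<subseteq> B \<Longrightarrow> exponent_map h p = (\<Sum>e\<in>B. sgl (h e) (lkp p e))"
  unfolding exponent_map_def by (rule sum.mono_neutral_left) (auto simp: in_keys_iff)

lemma exponent_map_single [simp]: "exponent_map h (sgl e c) = sgl (h e) c"
  by (cases "c = 0") (simp_all add: exponent_map_def)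

lemma exponent_map_0 [simp]: "exponent_map h 0 = 0"
  by (simp add: exponent_map_def)

lemma exponent_map_add: "exponent_map h (p + q) = exponent_map h p + exponent_map h q"
proof -
  have "exponent_map h (p + q) = (\<Sum>e\<in>kys p \<union> kys q. sgl (h e) (lkp (p + q) e))"
    using keys_add[of p q] by (intro exponent_map_superset) auto
  then show ?thesis
    by (simp add: exponent_map_superset[of "kys p \<union> kys q"] lookup_add single_add sum.distrib)
qed

lemma exponent_map_mult:
  assumes h: "\<And>e e'. h (e + e') = h e + h e'"
  shows "exponent_map h (p * q) = exponent_map h p * exponent_map h q"
proof (induction p rule: poly_mapping_add_induct)
  case (single e c)
  show ?case
    by (induction q rule: poly_mapping_add_induct)
       (simp_all add: exponent_map_add ring_distribs mult_single h)
qed (simp_all add: exponent_map_add ring_distribs)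

lemma exponent_map_sum: "exponent_map h (sum f B) = (\<Sum>b\<in>B. exponent_map h (f b))"
  by (induction B rule: infinite_finite_induct) (simp_all add: exponent_map_add)

lemma exponent_map_exponent_map:
  "exponent_map h (exponent_map h' p) = (\<Sum>e\<in>kys p. sgl (h (h' e)) (lkp p e))"
  unfolding exponent_map_def[of h' p] exponent_map_sum by simp

lemma keys_exponent_map: "kys (exponent_map h p) \<subseteq> h ` kys p"
proof
  fix e assume "e \<in> kys (exponent_map h p)"
  then have "(\<Sum>e'\<in>kys p. lkp (sgl (h e') (lkp p e')) e) \<noteq> 0"
    by (simp add: in_keys_iff exponent_map_def lookup_sum)
  then obtain e' where "e' \<in> kys p" "lkp (sgl (h e') (lkp p e')) e \<noteq> 0"
    by (rule sum.not_neutral_contains_not_neutral)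
  then show "e \<in> h ` kys p" by (auto simp: lookup_single when_def split: if_splits)
qed

lemma exponent_map_over:
  assumes K: "subring_set K" and p: "p \<in> laurent_over K I" and h: "\<And>e. e \<in> kys p \<Longrightarrow> kys (h e) \<subseteq> J"
  shows "exponent_map h p \<in> laurent_over K J"
  unfolding exponent_map_def
  using p h by (intro laurent_over_sum laurent_over_single K) (auto simp: laurent_over_def)


subsection \<open>Primality of the \<open>F\<close>-polynomial\<close>

locale non_initial_cluster_var = principal_seed K S
  for K :: "'f::field_char_0 set" and S :: "'f seed" +
  fixes T :: "'f seed" and l :: nat
  assumes factorial: "factorial_domain (subring_of (cluster_algebra K S))"
    and T: "T \<in> mutation_class S" and l: "l \<in> {1..seed_n S}"
    and non_initial: "seed_pt T l \<notin> exchangeable_vars S"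
begin

abbreviation "z \<equiv> seed_pt T l"
abbreviation "p \<equiv> laurent_lift S z"
abbreviation "\<phi> \<equiv> laurent_eval (seed_pt S)"
abbreviation "LK \<equiv> laurent_over K I"

lemma nz: "\<forall>i. seed_pt S i \<noteq> 0"
  by (rule seed_pt_nz[OF S])

lemma z_nonzero: "z \<noteq> 0"
  using seed_pt_nz[OF good_seed_class(1)[OF K S T]] by blast

lemma p: "p \<in> LK" "\<phi> p = z"
  using laurent_lift[OF S_Ints T] laurent_over_mono[OF subring_set_Ints[OF K] order_refl] by blast+

lemma p_nonzero: "p \<noteq> 0"
  by (rule laurent_lift_nonzero[OF S_Ints T])

lemma \<phi>_inj: "a \<in> LK \<Longrightarrow> b \<in> LK \<Longrightarrow> \<phi> a = \<phi> b \<Longrightarrow> a = b"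
  by (rule good_seed_inj[OF K S])

lemma p_regular:
  assumes "j \<in> I" "j \<notin> {1..n}"
  shows "regular_at j p" "\<exists>k>0. eval_at_zero j p = of_int k"
proof -
  have lI: "l \<in> I" using l by simp
  have "l \<noteq> j" using assms l by blast
  then show "regular_at j p" "\<exists>k>0. eval_at_zero j p = of_int k"
    using bspec[OF laurent_lift_regular[OF S_Ints assms T] lI] by auto
qed

lemma z_not_dvd_initial:
  assumes i: "i \<in> {1..n}" and r: "r \<in> A" "seed_pt S i = z * r"
  shows False
proof -
  have S0: "S \<in> mutation_class S" by (rule mutation_class.initial)
  note g = good_seed_class[OF K S T]
  obtain e c where e: "kys e \<subseteq> I" and c: "c \<in> K" "inverse c \<in> K" "c \<noteq> 0" and z: "z = c * monom_eval (seed_pt S) e"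
    and bd: "\<forall>j\<in>{1..n}. 0 \<le> lkp e j \<and> lkp e j \<le> (if j = i then 1 else 0)"
    using cluster_var_factors[OF S0 i cluster_var_A[OF T l] r(1) r(2)[symmetric]] by metis
  have pe: "p = sgl e c"
  proof (rule \<phi>_inj)
    show "sgl e c \<in> LK" by (rule laurent_over_single[OF K c(1) e])
    show "\<phi> p = \<phi> (sgl e c)" using p(2) z by simp
  qed (rule p(1))
  have fr: "lkp e j = 0 \<and> (\<exists>k>0. c = of_int k)" if j: "j \<in> I" "j \<notin> {1..n}" for j
  proof -
    obtain k :: int where "k > 0" "eval_at_zero j p = of_int k" using p_regular(2)[OF j] by blast
    then show ?thesis unfolding pe eval_at_zero_single by (auto split: if_splits)
  qed
  have out: "lkp e j = 0" if "j \<notin> I" for j using that e by (auto simp: in_keys_iff)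
  \<comment> \<open>Principal coefficients guarantee a frozen variable, at which the specialization
    shows that \<open>c\<close> is an integer.\<close>
  have "n + i \<in> I" "n + i \<notin> {1..n}" using i principal by (simp_all add: principal_coefficients_def)
  then obtain k :: int where k: "k > 0" "c = of_int k" using fr by blast
  have other: "lkp e j = 0" if "j \<noteq> i" for j
  proof (cases "j \<in> {1..n}")
    case True
    then show ?thesis using bspec[OF bd True] that by simp
  next
    case False
    then show ?thesis using fr[of j] out[of j] by blast
  qed
  have "lkp e i \<noteq> 0"
  proof
    assume "lkp e i = 0"
    then have "lkp e j = 0" for j using other[of j] by (cases "j = i") simp_all
    then have "e = 0" by (intro poly_mapping_eqI) simp
    then have "inverse z = inverse c" using z by simp
    then show False using cluster_var_not_unit[OF T l] c(2) K_A by auto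
  qed
  then have "lkp e i = 1" using bspec[OF bd i] by simp
  then have "lkp e j = lkp (sgl i 1) j" for j
    using other[of j] by (cases "j = i") (simp_all add: lookup_single when_def)
  then have "e = sgl i 1" by (rule poly_mapping_eqI)
  then have zc: "z = c * seed_pt S i" using z by simp
  \<comment> \<open>The Laurent phenomenon in the opposite direction: the expansion of
    \<open>x_i\<close> in the seed \<open>T\<close> is \<open>z / c\<close>, and its coefficient
    must be an integer.\<close>
  have "seed_pt S i \<in> laurent_ring \<int> T"
    by (rule laurent_phenomenon[OF subring_set_Ints_self S_Ints T S0])
  then obtain a where a: "a \<in> laurent_over \<int> (seed_idx T)" "seed_pt S i = laurent_eval (seed_pt T) a"
    by (rule laurent_ringE)
  have "a = sgl (sgl l 1) (inverse c)"
  proof (rule good_seed_inj[OF K g(1)])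
    show "a \<in> laurent_over K (seed_idx T)"
      using a(1) laurent_over_mono[OF subring_set_Ints[OF K] order_refl] by blast
    show "sgl (sgl l 1) (inverse c) \<in> laurent_over K (seed_idx T)"
      using l g(2) by (intro laurent_over_single[OF K c(2)]) simp
    show "laurent_eval (seed_pt T) a = laurent_eval (seed_pt T) (sgl (sgl l 1) (inverse c))"
      using a(2) zc c(3) by simp
  qed
  then have "lkp a (sgl l 1) = inverse c" by simp
  moreover have "lkp a (sgl l 1) \<in> \<int>" using a(1) unfolding laurent_over_def by blast
  ultimately have "inverse c \<in> \<int>" by simp
  then obtain k' :: int where "inverse c = of_int k'" by (elim Ints_cases)
  then have "of_int (k * k') = (1 :: 'f)" using k c(3) by (metis of_int_mult right_inverse)
  then have "k * k' = 1" using of_int_eq_1_iff by blast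
  then have "k = 1" using k(1) by (simp add: zmult_eq_1_iff)
  then have "z = seed_x S i" using zc k(2) seed_pt_exchangeable[OF S0 i] by simp
  then show False using non_initial i by (simp add: exchangeable_vars_def)
qed

lemma z_prime_A:
  assumes "a \<in> A" "b \<in> A" "q \<in> A" "a * b = z * q"
  shows "(\<exists>r\<in>A. a = z * r) \<or> (\<exists>r\<in>A. b = z * r)"
  using factorial cluster_var_A[OF T l] z_nonzero cluster_var_not_unit[OF T l] cluster_var_irreducible[OF T l] assms
  by (rule factorial_irreducible_dvd)

definition D :: 'f where "D = (\<Prod>i\<in>{1..n}. seed_pt S i)"

lemma D_nonzero: "D \<noteq> 0"
  using nz by (simp add: D_def)

lemma prod_initial_A: "B \<subseteq> {1..n} \<Longrightarrow> (\<Prod>i\<in>B. seed_pt S i) \<in> A"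
  using cluster_var_A[OF mutation_class.initial] by (intro subring_set_prod[OF A]) blast

lemma D_A: "D \<in> A"
  unfolding D_def by (rule prod_initial_A) simp

lemma z_not_dvd_one: "r \<in> A \<Longrightarrow> 1 \<noteq> z * r"
  using cluster_var_not_unit[OF T l] inverse_unique[of z r] by auto

text \<open>Primality of \<open>z\<close> in \<open>A\<close> strips off the initial variables one
  at a time.\<close>

lemma z_not_dvd_D_power:
  assumes "r \<in> A"
  shows "D ^ N \<noteq> z * r"
  using assms
proof (induction N arbitrary: r)
  case 0
  then show ?case using z_not_dvd_one by simp
next
  case (Suc N)
  have prods: "\<forall>r\<in>A. (\<Prod>i\<in>B. seed_pt S i) \<noteq> z * r" if "finite B" "B \<subseteq> {1..n}" for B
    using that
  proof (induction B rule: finite_induct)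
    case empty
    then show ?case using z_not_dvd_one by simp
  next
    case (insert i B)
    show ?case
    proof (intro ballI notI)
      fix r assume r: "r \<in> A" "(\<Prod>i\<in>insert i B. seed_pt S i) = z * r"
      have i: "i \<in> {1..n}" and B: "B \<subseteq> {1..n}" using insert.prems by simp_all
      have "seed_pt S i * (\<Prod>i\<in>B. seed_pt S i) = z * r" using r insert.hyps by simp
      from z_prime_A[OF cluster_var_A[OF mutation_class.initial i] prod_initial_A[OF B] r(1) this]
      show False using z_not_dvd_initial[OF i] insert.IH[OF B] by blast
    qed
  qed
  show ?case
  proof
    assume "D ^ Suc N = z * r"
    then have "D * D ^ N = z * r" by simp
    from z_prime_A[OF D_A subring_set_power[OF A D_A] Suc.prems this]
    show False using prods[of "{1..n}"] Suc.IH unfolding D_def by auto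
  qed
qed

lemma clear_to_A:
  assumes "a \<in> LK"
  obtains N where "D ^ N * \<phi> a \<in> A"
proof (rule clear_denominators[OF A K_A D_A _ _ assms, of "seed_pt S"])
  fix i assume i: "i \<in> I"
  show "seed_pt S i \<in> A"
    using cluster_var_A[OF mutation_class.initial, of i] frozen_A(1)[OF i] by blast
  show "D * inverse (seed_pt S i) \<in> A"
  proof (cases "i \<in> {1..n}")
    case True
    then have "D = seed_pt S i * (\<Prod>i\<in>{1..n} - {i}. seed_pt S i)" unfolding D_def by (simp add: prod.remove)
    then have "D * inverse (seed_pt S i) = (\<Prod>i\<in>{1..n} - {i}. seed_pt S i)" using nz by simp
    then show ?thesis using prod_initial_A[of "{1..n} - {i}"] by auto
  next
    case False
    then show ?thesis using frozen_A(2)[OF i] D_A subring_set_mult[OF A] by blast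
  qed
qed

lemma dvd_from_A:
  assumes a: "a \<in> LK" and r: "r \<in> A" "D ^ N * \<phi> a = z * r"
  shows "\<exists>q\<in>LK. a = p * q"
proof -
  note R = subring_laurent_ring[OF K S]
  have "inverse D \<in> laurent_ring K S"
    unfolding D_def prod_inversef[symmetric] o_def
    by (intro subring_set_prod[OF R] laurent_ring_inverse_var[OF K S])
  then have "r * inverse D ^ N \<in> laurent_ring K S"
    using r(1) A_laurent_ring[OF mutation_class.initial] subring_set_mult[OF R] subring_set_power[OF R] by blast
  then obtain q where q: "q \<in> LK" "r * inverse D ^ N = \<phi> q" by (rule laurent_ringE)
  have "\<phi> a = z * (r * inverse D ^ N)" using r(2) D_nonzero by (simp add: field_simps)
  then have "\<phi> a = \<phi> (p * q)" using q p by (simp add: laurent_eval_mult[OF nz])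
  then have "a = p * q" by (rule \<phi>_inj[OF a laurent_over_mult[OF K p(1) q(1)]])
  then show ?thesis using q(1) by blast
qed

text \<open>A prime that divides no power of \<open>D\<close> stays prime after inverting
  \<open>D\<close>.\<close>

lemma p_prime:
  assumes a: "a \<in> LK" and b: "b \<in> LK" and q: "q \<in> LK" and eq: "a * b = p * q"
  shows "(\<exists>r\<in>LK. a = p * r) \<or> (\<exists>r\<in>LK. b = p * r)"
proof -
  obtain N1 where N1: "D ^ N1 * \<phi> a \<in> A" using clear_to_A[OF a] .
  obtain N2 where N2: "D ^ N2 * \<phi> b \<in> A" using clear_to_A[OF b] .
  obtain N3 where N3: "D ^ N3 * \<phi> q \<in> A" using clear_to_A[OF q] .
  have pw: "D ^ k \<in> A" for k by (rule subring_set_power[OF A D_A])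
  have "\<phi> a * \<phi> b = z * \<phi> q"
    using arg_cong[OF eq, of \<phi>] p(2) by (simp add: laurent_eval_mult[OF nz])
  \<comment> \<open>The power of \<open>D\<close> needed by \<open>q\<close> is attached to the
    factor of \<open>b\<close>; a second use of primality removes it again.\<close>
  moreover have "(D ^ N1 * \<phi> a) * (D ^ N2 * \<phi> b * D ^ N3) = D ^ N1 * D ^ N2 * D ^ N3 * (\<phi> a * \<phi> b)"
    by (simp add: mult_ac)
  ultimately have "(D ^ N1 * \<phi> a) * (D ^ N2 * \<phi> b * D ^ N3) = z * (D ^ N1 * D ^ N2 * (D ^ N3 * \<phi> q))"
    by (simp add: mult_ac)
  moreover have "D ^ N2 * \<phi> b * D ^ N3 \<in> A" "D ^ N1 * D ^ N2 * (D ^ N3 * \<phi> q) \<in> A"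
    using N2 N3 pw subring_set_mult[OF A] by blast+
  ultimately have "(\<exists>r\<in>A. D ^ N1 * \<phi> a = z * r) \<or> (\<exists>r\<in>A. D ^ N2 * \<phi> b * D ^ N3 = z * r)"
    using z_prime_A[OF N1] by blast
  then show ?thesis
  proof
    assume "\<exists>r\<in>A. D ^ N1 * \<phi> a = z * r"
    then show ?thesis using dvd_from_A[OF a] by blast
  next
    assume "\<exists>r\<in>A. D ^ N2 * \<phi> b * D ^ N3 = z * r"
    then obtain r where "r \<in> A" "D ^ N2 * \<phi> b * D ^ N3 = z * r" by blast
    then have "\<exists>r\<in>A. D ^ N2 * \<phi> b = z * r"
      using z_prime_A[OF N2 pw] z_not_dvd_D_power by blast
    then show ?thesis using dvd_from_A[OF b] by blast
  qed
qed

lemma p_not_unit: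
  assumes q: "q \<in> LK"
  shows "p * q \<noteq> 1"
proof
  assume "p * q = 1"
  from arg_cong[OF this, of \<phi>] have 1: "z * \<phi> q = 1" using p(2) by (simp add: laurent_eval_mult[OF nz])
  obtain N where N: "D ^ N * \<phi> q \<in> A" using clear_to_A[OF q] .
  have "D ^ N = z * (D ^ N * \<phi> q)" using 1 by (simp add: mult.left_commute)
  then show False using z_not_dvd_D_power[OF N] by blast
qed

section \<open>Passing between \<open>z\<close> and its \<open>F\<close>-polynomial\<close>

definition J :: "nat set" where "J = {n + 1..n + seed_m S}"

lemma J_iff: "j \<in> J \<longleftrightarrow> j \<in> I \<and> j \<notin> {1..n}"
  by (auto simp: J_def)

lemma J_finite: "finite J" and J_I: "J \<subseteq> I"
  by (auto simp: J_def)

text \<open>The substitutions \<open>x_i \<mapsto> 1\<close> and \<open>y_j \<mapsto> y_j \<Prod>\<^sub>i x_i\<^sup>b\<^sup>i\<^sup>j\<close>, on exponents.\<close>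

definition specialize :: "(nat \<Rightarrow>\<^sub>0 int) \<Rightarrow> nat \<Rightarrow>\<^sub>0 int" where
  "specialize e = expo J (lkp e)"

definition homogenize :: "(nat \<Rightarrow>\<^sub>0 int) \<Rightarrow> nat \<Rightarrow>\<^sub>0 int" where
  "homogenize e = expo I (\<lambda>i. if i \<in> {1..n} then \<Sum>j\<in>{1..n}. seed_B S i j * lkp e (n + j) else lkp e i)"

lemma lookup_specialize: "lkp (specialize e) i = (if i \<in> J then lkp e i else 0)"
  by (simp add: specialize_def lookup_expo[OF J_finite])

lemma lookup_homogenize: "lkp (homogenize e) i =
    (if i \<in> {1..n} then \<Sum>j\<in>{1..n}. seed_B S i j * lkp e (n + j) else if i \<in> I then lkp e i else 0)"
  unfolding homogenize_def lookup_expo[OF finite_atLeastAtMost] by simp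

lemma specialize_add: "specialize (e + e') = specialize e + specialize e'"
  by (rule poly_mapping_eqI) (simp add: lookup_specialize lookup_add)

lemma homogenize_add: "homogenize (e + e') = homogenize e + homogenize e'"
  by (rule poly_mapping_eqI) (simp add: lookup_homogenize lookup_add algebra_simps sum.distrib)

lemma keys_specialize: "kys (specialize e) \<subseteq> J"
  unfolding specialize_def by (rule keys_expo[OF J_finite])

lemma keys_homogenize: "kys (homogenize e) \<subseteq> I"
  unfolding homogenize_def by (rule keys_expo) simp

lemma specialize_homogenize:
  assumes "kys e \<subseteq> J"
  shows "specialize (homogenize e) = e"
proof (rule poly_mapping_eqI)
  fix i
  show "lkp (specialize (homogenize e)) i = lkp e i"
  proof (cases "i \<in> J")
    case True
    then have "i \<in> I" "i \<notin> {1..n}" using J_iff by blast+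
    then show ?thesis using True unfolding lookup_specialize lookup_homogenize by presburger
  next
    case False
    then have "lkp e i = 0" using assms by (metis in_keys_iff subsetD)
    then show ?thesis using False by (simp add: lookup_specialize)
  qed
qed

definition F :: "'f laurent" where "F = exponent_map specialize p"

text \<open>Constancy of the principal degrees \<open>d\<close> on the support of \<open>p\<close>
  recovers the exponents of the \<open>x_i\<close> from those of the \<open>y_j\<close>, up to the
  common shift \<open>g = - d\<close>. The vector \<open>d\<close> is the g-vector of
  \<open>z\<close>.\<close>

lemma homogenize_F:
  obtains g where "exponent_map homogenize F = sgl g 1 * p" "kys g \<subseteq> {1..n}"
proof -
  have "\<exists>d. \<forall>e\<in>kys p. principal_degree S r e = d" if r: "r \<in> {1..n}" for r
  proof -
    have "l \<in> I" using l by simp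
    then show ?thesis using laurent_lift_homogeneous[OF S_Ints principal r T] by blast
  qed
  then obtain d where d: "\<And>r e. r \<in> {1..n} \<Longrightarrow> e \<in> kys p \<Longrightarrow> principal_degree S r e = d r" by metis
  define g where "g = expo {1..n} (\<lambda>r. - d r)"
  have lg: "lkp g i = (if i \<in> {1..n} then - d i else 0)" for i
    unfolding g_def by (rule lookup_expo) simp
  have hs: "homogenize (specialize e) = g + e" if e: "e \<in> kys p" for e
  proof (rule poly_mapping_eqI)
    fix i
    consider "i \<in> {1..n}" | "i \<in> I" "i \<notin> {1..n}" | "i \<notin> I" "i \<notin> {1..n}" by blast
    then show "lkp (homogenize (specialize e)) i = lkp (g + e) i"
    proof cases
      case 1
      have "(\<Sum>j\<in>{1..n}. seed_B S i j * lkp (specialize e) (n + j)) = (\<Sum>j\<in>{1..n}. seed_B S i j * lkp e (n + j))"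
        using principal by (intro sum.cong) (simp_all add: lookup_specialize J_def principal_coefficients_def)
      also have "\<dots> = lkp e i - d i" using d[OF 1 e] unfolding principal_degree_def by linarith
      finally show ?thesis unfolding lookup_homogenize lookup_add lg using 1 by (simp del: One_nat_def)
    next
      case 2
      then show ?thesis unfolding lookup_homogenize lookup_add lg lookup_specialize J_iff by presburger
    next
      case 3
      have "kys e \<subseteq> I" using p(1) e by (simp add: laurent_over_def)
      with 3 have "lkp e i = 0" by (metis in_keys_iff subsetD)
      then show ?thesis using 3 unfolding lookup_homogenize lookup_add lg by presburger
    qed
  qed
  have "exponent_map homogenize F = (\<Sum>e\<in>kys p. sgl (g + e) (lkp p e))"
    unfolding F_def exponent_map_exponent_map by (rule sum.cong) (simp_all add: hs)
  also have "\<dots> = sgl g 1 * (\<Sum>e\<in>kys p. sgl e (lkp p e))" by (simp add: sum_distrib_left mult_single)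
  also have "\<dots> = sgl g 1 * p" by (simp flip: poly_mapping_sum_single)
  finally show thesis using that[of g] keys_expo[of "{1..n}"] by (simp add: g_def)
qed

text \<open>The polynomial ring \<open>K[y]\<close>, kept inside the formal Laurent polynomials so
  that both substitutions act on one type.\<close>

definition KY :: "'f laurent set" where
  "KY = {a \<in> laurent_over K J. \<forall>j\<in>J. regular_at j a}"

lemma KY_LK: "a \<in> KY \<Longrightarrow> a \<in> LK"
  using laurent_over_mono[OF order_refl J_I] by (auto simp: KY_def)

lemma F_KY: "F \<in> KY"
proof -
  have "F \<in> laurent_over K J"
    unfolding F_def by (rule exponent_map_over[OF K p(1)]) (rule keys_specialize)
  moreover have "regular_at j F" if j: "j \<in> J" for j
    unfolding regular_at_def
  proof
    fix e assume "e \<in> kys F"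
    then obtain e' where "e' \<in> kys p" "e = specialize e'" using keys_exponent_map unfolding F_def by blast
    then show "0 \<le> lkp e j" using p_regular(1)[of j] j by (simp add: lookup_specialize regular_at_def J_iff)
  qed
  ultimately show ?thesis by (simp add: KY_def)
qed

lemma exponent_map_specialize_homogenize: "exponent_map specialize (exponent_map homogenize a) = a" if "a \<in> laurent_over K J"
proof -
  have "exponent_map specialize (exponent_map homogenize a) = (\<Sum>e\<in>kys a. sgl e (lkp a e))"
    unfolding exponent_map_exponent_map
    using that by (intro sum.cong refl) (simp add: specialize_homogenize laurent_over_def)
  then show ?thesis by (simp flip: poly_mapping_sum_single)
qed

lemma F_nonzero: "F \<noteq> 0"
proof
  assume "F = 0"
  obtain g where "exponent_map homogenize F = sgl g 1 * p" by (rule homogenize_F)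
  then have "sgl g 1 * p = 0" using \<open>F = 0\<close> by simp
  then have "sgl g (1 :: 'f) = 0" using p_nonzero by simp
  then show False by (metis lookup_single_eq lookup_zero zero_neq_one)
qed

text \<open>Homogenization leaves the exponent of \<open>y_j\<close> alone and \<open>g\<close>
  involves no frozen index, so if all terms of \<open>F\<close> contained \<open>y_j\<close>, those
  of \<open>p\<close> would too. That contradicts the positive value of \<open>p\<close> at
  \<open>y_j = 0\<close>.\<close>

lemma F_not_divisible:
  assumes j: "j \<in> J"
  shows "homog_part (\<lambda>e. lkp e j) 0 F \<noteq> 0"
proof
  assume 0: "homog_part (\<lambda>e. lkp e j) 0 F = 0"
  have jI: "j \<in> I" "j \<notin> {1..n}" using j J_iff by blast+
  obtain g where g: "exponent_map homogenize F = sgl g 1 * p" "kys g \<subseteq> {1..n}" by (rule homogenize_F)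
  have gj: "lkp g j = 0" using g(2) jI by (auto simp: in_keys_iff)
  have "lkp e j \<noteq> 0" if e: "e \<in> kys F" for e
  proof
    assume "lkp e j = 0"
    then have "e \<in> kys (homog_part (\<lambda>e. lkp e j) 0 F)" using e by (simp add: keys_homog_part)
    then show False using 0 by simp
  qed
  then have "lkp e j \<noteq> 0" if e: "e \<in> kys (sgl g 1 * p)" for e
  proof -
    obtain e' where "e' \<in> kys F" "e = homogenize e'"
      using e keys_exponent_map[of homogenize F] unfolding g(1) by blast
    moreover have "lkp (homogenize e') j = lkp e' j" using jI unfolding lookup_homogenize by presburger
    ultimately show ?thesis using \<open>\<And>e. e \<in> kys F \<Longrightarrow> lkp e j \<noteq> 0\<close> by simp
  qed
  then have "homog_part (\<lambda>e. lkp e j) 0 (sgl g 1 * p) = 0" by (intro homog_part_eq_0)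
  moreover have "homog_part (\<lambda>e. lkp e j) (0 + 0) (sgl g 1 * p) = sgl g 1 * homog_part (\<lambda>e. lkp e j) 0 p"
    by (rule homog_part_mult_homog) (simp_all add: lookup_add gj split: if_splits)
  ultimately have "sgl g 1 * homog_part (\<lambda>e. lkp e j) 0 p = 0" by simp
  moreover have "sgl g (1 :: 'f) \<noteq> 0" by (metis lookup_single_eq lookup_zero zero_neq_one)
  ultimately have "eval_at_zero j p = 0" by (simp add: eval_at_zero_def)
  then show False using p_regular(2)[OF jI] by auto
qed

lemma homogenize_over: "a \<in> KY \<Longrightarrow> exponent_map homogenize a \<in> LK"
  using exponent_map_over[OF K, of a J homogenize I] keys_homogenize by (simp add: KY_def)

text \<open>Setting the \<open>x_i\<close> to 1 yields a quotient that is only Laurent in the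
  \<open>y_j\<close>. It is a polynomial because \<open>F\<close> is divisible by no
  \<open>y_j\<close>.\<close>

lemma F_dvd:
  assumes a: "a \<in> KY" and q: "q \<in> LK" "exponent_map homogenize a = p * q"
  shows "\<exists>r\<in>KY. a = F * r"
proof -
  define r where "r = exponent_map specialize q"
  have "a \<in> laurent_over K J" using a by (simp add: KY_def)
  then have "a = exponent_map specialize (p * q)" by (simp only: q(2)[symmetric] exponent_map_specialize_homogenize)
  also have "\<dots> = F * r" unfolding F_def r_def by (rule exponent_map_mult[OF specialize_add])
  finally have eq: "a = F * r" .
  have "r \<in> laurent_over K J"
    unfolding r_def by (rule exponent_map_over[OF K q(1)]) (rule keys_specialize)
  moreover have "regular_at j r" if j: "j \<in> J" for j
  proof (rule regular_at_factor[OF _ F_not_divisible[OF j]])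
    show "regular_at j F" using F_KY j unfolding KY_def by blast
    show "regular_at j (F * r)" using a j unfolding eq KY_def by blast
  qed
  ultimately have "r \<in> KY" unfolding KY_def by blast
  then show ?thesis using eq by blast
qed

lemma F_prime:
  assumes a: "a \<in> KY" and b: "b \<in> KY" and q: "q \<in> KY" and eq: "a * b = F * q"
  shows "(\<exists>r\<in>KY. a = F * r) \<or> (\<exists>r\<in>KY. b = F * r)"
proof -
  obtain g where g: "exponent_map homogenize F = sgl g 1 * p" "kys g \<subseteq> {1..n}" by (rule homogenize_F)
  note mult = exponent_map_mult[OF homogenize_add]
  have "exponent_map homogenize a * exponent_map homogenize b = p * (sgl g 1 * exponent_map homogenize q)"
    using arg_cong[OF eq, of "exponent_map homogenize"] g(1) by (simp add: mult mult_ac)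
  moreover have "sgl g 1 * exponent_map homogenize q \<in> LK"
  proof (intro laurent_over_mult laurent_over_single K subring_set_1 homogenize_over q)
    show "kys g \<subseteq> I" using g(2) by auto
  qed
  ultimately have "(\<exists>r\<in>LK. exponent_map homogenize a = p * r) \<or> (\<exists>r\<in>LK. exponent_map homogenize b = p * r)"
    using p_prime[OF homogenize_over[OF a] homogenize_over[OF b]] by blast
  then show ?thesis using F_dvd a b by blast
qed

lemma F_not_unit:
  assumes q: "q \<in> KY"
  shows "F * q \<noteq> 1"
proof
  assume 1: "F * q = 1"
  obtain g where g: "exponent_map homogenize F = sgl g 1 * p" "kys g \<subseteq> {1..n}" by (rule homogenize_F)
  have "homogenize 0 = 0" using homogenize_add[of 0 0] by simp
  then have one: "exponent_map homogenize 1 = (1 :: 'f laurent)"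
    using exponent_map_single[of homogenize 0 "1 :: 'f"] by simp
  have "p * (sgl g 1 * exponent_map homogenize q) = exponent_map homogenize (F * q)"
    unfolding exponent_map_mult[OF homogenize_add] g(1) by (simp add: mult_ac)
  then have "p * (sgl g 1 * exponent_map homogenize q) = 1" unfolding 1 one .
  moreover have "sgl g 1 * exponent_map homogenize q \<in> LK"
  proof (intro laurent_over_mult laurent_over_single K subring_set_1 homogenize_over q)
    show "kys g \<subseteq> I" using g(2) by auto
  qed
  ultimately show False using p_not_unit by blast
qed

lemma F_polynomial_eq: "F_polynomial K S z = \<phi> F"
proof -
  let ?y = "\<lambda>i. if i \<in> {1..n} then 1 else seed_x S i"
  let ?P = "\<lambda>q. (\<forall>e. lkp q e \<in> K) \<and> (\<forall>e\<in>kys q. kys e \<subseteq> I \<and> (\<forall>j\<in>{n + 1..n + seed_m S}. 0 \<le> lkp e j)) \<and>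
      laurent_eval (seed_x S) q = z"
  have ev: "laurent_eval (seed_x S) q = \<phi> q" if "q \<in> LK" for q
    using that by (rule laurent_eval_cong) (simp add: seed_pt_def)
  have P: "?P q \<longleftrightarrow> q = p" for q
  proof
    assume q: "?P q"
    then have "q \<in> LK" by (auto simp: laurent_over_def)
    then show "q = p" using \<phi>_inj p ev q by metis
  next
    assume q: "q = p"
    have "\<forall>j\<in>{n + 1..n + seed_m S}. regular_at j p" using p_regular(1) J_iff J_def by blast
    moreover have "laurent_eval (seed_x S) p = z" using ev[OF p(1)] p(2) by (rule trans)
    ultimately show "?P q"
      using p(1) unfolding q laurent_over_def regular_at_def by blast
  qed
  have "\<phi> F = (\<Sum>e\<in>kys p. lkp p e * monom_eval (seed_pt S) (specialize e))"
    by (simp add: F_def exponent_map_def laurent_eval_sum)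
  also have "\<dots> = laurent_eval ?y p"
    unfolding laurent_eval_alt
  proof (intro sum.cong refl arg_cong2[of _ _ _ _ "(*)"])
    fix e assume "e \<in> kys p"
    then have e: "kys e \<subseteq> I" using p(1) by (simp add: laurent_over_def)
    have "monom_eval ?y e = (\<Prod>i\<in>I. ?y i powi lkp e i)"
      using e by (intro monom_eval_superset) simp_all
    also have "\<dots> = (\<Prod>i\<in>J. seed_pt S i powi lkp e i)"
    proof (rule prod.mono_neutral_cong_right)
      show "\<And>i. i \<in> J \<Longrightarrow> ?y i powi lkp e i = seed_pt S i powi lkp e i"
        using J_iff by (simp add: seed_pt_def)
      show "\<forall>i\<in>I - J. ?y i powi lkp e i = 1" using J_iff by (simp del: One_nat_def)
    qed (use J_I in simp_all)
    also have "\<dots> = monom_eval (seed_pt S) (specialize e)"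
      by (simp add: specialize_def monom_eval_expo[OF J_finite])
    finally show "monom_eval (seed_pt S) (specialize e) = monom_eval ?y e" ..
  qed
  finally have w: "\<phi> F = laurent_eval ?y p" .
  have "F_polynomial K S z = (THE w. \<exists>q. ?P q \<and> w = laurent_eval ?y q)"
    unfolding F_polynomial_def by (simp only: conj_assoc)
  also have "\<dots> = laurent_eval ?y p" unfolding P by simp
  finally show ?thesis using w by simp
qed

section \<open>Transfer from formal polynomials to the subring \<open>K[y]\<close> of the
  field\<close>

lemma KY_1: "1 \<in> KY"
  by (simp add: KY_def laurent_over_1[OF K] eval_at_zero_1)

lemma KY_mult: "a \<in> KY \<Longrightarrow> b \<in> KY \<Longrightarrow> a * b \<in> KY"
  by (simp add: KY_def laurent_over_mult[OF K] eval_at_zero_mult)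

lemma KY_subring: "subring_set (\<phi> ` KY)"
  unfolding subring_set_def
proof (intro conjI ballI)
  show "1 \<in> \<phi> ` KY" using KY_1 by (rule rev_image_eqI) simp
next
  fix a b assume "a \<in> \<phi> ` KY" "b \<in> \<phi> ` KY"
  then obtain a' b' where a: "a' \<in> KY" "a = \<phi> a'" and b: "b' \<in> KY" "b = \<phi> b'" by blast
  have "regular_at j (- b')" if "j \<in> J" for j
    using b(1) that by (simp add: KY_def regular_at_def keys_minus)
  then have "a' + - b' \<in> KY"
    using a(1) b(1) by (simp only: KY_def mem_Collect_eq)
      (intro conjI ballI laurent_over_add[OF K] laurent_over_uminus[OF K] regular_at_add; blast)
  then show "a - b \<in> \<phi> ` KY"
    by (rule rev_image_eqI) (simp add: a b laurent_eval_diff)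
  show "a * b \<in> \<phi> ` KY" using KY_mult[OF a(1) b(1)] by (rule rev_image_eqI) (simp add: a b laurent_eval_mult[OF nz])
qed

lemma adjoin_frozen: "adjoin K (frozen_vars S) = \<phi> ` KY"
proof
  show "adjoin K (frozen_vars S) \<subseteq> \<phi> ` KY"
  proof (rule adjoin_least[OF KY_subring])
    show "K \<subseteq> \<phi> ` KY"
    proof
      fix c assume "c \<in> K"
      then have "sgl 0 c \<in> KY"
        using laurent_over_single[OF K, of c 0 J] by (simp add: KY_def regular_at_def)
      then show "c \<in> \<phi> ` KY" by (rule rev_image_eqI) simp
    qed
    show "frozen_vars S \<subseteq> \<phi> ` KY"
    proof
      fix y assume "y \<in> frozen_vars S"
      then obtain j where j: "j \<in> J" "y = seed_x S j" unfolding frozen_vars_def J_def by blast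
      have "sgl (sgl j 1) 1 \<in> KY"
        using laurent_over_single[OF K subring_set_1[OF K], of "sgl j 1" J] j(1)
        by (simp add: KY_def regular_at_def lookup_single when_def)
      then show "y \<in> \<phi> ` KY"
      proof (rule rev_image_eqI)
        have "j \<in> I" using j(1) J_I by blast
        then show "y = \<phi> (sgl (sgl j 1) 1)" by (simp add: seed_pt_def j(2))
      qed
    qed
  qed
  show "\<phi> ` KY \<subseteq> adjoin K (frozen_vars S)"
  proof
    note R = subring_set_adjoin[of K "frozen_vars S"]
    fix b assume "b \<in> \<phi> ` KY"
    then obtain a where a: "a \<in> KY" "b = \<phi> a" by blast
    have "monom_eval (seed_pt S) e \<in> adjoin K (frozen_vars S)" if e: "e \<in> kys a" for e
      unfolding monom_eval_def
    proof (rule subring_set_prod[OF R])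
      fix j assume "j \<in> kys e"
      then have j: "j \<in> J" using a(1) e by (auto simp: KY_def laurent_over_def)
      then have "0 \<le> lkp e j" using a(1) e by (simp add: KY_def regular_at_def)
      moreover have "seed_pt S j \<in> adjoin K (frozen_vars S)"
        using j J_iff frozen_pt by (intro adjoin_incl(2)) blast
      ultimately show "seed_pt S j powi lkp e j \<in> adjoin K (frozen_vars S)"
        unfolding power_int_def by (simp add: subring_set_power[OF R])
    qed
    moreover have "lkp a e \<in> adjoin K (frozen_vars S)" for e
      using a(1) by (intro adjoin_incl(1)) (simp add: KY_def laurent_over_def)
    ultimately show "b \<in> adjoin K (frozen_vars S)"
      unfolding a(2) laurent_eval_alt by (intro subring_set_sum[OF R] subring_set_mult[OF R])
  qed
qed

lemma F_polynomial_prime: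
  "F_polynomial K S z \<in> adjoin K (frozen_vars S) \<and>
   ring_prime\<^bsub>subring_of (adjoin K (frozen_vars S))\<^esub> (F_polynomial K S z)"
proof
  note mult = laurent_eval_mult[OF nz]
  have inj: "a = b" if "a \<in> KY" "b \<in> KY" "\<phi> a = \<phi> b" for a b
    using that KY_LK \<phi>_inj by blast
  show "F_polynomial K S z \<in> adjoin K (frozen_vars S)"
    unfolding F_polynomial_eq adjoin_frozen using F_KY by blast
  show "ring_prime\<^bsub>subring_of (adjoin K (frozen_vars S))\<^esub> (F_polynomial K S z)"
    unfolding F_polynomial_eq adjoin_frozen ring_prime_def
  proof
    have "F = 0" if "\<phi> F = 0"
      using that \<phi>_inj[OF KY_LK[OF F_KY] laurent_over_0[OF K]] by simp
    then show "\<phi> F \<noteq> \<zero>\<^bsub>subring_of (\<phi> ` KY)\<^esub>" using F_nonzero by auto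
    show "prime (subring_of (\<phi> ` KY)) (\<phi> F)"
    proof (rule primeI)
      show "\<phi> F \<notin> Units (subring_of (\<phi> ` KY))"
      proof
        assume "\<phi> F \<in> Units (subring_of (\<phi> ` KY))"
        then obtain q where q: "q \<in> KY" "inverse (\<phi> F) = \<phi> q" "\<phi> F \<noteq> 0" unfolding Units_subring_of by blast
        then have "\<phi> (F * q) = \<phi> 1" using mult right_inverse[OF q(3)] by simp
        then have "F * q = 1" by (rule inj[OF KY_mult[OF F_KY q(1)] KY_1])
        then show False using F_not_unit[OF q(1)] by blast
      qed
    next
      fix a b assume "a \<in> carrier (subring_of (\<phi> ` KY))" "b \<in> carrier (subring_of (\<phi> ` KY))"
      then obtain a' b' where a: "a' \<in> KY" "a = \<phi> a'" and b: "b' \<in> KY" "b = \<phi> b'" by auto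
      assume "\<phi> F divides\<^bsub>subring_of (\<phi> ` KY)\<^esub> (a \<otimes>\<^bsub>subring_of (\<phi> ` KY)\<^esub> b)"
      then obtain q where q: "q \<in> KY" "a * b = \<phi> F * \<phi> q" unfolding factor_def by auto
      have "a' * b' = F * q"
        by (rule inj[OF KY_mult[OF a(1) b(1)] KY_mult[OF F_KY q(1)]]) (use q(2) a b mult in simp)
      from F_prime[OF a(1) b(1) q(1) this]
      show "\<phi> F divides\<^bsub>subring_of (\<phi> ` KY)\<^esub> a \<or> \<phi> F divides\<^bsub>subring_of (\<phi> ` KY)\<^esub> b"
      proof (elim disjE bexE)
        fix r assume "r \<in> KY" "a' = F * r"
        then show ?thesis using a(2) mult unfolding factor_def by auto
      next
        fix r assume "r \<in> KY" "b' = F * r"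
        then show ?thesis using b(2) mult unfolding factor_def by auto
      qed
    qed
  qed
qed

end

theorem theorem3p9:
  fixes K :: "'f::field_char_0 set" and S :: "'f seed" and z :: 'f
  assumes "base_ring K"
    and "is_seed K S"
    and "principal_coefficients S"
    and "factorial_domain (subring_of (cluster_algebra K S))"
    and "z \<in> cluster_variables S" and "z \<notin> exchangeable_vars S"
  shows "F_polynomial K S z \<in> adjoin K (frozen_vars S) \<and>
         ring_prime\<^bsub>subring_of (adjoin K (frozen_vars S))\<^esub> (F_polynomial K S z)"
proof -
  interpret principal_seed K S using assms(1-3) by unfold_locales
  obtain T l where T: "T \<in> mutation_class S" "l \<in> {1..seed_n T}" "z = seed_x T l"
    using assms(5) unfolding cluster_variables_def exchangeable_vars_def by blast
  have l: "l \<in> {1..seed_n S}" using T(2) good_seed_class(2)[OF K S T(1)] by simp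
  have z: "z = seed_pt T l" using T(3) seed_pt_exchangeable[OF T(1) l] by simp
  interpret non_initial_cluster_var K S T l
    by (intro non_initial_cluster_var.intro non_initial_cluster_var_axioms.intro principal_seed_axioms
        assms(4) T(1) l assms(6)[unfolded z])
  show ?thesis unfolding z by (rule F_polynomial_prime)
qed

end
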